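(* Assume $N\ge1$, $k\ge0$, that $a>0$ satisfies $a+2\langle k\rangle+N>2$, and that $0<\alpha,\beta<1$. If either (i) $N=1$ and $a>0$, or (ii) $N\ge2$ and $a\in\{1,2\}$, or (iii) $N=2$, $k\equiv0$ and $a=2/n$ for some $n\in\mathbb{N}$, then there exists a finite positive constant $c(\alpha,\beta)$ such that for all $f\in L^2_{k,a}(\mathbb{R}^N)$ \[\bigl\|\|\cdot\|^{\alpha\cdot\frac a2}f\bigr\|_{L^2_{k,a}}^{\frac{\beta}{\alpha+\beta}}\bigl\|\|\cdot\|^{\beta\cdot\frac a2}\mathcal{F}_{k,a}f\bigr\|_{L^2_{k,a}}^{\frac{\alpha}{\alpha+\beta}}\ge c(\alpha,\beta)\|f\|_{L^2_{k,a}}.\]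
   Context: Let $\langle\cdot,\cdot\rangle$, $\|\cdot\|$ be the Euclidean inner product and norm on $\mathbb{R}^N$. Let $\mathcal{R}\subset\mathbb{R}^N\setminus\{0\}$ be a reduced root system with positive subsystem $\mathcal{R}^+$, let $r_\alpha(x)=x-2\frac{\langle\alpha,x\rangle}{\|\alpha\|^2}\alpha$, let $\mathfrak{C}$ be the finite group generated by the $r_\alpha$, and let $k:\mathcal{R}\to[0,\infty)$, $\alpha\mapsto k_\alpha$, be a $\mathfrak{C}$-invariant (multiplicity) function; $\langle k\rangle=\sum_{\alpha\in\mathcal{R}^+}k_\alpha$. For $a>0$ put $\vartheta_k(x)=\prod_{\alpha\in\mathcal{R}^+}|\langle\alpha,x\rangle|^{2k_\alpha}$, $\vartheta_{k,a}(x)=\|x\|^{a-2}\vartheta_k(x)$, $d\mu_{k,a}(x)=\vartheta_{k,a}(x)\,dx$, $L^p_{k,a}(\mathbb{R}^N)=L^p(\mathbb{R}^N,\mu_{k,a})$. The Dunkl Laplacian is $\Delta_kf(x)=\Delta f(x)+\sum_{\alpha\in\mathcal{R}^+}k_\alpha\bigl(\frac{2\langle\nabla f(x),\alpha\rangle}{\langle\alpha,x\rangle}-\|\alpha\|^2\frac{f(x)-f(r_\alpha x)}{\langle\alpha,x\rangle^2}\bigr)$. If $a+2\langle k\rangle+N>2$, the $(k,a)$-generalized Fourier transform is the unitary operator on $L^2_{k,a}(\mathbb{R}^N)$ given by $\mathcal{F}_{k,a}=\exp\bigl[\frac{i\pi}{2a}(2\langle k\rangle+N+a-2)\bigr]\exp\bigl[\frac{i\pi}{2a}(\|x\|^{2-a}\Delta_k-\|x\|^a)\bigr]$.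 Equivalently, it is the unitary operator determined by $\mathcal{F}_{k,a}\Phi_{\ell}(p,\cdot)=e^{-i\pi(\ell+m/a)}\Phi_\ell(p,\cdot)$ for $\ell,m\in\{0,1,2,\dots\}$ and $p$ a homogeneous polynomial of degree $m$ with $\Delta_kp=0$, where $\Phi_\ell(p,x)=p(x)L_\ell^{(\lambda_m)}(\frac2a\|x\|^a)e^{-\|x\|^a/a}$, $\lambda_m=\frac1a(2m+2\langle k\rangle+N-2)$, and $L_\ell^{(\lambda)}$ are Laguerre polynomials (these functions span a dense subspace). Weighted norms may take the value $+\infty$. *)

theory Defs
  imports "HOL-Analysis.Analysis"
begin

section \<open>Root systems and multiplicity functions\<close>

definition root_reflection :: "'a::euclidean_space \<Rightarrow> 'a \<Rightarrow> 'a" where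
  "root_reflection \<alpha> x = x - (2 * (\<alpha> \<bullet> x) / (norm \<alpha>)\<^sup>2) *\<^sub>R \<alpha>"

text \<open>As usual in Dunkl theory, neither crystallographic nor spanning.\<close>

definition reduced_root_system :: "'a::euclidean_space set \<Rightarrow> bool" where
  "reduced_root_system R \<longleftrightarrow>
     finite R \<and> 0 \<notin> R \<and>
     (\<forall>\<alpha>\<in>R. R \<inter> span {\<alpha>} = {\<alpha>, -\<alpha>}) \<and>
     (\<forall>\<alpha>\<in>R. root_reflection \<alpha> ` R = R)"

definition positive_subsystem :: "'a::euclidean_space set \<Rightarrow> 'a set \<Rightarrow> bool" where
  "positive_subsystem R P \<longleftrightarrow>
     (\<exists>u. (\<forall>\<alpha>\<in>R. \<alpha> \<bullet> u \<noteq> 0) \<and> P = {\<alpha>\<in>R. \<alpha> \<bullet> u > 0})"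

text \<open>Reflections are involutions, so closure under composition already gives the
  generated group.\<close>

inductive_set reflection_group :: "'a::euclidean_space set \<Rightarrow> ('a \<Rightarrow> 'a) set"
  for R :: "'a set" where
  one: "id \<in> reflection_group R"
| refl: "\<alpha> \<in> R \<Longrightarrow> g \<in> reflection_group R \<Longrightarrow> root_reflection \<alpha> \<circ> g \<in> reflection_group R"

definition multiplicity_function :: "'a::euclidean_space set \<Rightarrow> ('a \<Rightarrow> real) \<Rightarrow> bool" where
  "multiplicity_function R k \<longleftrightarrow>
     (\<forall>\<alpha>\<in>R. k \<alpha> \<ge> 0) \<and> (\<forall>g\<in>reflection_group R. \<forall>\<alpha>\<in>R. k (g \<alpha>) = k \<alpha>)"

section \<open>The weighted measure and its space of square integrable functions\<close>

text \<open>\<open>P\<close> is always the positive subsystem. Since \<open>0 powr t = 0\<close> for every \<open>t\<close>, the density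
  below departs from the usual conventions only on the Lebesgue null set consisting of
  the origin and the hyperplanes orthogonal to the roots.\<close>

definition ka_density :: "'a::euclidean_space set \<Rightarrow> ('a \<Rightarrow> real) \<Rightarrow> real \<Rightarrow> 'a \<Rightarrow> real" where
  "ka_density P k a x = norm x powr (a - 2) * (\<Prod>\<alpha>\<in>P. \<bar>\<alpha> \<bullet> x\<bar> powr (2 * k \<alpha>))"

definition ka_measure :: "'a::euclidean_space set \<Rightarrow> ('a \<Rightarrow> real) \<Rightarrow> real \<Rightarrow> 'a measure" where
  "ka_measure P k a = density lborel (\<lambda>x. ennreal (ka_density P k a x))"

text \<open>Square integrable functions are not quotiented by equality almost everywhere;
  that identification is made explicit where it matters.\<close>

definition L2_functions :: "'a measure \<Rightarrow> ('a \<Rightarrow> complex) set" where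
  "L2_functions M = {f \<in> borel_measurable M. integrable M (\<lambda>x. (norm (f x))\<^sup>2)}"

text \<open>Used only for exponents \<open>p > 0\<close>, so that infinity to the power \<open>p\<close> is infinity.\<close>

definition ennreal_powr :: "ennreal \<Rightarrow> real \<Rightarrow> ennreal" where
  "ennreal_powr x p = (if x = \<infinity> then \<infinity> else ennreal (enn2real x powr p))"

definition L2_norm_ennreal :: "'a measure \<Rightarrow> ('a \<Rightarrow> complex) \<Rightarrow> ennreal" where
  "L2_norm_ennreal M f = ennreal_powr (\<integral>\<^sup>+x. ennreal ((norm (f x))\<^sup>2) \<partial>M) (1/2)"

text \<open>The second and third clauses make the operator well defined on classes modulo
  equality almost everywhere.\<close>

definition unitary_on_L2 :: "'a measure \<Rightarrow> (('a \<Rightarrow> complex) \<Rightarrow> ('a \<Rightarrow> complex)) \<Rightarrow> bool" where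
  "unitary_on_L2 M U \<longleftrightarrow>
     (\<forall>f\<in>L2_functions M. U f \<in> L2_functions M) \<and>
     (\<forall>f\<in>L2_functions M. \<forall>g\<in>L2_functions M. \<forall>c d.
        AE x in M. U (\<lambda>y. c * f y + d * g y) x = c * U f x + d * U g x) \<and>
     (\<forall>f\<in>L2_functions M. \<forall>g\<in>L2_functions M.
        (LINT x|M. U f x * cnj (U g x)) = (LINT x|M. f x * cnj (g x))) \<and>
     (\<forall>g\<in>L2_functions M. \<exists>f\<in>L2_functions M. AE x in M. U f x = g x)"

section \<open>The Dunkl Laplacian and its homogeneous harmonic polynomials\<close>

definition laplacian :: "('a::euclidean_space \<Rightarrow> 'b::real_normed_vector) \<Rightarrow> 'a \<Rightarrow> 'b" where
  "laplacian f x =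
     (\<Sum>b\<in>Basis. frechet_derivative (\<lambda>y. frechet_derivative f (at y) b) (at x) b)"

text \<open>The derivative of \<open>f\<close> at \<open>x\<close> in direction \<open>\<alpha>\<close> is the pairing of the gradient with
  \<open>\<alpha>\<close>. The formula is meaningful only off the hyperplanes orthogonal to the roots.\<close>

definition dunkl_laplacian ::
    "'a::euclidean_space set \<Rightarrow> ('a \<Rightarrow> real) \<Rightarrow> ('a \<Rightarrow> complex) \<Rightarrow> 'a \<Rightarrow> complex" where
  "dunkl_laplacian P k f x =
     laplacian f x +
     (\<Sum>\<alpha>\<in>P. of_real (k \<alpha>) *
        (2 * frechet_derivative f (at x) \<alpha> / of_real (\<alpha> \<bullet> x)
         - of_real ((norm \<alpha>)\<^sup>2) * (f x - f (root_reflection \<alpha> x)) / of_real ((\<alpha> \<bullet> x)\<^sup>2)))"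

definition homogeneous_polynomial :: "nat \<Rightarrow> ('a::euclidean_space \<Rightarrow> complex) \<Rightarrow> bool" where
  "homogeneous_polynomial m p \<longleftrightarrow>
     polynomial_function p \<and> (\<forall>t x. p (t *\<^sub>R x) = of_real (t ^ m) * p x)"

text \<open>For a polynomial, the Dunkl Laplacian off the hyperplanes extends to a polynomial, so
  vanishing there is vanishing of that polynomial. At points of the hyperplanes the formula
  evaluated with \<open>z / 0 = 0\<close> would be a spurious condition.\<close>

definition dunkl_harmonic ::
    "'a::euclidean_space set \<Rightarrow> ('a \<Rightarrow> real) \<Rightarrow> ('a \<Rightarrow> complex) \<Rightarrow> bool" where
  "dunkl_harmonic P k p \<longleftrightarrow>
     (\<forall>x. (\<forall>\<alpha>\<in>P. \<alpha> \<bullet> x \<noteq> 0) \<longrightarrow> dunkl_laplacian P k p x = 0)"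

section \<open>The generalized Fourier transform\<close>

definition laguerre :: "nat \<Rightarrow> real \<Rightarrow> real \<Rightarrow> real" where
  "laguerre l \<nu> t =
     (\<Sum>j\<le>l. (-1) ^ j * ((real l + \<nu>) gchoose (l - j)) * t ^ j / fact j)"

definition ka_lambda :: "'a::euclidean_space set \<Rightarrow> ('a \<Rightarrow> real) \<Rightarrow> real \<Rightarrow> nat \<Rightarrow> real" where
  "ka_lambda P k a m = (2 * real m + 2 * (\<Sum>\<alpha>\<in>P. k \<alpha>) + real DIM('a) - 2) / a"

definition ka_Phi ::
    "'a::euclidean_space set \<Rightarrow> ('a \<Rightarrow> real) \<Rightarrow> real \<Rightarrow> nat \<Rightarrow> nat \<Rightarrow> ('a \<Rightarrow> complex) \<Rightarrow> 'a \<Rightarrow> complex"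
  where
  "ka_Phi P k a l m p x =
     p x * of_real (laguerre l (ka_lambda P k a m) (2 / a * norm x powr a)
                    * exp (- (norm x powr a) / a))"

text \<open>The transform is the unitary operator, unique up to equality almost everywhere, that is
  diagonal on the functions above, whose linear span is dense.\<close>

definition is_ka_fourier ::
    "'a::euclidean_space set \<Rightarrow> ('a \<Rightarrow> real) \<Rightarrow> real \<Rightarrow> (('a \<Rightarrow> complex) \<Rightarrow> ('a \<Rightarrow> complex)) \<Rightarrow> bool"
  where
  "is_ka_fourier P k a F \<longleftrightarrow>
     unitary_on_L2 (ka_measure P k a) F \<and>
     (\<forall>l m p. homogeneous_polynomial m p \<and> dunkl_harmonic P k p \<longrightarrow>
        (AE x in ka_measure P k a.
           F (ka_Phi P k a l m p) x
             = cis (- pi * (real l + real m / a)) * ka_Phi P k a l m p x))"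

end

theory Submission
  imports Defs
begin

text \<open>Put \<open>A x = norm x powr a / a\<close>. In the Laguerre generating function the eigenvalue relation
  says that the transform sends \<open>p x * exp (- z * A x)\<close>, with \<open>p\<close> a \<open>k\<close>-harmonic homogeneous
  polynomial of degree \<open>m\<close>, to a unimodular multiple of
  \<open>z powr (- \<lambda> - 1) * p x * exp (- A x / z)\<close>, where \<open>\<lambda>\<close> is \<open>ka_lambda P k a m\<close>. On the span of these
  Gaussians the energy \<open>B g\<close>, the integral of \<open>A\<close> times the squared modulus of the transform of \<open>g\<close>,
  is therefore a weighted Dirichlet form in the radial variable, and an integration by parts against
  \<open>exp (- t * A x)\<close>, which is an identity between Gaussian integrals, bounds the squared norm of \<open>g\<close>
  by a constant times the integral of \<open>min 1 (t * A x)\<close> against the squared modulus of \<open>g\<close> plus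
  \<open>B g / t\<close>. The constant does not depend on the degrees because \<open>\<lambda>\<close> increases with \<open>m\<close>.

  The span is dense, even for the measure with the additional density \<open>1 + A x / t\<close>, by the Fischer
  decomposition of polynomials into \<open>k\<close>-harmonics and the Weierstrass theorems. Approximating the
  function whose transform is that of \<open>f\<close> divided by \<open>1 + A x / t\<close> extends the bound to all \<open>f\<close>, with
  \<open>min 1 (A x / t)\<close> as the weight of the transform. Since \<open>min 1 y\<close> is at most \<open>y powr s\<close> for
  \<open>0 < s\<close> and \<open>s \<le> 1\<close>, choosing \<open>t\<close> optimally gives the theorem.\<close>

section \<open>Polynomials and the Dunkl Laplacian\<close>

text \<open>Only two facts about the transform enter: it is unitary, and it is known on Gaussians.
  The orthogonality of harmonics of different degrees, on which both the Dirichlet form and the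
  integration by parts rest, is extracted from them: unitarity and the scaling of Gaussian integrals
  would otherwise disagree. The obstacle is the passage to general \<open>f\<close>. The energy may
  be infinite there and is not continuous for the L2 norm, so density in L2 alone does not carry the
  inequality over. Division of the transform by \<open>1 + A x / t\<close> makes the energy finite;
  both the resulting energy and the change of the function cost at most the weight
  \<open>min 1 (A x / t)\<close>. Approximating for the density \<open>1 + A x / t\<close> keeps the
  energy under control as well. On the other side the truncated weight enters through
  \<open>1 \<le> exp (- y) + min 1 y\<close> and \<open>y * exp (- y) \<le> min 1 y\<close>. The
  outcome has truncated weights on both sides and a free scale \<open>t\<close>, so one inequality
  serves all pairs of exponents.\<close>

lemma polynomial_function_cmult:
  fixes f :: "'a::real_normed_vector \<Rightarrow> complex"
  assumes "polynomial_function f"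
  shows "polynomial_function (\<lambda>x. c * f x)"
  using polynomial_function_compose[OF assms polynomial_function_bounded_linear[OF bounded_linear_mult_right[of c]]]
  by (simp add: o_def)

lemma polynomial_function_norm_power2:
  "polynomial_function (\<lambda>x::'a::euclidean_space. (norm x)\<^sup>2)"
proof -
  have "real_polynomial_function (\<lambda>x::'a. \<Sum>b\<in>Basis. (x \<bullet> b)^2)"
    by (intro real_polynomial_function_sum real_polynomial_function_power real_polynomial_function.intros(1))
       (auto simp: bounded_linear_inner_left)
  moreover have "(\<lambda>x::'a. \<Sum>b\<in>Basis. (x \<bullet> b)^2) = (\<lambda>x. (norm x)\<^sup>2)"
    unfolding power2_norm_eq_inner by (subst euclidean_inner) (simp only: power2_eq_square)
  ultimately show ?thesis
    by (simp add: real_polynomial_function_eq)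
qed

text \<open>The step \<open>s x\<close> may depend on \<open>x\<close>, because a reflection moves
  \<open>x\<close> along the root by an amount linear in \<open>x\<close>. The remainder must be
  \<open>(s x)\<^sup>2\<close> times a polynomial, so that it survives division by the square of
  that amount. Sums and products of such expansions are again of this form.\<close>

lemma real_polynomial_taylor_along:
  fixes f s :: "'a::real_normed_vector \<Rightarrow> real"
  assumes "real_polynomial_function f" "real_polynomial_function s"
  shows "\<exists>D q. real_polynomial_function D \<and> real_polynomial_function q \<and>
    (\<forall>x. \<exists>f'. (f has_derivative f') (at x) \<and> f' v = D x) \<and>
    (\<forall>x. f (x - s x *\<^sub>R v) = f x - s x * D x + (s x)\<^sup>2 * q x)"
  using assms(1)
proof (induction rule: real_polynomial_function.induct)
  case (linear f)
  then interpret bounded_linear f .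
  have "\<exists>f'. (f has_derivative f') (at x) \<and> f' v = f v" for x
    using bounded_linear_imp_has_derivative[OF bounded_linear_axioms] by blast
  then show ?case
    by (intro exI[of _ "\<lambda>x. f v"] exI[of _ "\<lambda>x. 0"])
       (simp add: diff scaleR real_polynomial_function.intros(2))
next
  case (const c)
  have "\<exists>f'. ((\<lambda>x::'a. c) has_derivative f') (at x) \<and> f' v = 0" for x
    using has_derivative_const by metis
  then show ?case
    by (intro exI[of _ "\<lambda>x. 0"]) (simp add: real_polynomial_function.intros(2))
next
  case (add f g)
  then obtain D q D' q' where *: "real_polynomial_function D" "real_polynomial_function q"
     "\<forall>x. \<exists>f'. (f has_derivative f') (at x) \<and> f' v = D x"
     "\<forall>x. f (x - s x *\<^sub>R v) = f x - s x * D x + (s x)\<^sup>2 * q x"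
     "real_polynomial_function D'" "real_polynomial_function q'"
     "\<forall>x. \<exists>f'. (g has_derivative f') (at x) \<and> f' v = D' x"
     "\<forall>x. g (x - s x *\<^sub>R v) = g x - s x * D' x + (s x)\<^sup>2 * q' x"
    by blast
  have "\<exists>f'. ((\<lambda>x. f x + g x) has_derivative f') (at x) \<and> f' v = D x + D' x" for x
  proof -
    obtain f' g' where "(f has_derivative f') (at x)" "f' v = D x" "(g has_derivative g') (at x)" "g' v = D' x"
      using *(3,7) by blast
    then show ?thesis
      by (intro exI[of _ "\<lambda>y. f' y + g' y"]) (simp add: has_derivative_add)
  qed
  moreover have "f (x - s x *\<^sub>R v) + g (x - s x *\<^sub>R v) = f x + g x - s x * (D x + D' x) + (s x)\<^sup>2 * (q x + q' x)" for x
    unfolding *(4)[rule_format] *(8)[rule_format] by (simp add: algebra_simps)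
  ultimately show ?case
    using real_polynomial_function.intros(3)[OF *(1) *(5)] real_polynomial_function.intros(3)[OF *(2) *(6)]
    by (intro exI[of _ "\<lambda>x. D x + D' x"] exI[of _ "\<lambda>x. q x + q' x"]) simp
next
  case (mult f g)
  then obtain D q D' q' where *: "real_polynomial_function D" "real_polynomial_function q"
     "\<forall>x. \<exists>f'. (f has_derivative f') (at x) \<and> f' v = D x"
     "\<forall>x. f (x - s x *\<^sub>R v) = f x - s x * D x + (s x)\<^sup>2 * q x"
     "real_polynomial_function D'" "real_polynomial_function q'"
     "\<forall>x. \<exists>f'. (g has_derivative f') (at x) \<and> f' v = D' x"
     "\<forall>x. g (x - s x *\<^sub>R v) = g x - s x * D' x + (s x)\<^sup>2 * q' x"
    by blast
  let ?D = "\<lambda>x. f x * D' x + D x * g x"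
  \<comment> \<open>The coefficient of \<open>(s x)\<^sup>2\<close> in the product of the two
    expansions; terms of order three and four keep their extra factors \<open>s x\<close> inside
    it.\<close>
  let ?q = "\<lambda>x. q x * g x + f x * q' x + D x * D' x - s x * (D x * q' x + q x * D' x) + s x * s x * (q x * q' x)"
  have "\<exists>f'. ((\<lambda>x. f x * g x) has_derivative f') (at x) \<and> f' v = ?D x" for x
  proof -
    obtain f' g' where "(f has_derivative f') (at x)" "f' v = D x" "(g has_derivative g') (at x)" "g' v = D' x"
      using *(3,7) by blast
    then show ?thesis
      by (intro exI[of _ "\<lambda>y. f x * g' y + f' y * g x"]) (simp add: has_derivative_mult)
  qed
  moreover have "f (x - s x *\<^sub>R v) * g (x - s x *\<^sub>R v) = f x * g x - s x * ?D x + (s x)\<^sup>2 * ?q x" for x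
    unfolding *(4)[rule_format] *(8)[rule_format] by (simp add: algebra_simps power2_eq_square)
  moreover have "real_polynomial_function ?D" "real_polynomial_function ?q"
    by (intro real_polynomial_function.intros(3,4) real_polynomial_function_diff mult.hyps *(1,2,5,6) assms(2))+
  ultimately show ?case by blast
qed

lemma polynomial_function_of_real_complex:
  assumes "real_polynomial_function (f :: 'a::real_normed_vector \<Rightarrow> real)"
  shows "polynomial_function (\<lambda>x. of_real (f x) :: complex)"
proof -
  have "polynomial_function (\<lambda>x. f x *\<^sub>R (1::complex))"
    using assms by (intro polynomial_function_mult) (auto simp: real_polynomial_function_eq)
  then show ?thesis by (simp add: scaleR_conv_of_real)
qed

lemma polynomial_taylor_along:
  fixes f :: "'a::real_normed_vector \<Rightarrow> complex"
  assumes "polynomial_function f" "real_polynomial_function s"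
  shows "\<exists>D q. polynomial_function D \<and> polynomial_function q \<and>
    (\<forall>x. frechet_derivative f (at x) v = D x) \<and>
    (\<forall>x. f (x - s x *\<^sub>R v) = f x - of_real (s x) * D x + of_real ((s x)\<^sup>2) * q x)"
proof -
  have "real_polynomial_function (\<lambda>x. Re (f x))" "real_polynomial_function (\<lambda>x. Im (f x))"
    using assms(1) bounded_linear_Re bounded_linear_Im by (auto simp: polynomial_function_def o_def)
  from this[THEN real_polynomial_taylor_along[OF _ assms(2)], of v]
  obtain D q D' q' where *: "real_polynomial_function D" "real_polynomial_function q"
     "\<forall>x. \<exists>f'. ((\<lambda>x. Re (f x)) has_derivative f') (at x) \<and> f' v = D x"
     "\<forall>x. Re (f (x - s x *\<^sub>R v)) = Re (f x) - s x * D x + (s x)\<^sup>2 * q x"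
     "real_polynomial_function D'" "real_polynomial_function q'"
     "\<forall>x. \<exists>f'. ((\<lambda>x. Im (f x)) has_derivative f') (at x) \<and> f' v = D' x"
     "\<forall>x. Im (f (x - s x *\<^sub>R v)) = Im (f x) - s x * D' x + (s x)\<^sup>2 * q' x"
    by blast
  have "polynomial_function (\<lambda>x. of_real (D x) + \<i> * of_real (D' x))"
       "polynomial_function (\<lambda>x. of_real (q x) + \<i> * of_real (q' x))"
    using * by (intro polynomial_function_add polynomial_function_cmult polynomial_function_of_real_complex; simp)+
  moreover have "frechet_derivative f (at x) v = of_real (D x) + \<i> * of_real (D' x)" for x
  proof -
    obtain f1 f2 where f: "((\<lambda>x. Re (f x)) has_derivative f1) (at x)" "f1 v = D x"
      "((\<lambda>x. Im (f x)) has_derivative f2) (at x)" "f2 v = D' x"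
      using *(3,7) by blast
    have "(f has_derivative (\<lambda>y. of_real (f1 y) + \<i> * of_real (f2 y))) (at x)"
      using has_derivative_add[OF has_derivative_of_real[OF f(1)]
          has_derivative_mult_right[OF has_derivative_of_real[OF f(3)], of "\<i>"]]
      by (simp flip: complex_eq)
    from fun_cong[OF frechet_derivative_at[OF this], of v] f(2,4) show ?thesis by simp
  qed
  moreover have "f (x - s x *\<^sub>R v) = f x - of_real (s x) * (of_real (D x) + \<i> * of_real (D' x))
      + of_real ((s x)\<^sup>2) * (of_real (q x) + \<i> * of_real (q' x))" for x
    using *(4,8) by (simp add: complex_eq_iff)
  ultimately show ?thesis by blast
qed

lemma frechet_derivative_polynomial_works:
  fixes f :: "'a::euclidean_space \<Rightarrow> complex"
  assumes "polynomial_function f"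
  shows "(f has_derivative frechet_derivative f (at x)) (at x)"
  using differentiable_at_polynomial_function[OF assms] by (simp add: frechet_derivative_works)

lemma polynomial_function_frechet_derivative:
  fixes f :: "'a::euclidean_space \<Rightarrow> complex"
  assumes "polynomial_function f"
  shows "polynomial_function (\<lambda>x. frechet_derivative f (at x) v)"
proof -
  obtain D where "polynomial_function D" "\<forall>x. frechet_derivative f (at x) v = D x"
    using polynomial_taylor_along[OF assms real_polynomial_function.intros(2)[of 0], of v] by blast
  then show ?thesis by simp
qed

lemma norm_root_reflection: "norm (root_reflection \<alpha> x) = norm x"
proof (cases "\<alpha> = 0")
  case False
  define s where "s = 2 * (\<alpha> \<bullet> x) / (norm \<alpha>)\<^sup>2"
  have s: "s * (\<alpha> \<bullet> \<alpha>) = 2 * (\<alpha> \<bullet> x)"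
    using False by (simp add: s_def dot_square_norm)
  have "(x - s *\<^sub>R \<alpha>) \<bullet> (x - s *\<^sub>R \<alpha>) = x \<bullet> x - 2 * s * (\<alpha> \<bullet> x) + s * (s * (\<alpha> \<bullet> \<alpha>))"
    by (simp add: inner_diff_left inner_diff_right inner_commute)
  also have "\<dots> = x \<bullet> x" unfolding s by simp
  finally show ?thesis by (simp add: norm_eq_sqrt_inner root_reflection_def s_def)
qed (simp add: root_reflection_def)

text \<open>The poles cancel. With \<open>t = \<alpha> \<bullet> x\<close> and
  \<open>n = (norm \<alpha>)\<^sup>2\<close> the reflection is a step of length factor
  \<open>2 * t / n\<close> along \<open>\<alpha>\<close>. The first-order term of the expansion at
  the reflected point removes \<open>2 * D x / t\<close>, and the second-order term leaves the
  polynomial \<open>4 / n * q x\<close>.\<close>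

lemma dunkl_laplacian_polynomial:
  fixes f :: "'a::euclidean_space \<Rightarrow> complex"
  assumes f: "polynomial_function f" and P: "finite P" "0 \<notin> P"
  obtains q where "polynomial_function q"
    "\<And>x. (\<forall>\<alpha>\<in>P. \<alpha> \<bullet> x \<noteq> 0) \<Longrightarrow> dunkl_laplacian P k f x = q x"
proof -
  let ?t = "\<lambda>\<alpha> x. 2 * frechet_derivative f (at x) \<alpha> / of_real (\<alpha> \<bullet> x)
         - of_real ((norm \<alpha>)\<^sup>2) * (f x - f (root_reflection \<alpha> x)) / of_real ((\<alpha> \<bullet> x)\<^sup>2)"
  have "\<exists>q. polynomial_function q \<and> (\<forall>x. \<alpha> \<bullet> x \<noteq> 0 \<longrightarrow> ?t \<alpha> x = q x)"
    if "\<alpha> \<in> P" for \<alpha>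
  proof -
    have "\<alpha> \<noteq> 0" using that P by auto
    let ?s = "\<lambda>x. 2 * (\<alpha> \<bullet> x) / (norm \<alpha>)\<^sup>2"
    have "?s = (\<lambda>x. ((2 / (norm \<alpha>)\<^sup>2) *\<^sub>R \<alpha>) \<bullet> x)" by auto
    then have "real_polynomial_function ?s"
      by (simp only: real_polynomial_function.intros(1) bounded_linear_inner_right)
    from polynomial_taylor_along[OF f this, of \<alpha>] obtain D q where
      *: "polynomial_function D" "polynomial_function q" "\<forall>x. frechet_derivative f (at x) \<alpha> = D x"
      "\<forall>x. f (x - ?s x *\<^sub>R \<alpha>) = f x - of_real (?s x) * D x + of_real ((?s x)\<^sup>2) * q x"
      by blast
    show ?thesis
    proof (intro exI[of _ "\<lambda>x. of_real (4 / (norm \<alpha>)\<^sup>2) * q x"] conjI polynomial_function_cmult *(2) allI impI)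
      fix x assume "\<alpha> \<bullet> x \<noteq> 0"
      moreover define N where "N = complex_of_real ((norm \<alpha>)\<^sup>2)"
      moreover define t where "t = complex_of_real (\<alpha> \<bullet> x)"
      ultimately have nz: "N \<noteq> 0" "t \<noteq> 0" using \<open>\<alpha> \<noteq> 0\<close> by auto
      have "2 * D x / t - N * (f x - (f x - (2 * t / N) * D x + (2 * t / N)\<^sup>2 * q x)) / t\<^sup>2 = 4 / N * q x"
        using nz by (simp add: divide_simps power2_eq_square) (simp add: algebra_simps)
      then show "?t \<alpha> x = of_real (4 / (norm \<alpha>)\<^sup>2) * q x"
        unfolding root_reflection_def *(3)[rule_format] *(4)[rule_format] N_def t_def by simp
    qed
  qed
  then have "\<forall>\<alpha>\<in>P. \<exists>q. polynomial_function q \<and> (\<forall>x. \<alpha> \<bullet> x \<noteq> 0 \<longrightarrow> ?t \<alpha> x = q x)"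
    by blast
  from bchoice[OF this] obtain T where
    T: "\<forall>\<alpha>\<in>P. polynomial_function (T \<alpha>) \<and> (\<forall>x. \<alpha> \<bullet> x \<noteq> 0 \<longrightarrow> ?t \<alpha> x = T \<alpha> x)"
    by blast
  show ?thesis
  proof (rule that[of "\<lambda>x. laplacian f x + (\<Sum>\<alpha>\<in>P. of_real (k \<alpha>) * T \<alpha> x)"])
    show "polynomial_function (\<lambda>x. laplacian f x + (\<Sum>\<alpha>\<in>P. of_real (k \<alpha>) * T \<alpha> x))"
      unfolding laplacian_def using f T P(1)
      by (intro polynomial_function_add polynomial_function_sum polynomial_function_frechet_derivative
          polynomial_function_cmult) auto
  qed (use T in \<open>auto simp: dunkl_laplacian_def intro!: sum.cong\<close>)
qed

section \<open>Linearity, radial factors and scaling of the Dunkl Laplacian\<close>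

lemma frechet_derivative_polynomial_lincomb:
  fixes f g :: "'a::euclidean_space \<Rightarrow> complex"
  assumes "polynomial_function f" "polynomial_function g"
  shows "frechet_derivative (\<lambda>x. f x + c * g x) (at x) v
    = frechet_derivative f (at x) v + c * frechet_derivative g (at x) v"
  using fun_cong[OF frechet_derivative_at[OF has_derivative_add[OF frechet_derivative_polynomial_works[OF assms(1), of x]
        has_derivative_mult_right[OF frechet_derivative_polynomial_works[OF assms(2)], of c]]], of v] by simp

lemma laplacian_lincomb:
  fixes f g :: "'a::euclidean_space \<Rightarrow> complex"
  assumes "polynomial_function f" "polynomial_function g"
  shows "laplacian (\<lambda>x. f x + c * g x) x = laplacian f x + c * laplacian g x"
  unfolding laplacian_def frechet_derivative_polynomial_lincomb[OF assms]
    frechet_derivative_polynomial_lincomb[OF assms[THEN polynomial_function_frechet_derivative]]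
  by (simp only: sum.distrib sum_distrib_left)

lemma dunkl_laplacian_lincomb:
  fixes f g :: "'a::euclidean_space \<Rightarrow> complex"
  assumes "polynomial_function f" "polynomial_function g"
  shows "dunkl_laplacian P k (\<lambda>x. f x + c * g x) x = dunkl_laplacian P k f x + c * dunkl_laplacian P k g x"
proof -
  have *: "of_real (k \<alpha>) *
      (2 * (f' + c * g') / b - n * (f1 + c * g1 - (f2 + c * g2)) / b2)
    = of_real (k \<alpha>) * (2 * f' / b - n * (f1 - f2) / b2)
      + c * (of_real (k \<alpha>) * (2 * g' / b - n * (g1 - g2) / b2))" for f' g' b n f1 f2 g1 g2 b2 \<alpha>
    by (simp add: divide_inverse algebra_simps)
  show ?thesis
    unfolding dunkl_laplacian_def laplacian_lincomb[OF assms] frechet_derivative_polynomial_lincomb[OF assms] *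
    by (simp only: sum.distrib sum_distrib_left[symmetric] distrib_left add.assoc add.left_commute)
qed

lemma dunkl_laplacian_zero [simp]: "dunkl_laplacian P k (\<lambda>x. 0) x = 0"
  by (simp add: dunkl_laplacian_def laplacian_def)

text \<open>Euler's identity: both sides are the derivative of \<open>f (t *\<^sub>R x)\<close> in
  \<open>t\<close> at \<open>1\<close>.\<close>

lemma homogeneous_euler:
  fixes f :: "'a::euclidean_space \<Rightarrow> complex"
  assumes "homogeneous_polynomial m f"
  shows "frechet_derivative f (at x) x = of_nat m * f x"
proof -
  have f: "polynomial_function f" and h: "\<And>t x. f (t *\<^sub>R x) = of_real (t ^ m) * f x"
    using assms unfolding homogeneous_polynomial_def by blast+
  have 1: "((\<lambda>t. f (t *\<^sub>R x)) has_derivative (\<lambda>s. frechet_derivative f (at x) (s *\<^sub>R x))) (at 1)"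
    by (rule has_derivative_compose[of "\<lambda>t. t *\<^sub>R x" _ 1 UNIV f])
       (auto intro!: derivative_eq_intros frechet_derivative_polynomial_works f)
  have 2: "((\<lambda>t. of_real (t ^ m) * f x) has_derivative (\<lambda>s. of_real (real m * s) * f x)) (at 1)"
    by (auto intro!: derivative_eq_intros)
  have "(\<lambda>s. frechet_derivative f (at x) (s *\<^sub>R x)) = (\<lambda>s. of_real (real m * s) * f x)"
    using has_derivative_unique 1 2 unfolding h by blast
  from fun_cong[OF this, of 1] show ?thesis by simp
qed

lemma frechet_derivative_norm_power2_mult:
  fixes f :: "'a::euclidean_space \<Rightarrow> complex"
  assumes "polynomial_function f"
  shows "frechet_derivative (\<lambda>x. of_real ((norm x)\<^sup>2) * f x) (at x) v
    = of_real (2 * (x \<bullet> v)) * f x + of_real ((norm x)\<^sup>2) * frechet_derivative f (at x) v"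
proof -
  have "((\<lambda>x::'a. (norm x)\<^sup>2) has_derivative (\<lambda>v. 2 * (x \<bullet> v))) (at x)"
    unfolding power2_norm_eq_inner by (auto intro!: derivative_eq_intros simp: inner_commute)
  from fun_cong[OF frechet_derivative_at[OF has_derivative_mult[OF has_derivative_of_real[OF this, where 'a=complex]
    frechet_derivative_polynomial_works[OF assms]]], of v]
  show ?thesis by (simp add: add.commute)
qed

lemma polynomial_function_norm_power2_mult:
  fixes f :: "'a::euclidean_space \<Rightarrow> complex"
  assumes "polynomial_function f"
  shows "polynomial_function (\<lambda>x. of_real ((norm x)\<^sup>2) * f x)"
  using polynomial_function_mult[OF polynomial_function_norm_power2 assms] by (simp add: scaleR_conv_of_real)

text \<open>The cross terms of the product rule add up to four times the derivative in direction
  \<open>x\<close>, which Euler's identity evaluates. The summand with the dimension is the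
  Laplacian of the squared norm.\<close>

lemma laplacian_norm_power2_mult:
  fixes f :: "'a::euclidean_space \<Rightarrow> complex"
  assumes f: "homogeneous_polynomial d f"
  shows "laplacian (\<lambda>x. of_real ((norm x)\<^sup>2) * f x) x
    = of_real (2 * real DIM('a) + 4 * real d) * f x + of_real ((norm x)\<^sup>2) * laplacian f x"
proof -
  have pf: "polynomial_function f" using f unfolding homogeneous_polynomial_def by (rule conjunct1)
  let ?D = "\<lambda>b x. frechet_derivative f (at x) b"
  have pD: "polynomial_function (?D b)" for b
    using polynomial_function_frechet_derivative[OF pf] .
  have lin: "((\<lambda>x. of_real (2 * (x \<bullet> b)) * f x) has_derivative
     (\<lambda>v. of_real (2 * (v \<bullet> b)) * f x + of_real (2 * (x \<bullet> b)) * frechet_derivative f (at x) v)) (at x)" for x b :: 'a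
  proof -
    have "((\<lambda>x. 2 * (x \<bullet> b)) has_derivative (\<lambda>v. 2 * (v \<bullet> b))) (at x)"
      by (auto intro!: derivative_eq_intros)
    from has_derivative_mult[OF has_derivative_of_real[OF this, where 'a=complex]
      frechet_derivative_polynomial_works[OF pf, of x]]
    show ?thesis by (simp only: add.commute)
  qed
  have "frechet_derivative (\<lambda>x. frechet_derivative (\<lambda>x. of_real ((norm x)\<^sup>2) * f x) (at x) b) (at x) b
     = of_real (2 * (b \<bullet> b)) * f x + 2 * (of_real (2 * (x \<bullet> b)) * ?D b x)
       + of_real ((norm x)\<^sup>2) * frechet_derivative (?D b) (at x) b" for b :: 'a
  proof -
    have "((\<lambda>x. of_real (2 * (x \<bullet> b)) * f x + of_real ((norm x)\<^sup>2) * ?D b x) has_derivative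
       (\<lambda>v. (of_real (2 * (v \<bullet> b)) * f x + of_real (2 * (x \<bullet> b)) * frechet_derivative f (at x) v)
         + (of_real (2 * (x \<bullet> v)) * ?D b x + of_real ((norm x)\<^sup>2) * frechet_derivative (?D b) (at x) v))) (at x)"
      using frechet_derivative_polynomial_works[OF polynomial_function_norm_power2_mult[OF pD[of b]], of x]
      unfolding frechet_derivative_norm_power2_mult[OF pD[of b], abs_def]
      by (intro has_derivative_add lin)
    from fun_cong[OF frechet_derivative_at[OF this], of b]
    have "frechet_derivative (\<lambda>x. of_real (2 * (x \<bullet> b)) * f x + of_real ((norm x)\<^sup>2) * ?D b x) (at x) b
      = (of_real (2 * (b \<bullet> b)) * f x + of_real (2 * (x \<bullet> b)) * ?D b x)
         + (of_real (2 * (x \<bullet> b)) * ?D b x + of_real ((norm x)\<^sup>2) * frechet_derivative (?D b) (at x) b)"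
      by (rule sym)
    then show ?thesis unfolding frechet_derivative_norm_power2_mult[OF pf] by simp
  qed
  then have "laplacian (\<lambda>x. of_real ((norm x)\<^sup>2) * f x) x
    = (\<Sum>b\<in>(Basis :: 'a set). of_real (2 * (b \<bullet> b)) * f x) + 4 * (\<Sum>b\<in>Basis. of_real (x \<bullet> b) * ?D b x)
       + of_real ((norm x)\<^sup>2) * laplacian f x"
    unfolding laplacian_def by (simp add: sum.distrib sum_distrib_left mult.assoc)
  also have "(\<Sum>b\<in>Basis. of_real (x \<bullet> b) * ?D b x) = frechet_derivative f (at x) (\<Sum>b\<in>Basis. (x \<bullet> b) *\<^sub>R b)"
    using has_derivative_linear[OF frechet_derivative_polynomial_works[OF pf]]
    by (simp add: linear_sum linear_scale scaleR_conv_of_real)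
  also have "\<dots> = of_nat d * f x"
    using homogeneous_euler[OF f] by (simp add: euclidean_representation)
  finally show ?thesis by (simp add: algebra_simps inner_Basis)
qed

text \<open>Each root adds \<open>4 * k \<alpha>\<close>: the squared norm is invariant under
  reflections and passes through the difference term, while its derivative along
  \<open>\<alpha>\<close> is \<open>2 * (x \<bullet> \<alpha>)\<close> and cancels the
  denominator.\<close>

lemma dunkl_laplacian_norm_power2_mult:
  fixes f :: "'a::euclidean_space \<Rightarrow> complex"
  assumes f: "homogeneous_polynomial d f" and P: "\<forall>\<alpha>\<in>P. \<alpha> \<bullet> x \<noteq> 0"
  shows "dunkl_laplacian P k (\<lambda>x. of_real ((norm x)\<^sup>2) * f x) x
    = of_real (2 * real DIM('a) + 4 * real d + 4 * (\<Sum>\<alpha>\<in>P. k \<alpha>)) * f x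
      + of_real ((norm x)\<^sup>2) * dunkl_laplacian P k f x"
proof -
  have pf: "polynomial_function f" using f unfolding homogeneous_polynomial_def by (rule conjunct1)
  have "of_real (k \<alpha>) *
        (2 * (of_real (2 * (x \<bullet> \<alpha>)) * f x + of_real ((norm x)\<^sup>2) * frechet_derivative f (at x) \<alpha>) / of_real (\<alpha> \<bullet> x)
         - of_real ((norm \<alpha>)\<^sup>2) * (of_real ((norm x)\<^sup>2) * f x - of_real ((norm x)\<^sup>2) * f (root_reflection \<alpha> x)) / of_real ((\<alpha> \<bullet> x)\<^sup>2))
    = of_real (4 * k \<alpha>) * f x + of_real ((norm x)\<^sup>2) * (of_real (k \<alpha>) *
        (2 * frechet_derivative f (at x) \<alpha> / of_real (\<alpha> \<bullet> x)
         - of_real ((norm \<alpha>)\<^sup>2) * (f x - f (root_reflection \<alpha> x)) / of_real ((\<alpha> \<bullet> x)\<^sup>2)))"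
    if "\<alpha> \<in> P" for \<alpha>
    using P that by (simp add: inner_commute field_simps)
  then have "(\<Sum>\<alpha>\<in>P. of_real (k \<alpha>) *
        (2 * (of_real (2 * (x \<bullet> \<alpha>)) * f x + of_real ((norm x)\<^sup>2) * frechet_derivative f (at x) \<alpha>) / of_real (\<alpha> \<bullet> x)
         - of_real ((norm \<alpha>)\<^sup>2) * (of_real ((norm x)\<^sup>2) * f x - of_real ((norm x)\<^sup>2) * f (root_reflection \<alpha> x)) / of_real ((\<alpha> \<bullet> x)\<^sup>2)))
    = of_real (4 * (\<Sum>\<alpha>\<in>P. k \<alpha>)) * f x + of_real ((norm x)\<^sup>2) * (\<Sum>\<alpha>\<in>P. of_real (k \<alpha>) *
        (2 * frechet_derivative f (at x) \<alpha> / of_real (\<alpha> \<bullet> x)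
         - of_real ((norm \<alpha>)\<^sup>2) * (f x - f (root_reflection \<alpha> x)) / of_real ((\<alpha> \<bullet> x)\<^sup>2)))"
    by (simp add: sum.distrib sum_distrib_left sum_distrib_right)
  then show ?thesis
    unfolding dunkl_laplacian_def laplacian_norm_power2_mult[OF f] frechet_derivative_norm_power2_mult[OF pf]
      norm_root_reflection
    by (simp add: algebra_simps)
qed

text \<open>Finitely many hyperplanes form a null set, whereas a nonempty open set on which
  \<open>f\<close> and \<open>g\<close> differ is not null. Harmonicity and the polynomial extension
  of the Dunkl Laplacian are specified only off the hyperplanes; this lifts identities between
  continuous extensions to all points.\<close>

lemma eq_off_hyperplanes_imp_eq:
  fixes f g :: "'a::euclidean_space \<Rightarrow> complex"
  assumes P: "finite P" "0 \<notin> P" and "continuous_on UNIV f" "continuous_on UNIV g"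
    and eq: "\<And>x. \<forall>\<alpha>\<in>P. \<alpha> \<bullet> x \<noteq> 0 \<Longrightarrow> f x = g x"
  shows "f x = g x"
proof (rule ccontr)
  assume ne: "f x \<noteq> g x"
  have "open {x. f x - g x \<noteq> 0}"
    by (intro open_Collect_neq continuous_intros assms)
  moreover have "negligible (\<Union>\<alpha>\<in>P. {x. \<alpha> \<bullet> x = 0})"
    using P by (intro negligible_Union) (auto intro!: negligible_hyperplane)
  then have "negligible {x. f x - g x \<noteq> 0}"
    by (rule negligible_subset) (use eq in auto)
  ultimately show False
    using open_not_negligible[of "{x. f x - g x \<noteq> 0}"] ne by auto
qed

lemma polynomial_function_complex_mult:
  fixes f g :: "'a::real_normed_vector \<Rightarrow> complex"
  assumes "polynomial_function f" "polynomial_function g"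
  shows "polynomial_function (\<lambda>x. f x * g x)"
proof -
  have "polynomial_function (\<lambda>x. Re (f x))" "polynomial_function (\<lambda>x. Im (f x))"
    using assms(1) bounded_linear_Re bounded_linear_Im
    by (auto simp: polynomial_function_def[of f] o_def real_polynomial_function_eq)
  then have "polynomial_function (\<lambda>x. Re (f x) *\<^sub>R g x + Im (f x) *\<^sub>R (\<i> * g x))"
    using assms(2) by (intro polynomial_function_add polynomial_function_mult polynomial_function_cmult)
  moreover have "(\<lambda>x. Re (f x) *\<^sub>R g x + Im (f x) *\<^sub>R (\<i> * g x)) = (\<lambda>x. f x * g x)"
    by (auto simp: complex_eq_iff)
  ultimately show ?thesis by simp
qed

lemma homogeneous_polynomialD:
  assumes "homogeneous_polynomial m f"
  shows "polynomial_function f" "f (t *\<^sub>R x) = of_real (t ^ m) * f x"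
  using assms unfolding homogeneous_polynomial_def by blast+

lemma homogeneous_polynomial_mult:
  assumes "homogeneous_polynomial m f" "homogeneous_polynomial n g"
  shows "homogeneous_polynomial (m + n) (\<lambda>x. f x * g x)"
  using homogeneous_polynomialD[OF assms(1)] homogeneous_polynomialD[OF assms(2)]
  unfolding homogeneous_polynomial_def
  by (simp add: polynomial_function_complex_mult power_add)

lemma homogeneous_polynomial_lincomb:
  assumes "homogeneous_polynomial m f" "homogeneous_polynomial m g"
  shows "homogeneous_polynomial m (\<lambda>x. f x + c * g x)"
  using homogeneous_polynomialD[OF assms(1)] homogeneous_polynomialD[OF assms(2)]
  unfolding homogeneous_polynomial_def
  by (simp add: polynomial_function_cmult polynomial_function_add algebra_simps)

lemma homogeneous_polynomial_zero: "homogeneous_polynomial m (\<lambda>x. 0)"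
  by (simp add: homogeneous_polynomial_def)

lemma homogeneous_polynomial_norm_power2_mult:
  fixes f :: "'a::euclidean_space \<Rightarrow> complex"
  assumes "homogeneous_polynomial m f"
  shows "homogeneous_polynomial (m + 2) (\<lambda>x. of_real ((norm x)\<^sup>2) * f x)"
proof -
  have "complex_of_real ((norm (t *\<^sub>R x))\<^sup>2) * f (t *\<^sub>R x) = of_real (t ^ (m + 2)) * (of_real ((norm x)\<^sup>2) * f x)"
    for t x
    unfolding homogeneous_polynomialD(2)[OF assms] norm_scaleR power_mult_distrib power2_abs of_real_mult power_add
    by (simp only: mult_ac)
  then show ?thesis
    using polynomial_function_norm_power2_mult[OF homogeneous_polynomialD(1)[OF assms]]
    unfolding homogeneous_polynomial_def by blast
qed

lemma homogeneous_polynomial_norm_power_mult: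
  fixes f :: "'a::euclidean_space \<Rightarrow> complex"
  assumes "homogeneous_polynomial m f"
  shows "homogeneous_polynomial (m + 2 * e) (\<lambda>x. of_real ((norm x)\<^sup>2) ^ e * f x)"
proof (induction e)
  case (Suc e)
  from homogeneous_polynomial_norm_power2_mult[OF this] show ?case
    by (simp add: mult.assoc)
qed (simp add: assms)

lemma frechet_derivative_scale_invariant:
  fixes f :: "'a::euclidean_space \<Rightarrow> complex"
  assumes f: "polynomial_function f" and eq: "\<And>x. f (s *\<^sub>R x) = c * f x"
  shows "of_real s * frechet_derivative f (at (s *\<^sub>R x)) v = c * frechet_derivative f (at x) v"
proof -
  have "((\<lambda>x. f (s *\<^sub>R x)) has_derivative (\<lambda>v. frechet_derivative f (at (s *\<^sub>R x)) (s *\<^sub>R v))) (at x)"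
    by (rule has_derivative_compose[of "\<lambda>x. s *\<^sub>R x" _ x UNIV f])
       (auto intro!: derivative_eq_intros frechet_derivative_polynomial_works f)
  moreover have "((\<lambda>x. f (s *\<^sub>R x)) has_derivative (\<lambda>v. c * frechet_derivative f (at x) v)) (at x)"
    unfolding eq by (intro has_derivative_mult_right frechet_derivative_polynomial_works f)
  ultimately have "frechet_derivative f (at (s *\<^sub>R x)) (s *\<^sub>R v) = c * frechet_derivative f (at x) v"
    using has_derivative_unique by (metis (no_types, lifting))
  then show ?thesis
    using has_derivative_linear[OF frechet_derivative_polynomial_works[OF f]]
    by (simp add: linear_scale scaleR_conv_of_real)
qed

lemma root_reflection_scaleR: "root_reflection \<alpha> (s *\<^sub>R x) = s *\<^sub>R root_reflection \<alpha> x"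
  by (simp add: root_reflection_def scaleR_right_diff_distrib mult_ac)

lemma dunkl_laplacian_scale:
  fixes f :: "'a::euclidean_space \<Rightarrow> complex"
  assumes f: "homogeneous_polynomial m f" and s: "s \<noteq> 0"
  shows "of_real (s\<^sup>2) * dunkl_laplacian P k f (s *\<^sub>R x) = of_real (s ^ m) * dunkl_laplacian P k f x"
proof -
  let ?c = "complex_of_real (s ^ m)"
  have pf: "polynomial_function f" and h: "\<And>x. f (s *\<^sub>R x) = ?c * f x"
    using homogeneous_polynomialD[OF f] by blast+
  have 1: "of_real s * frechet_derivative f (at (s *\<^sub>R x)) v = ?c * frechet_derivative f (at x) v" for x v
    by (rule frechet_derivative_scale_invariant[OF pf h])
  have D1: "frechet_derivative f (at (s *\<^sub>R x)) v = (?c / of_real s) * frechet_derivative f (at x) v" for x v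
    using 1[of x v] s by (simp add: field_simps)
  have "of_real s * frechet_derivative (\<lambda>y. frechet_derivative f (at y) b) (at (s *\<^sub>R x)) b
      = ?c / of_real s * frechet_derivative (\<lambda>y. frechet_derivative f (at y) b) (at x) b" for b :: 'a
    by (rule frechet_derivative_scale_invariant[OF polynomial_function_frechet_derivative[OF pf] D1])
  then have D2: "of_real (s\<^sup>2) * frechet_derivative (\<lambda>y. frechet_derivative f (at y) b) (at (s *\<^sub>R x)) b
      = ?c * frechet_derivative (\<lambda>y. frechet_derivative f (at y) b) (at x) b" for b :: 'a
    using s by (simp add: field_simps power2_eq_square)
  have L: "of_real (s\<^sup>2) * laplacian f (s *\<^sub>R x) = ?c * laplacian f x"
    unfolding laplacian_def sum_distrib_left by (rule sum.cong[OF HOL.refl D2])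
  \<comment> \<open>For \<open>t = 0\<close> both sides are zero by the convention
    \<open>z / 0 = 0\<close>, so the scaling holds on the hyperplanes too.\<close>
  have T: "S\<^sup>2 * (K * (2 * (C / S * D) / (S * t) - n * (C * f1 - C * f2) / (S * t)\<^sup>2))
      = C * (K * (2 * D / t - n * (f1 - f2) / t\<^sup>2))" if "S \<noteq> 0" for S K C D t n f1 f2 :: complex
    using that by (cases "t = 0") (simp_all add: field_simps power2_eq_square)
  have "of_real (s\<^sup>2) * (\<Sum>\<alpha>\<in>P. of_real (k \<alpha>) *
        (2 * frechet_derivative f (at (s *\<^sub>R x)) \<alpha> / of_real (\<alpha> \<bullet> (s *\<^sub>R x))
         - of_real ((norm \<alpha>)\<^sup>2) * (f (s *\<^sub>R x) - f (root_reflection \<alpha> (s *\<^sub>R x))) / of_real ((\<alpha> \<bullet> (s *\<^sub>R x))\<^sup>2)))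
     = ?c * (\<Sum>\<alpha>\<in>P. of_real (k \<alpha>) *
        (2 * frechet_derivative f (at x) \<alpha> / of_real (\<alpha> \<bullet> x)
         - of_real ((norm \<alpha>)\<^sup>2) * (f x - f (root_reflection \<alpha> x)) / of_real ((\<alpha> \<bullet> x)\<^sup>2)))"
    unfolding sum_distrib_left root_reflection_scaleR h D1 inner_scaleR_right of_real_mult of_real_power
    by (intro sum.cong HOL.refl T) (use s in simp)
  with L show ?thesis
    unfolding dunkl_laplacian_def distrib_left by simp
qed

text \<open>The extension inherits the scaling of the Dunkl Laplacian for nonzero factors, and
  continuity adds the factor 0. The subtraction \<open>m - 2\<close> is truncated, hence the
  separate clause for degrees 0 and 1.\<close>

lemma dunkl_laplacian_homogeneous:
  fixes f :: "'a::euclidean_space \<Rightarrow> complex"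
  assumes f: "homogeneous_polynomial m f" and P: "finite P" "0 \<notin> P"
  shows "\<exists>q. homogeneous_polynomial (m - 2) q \<and> (m < 2 \<longrightarrow> q = (\<lambda>x. 0)) \<and>
     (\<forall>x. (\<forall>\<alpha>\<in>P. \<alpha> \<bullet> x \<noteq> 0) \<longrightarrow> dunkl_laplacian P k f x = q x)"
proof -
  obtain q where q: "polynomial_function q"
    "\<And>x. (\<forall>\<alpha>\<in>P. \<alpha> \<bullet> x \<noteq> 0) \<Longrightarrow> dunkl_laplacian P k f x = q x"
    using dunkl_laplacian_polynomial[OF homogeneous_polynomialD(1)[OF f] P] by blast
  have cq: "continuous_on S q" for S
    by (rule continuous_on_polymonial_function[OF q(1)])
  have cqs: "continuous_on UNIV (\<lambda>x. q (s x))" if "continuous_on UNIV s" for s :: "'c::euclidean_space \<Rightarrow> 'a"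
    using continuous_on_compose2[OF cq[of UNIV] that] by simp
  have hom: "of_real (s\<^sup>2) * q (s *\<^sub>R x) = of_real (s ^ m) * q x" if "s \<noteq> 0" for s x
  proof (rule eq_off_hyperplanes_imp_eq[OF P])
    fix x assume "\<forall>\<alpha>\<in>P. \<alpha> \<bullet> x \<noteq> 0"
    with that q(2)[of x] q(2)[of "s *\<^sub>R x"] dunkl_laplacian_scale[OF f that, of P k x]
    show "of_real (s\<^sup>2) * q (s *\<^sub>R x) = of_real (s ^ m) * q x" by simp
  qed (auto intro!: continuous_intros cqs)
  \<comment> \<open>On the real line the hyperplane orthogonal to \<open>1\<close> is the origin, so
    agreement off the hyperplanes means agreement for all nonzero \<open>s\<close>.\<close>
  have *: "F 0 = G 0" if "\<And>s. s \<noteq> 0 \<Longrightarrow> F s = G s" "continuous_on UNIV F" "continuous_on UNIV G"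
    for F G :: "real \<Rightarrow> complex"
    using eq_off_hyperplanes_imp_eq[of "{1}" F G 0] that by auto
  show ?thesis
  proof (cases "m < 2")
    case True
    have "q x = 0" for x
    proof -
      \<comment> \<open>A positive power of \<open>s\<close> remains on the right, so
        \<open>s = 0\<close> forces the value zero.\<close>
      have "q x = of_real (s ^ (2 - m)) * q (s *\<^sub>R x)" if "s \<noteq> 0" for s
      proof -
        have "complex_of_real (s ^ m) * (of_real (s ^ (2 - m)) * q (s *\<^sub>R x)) = of_real (s\<^sup>2) * q (s *\<^sub>R x)"
          unfolding mult.assoc[symmetric] of_real_mult[symmetric] power_add[symmetric] using True by simp
        with hom[OF that, of x] that show ?thesis by simp
      qed
      then have "q x = of_real (0 ^ (2 - m)) * q (0 *\<^sub>R x)"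
        by (rule *[of "\<lambda>s. q x" "\<lambda>s. of_real (s ^ (2 - m)) * q (s *\<^sub>R x)"])
           (assumption, (intro continuous_intros cqs)+)
      with True show ?thesis by (simp add: zero_power)
    qed
    with q True show ?thesis by (intro exI[of _ "\<lambda>x. 0"]) (auto simp: homogeneous_polynomial_zero)
  next
    case False
    have nz: "q (s *\<^sub>R x) = of_real (s ^ (m - 2)) * q x" if "s \<noteq> 0" for s x
    proof -
      have "complex_of_real (s\<^sup>2) * (of_real (s ^ (m - 2)) * q x) = of_real (s ^ m) * q x"
        unfolding mult.assoc[symmetric] of_real_mult[symmetric] power_add[symmetric]
          le_add_diff_inverse[OF leI[OF False]] ..
      with hom[OF that, of x] that show ?thesis
        by (metis mult_left_cancel of_real_eq_0_iff power_not_zero)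
    qed
    moreover have "q (0 *\<^sub>R x) = of_real (0 ^ (m - 2)) * q x" for x
      by (rule *[of "\<lambda>s. q (s *\<^sub>R x)" "\<lambda>s. of_real (s ^ (m - 2)) * q x", OF nz])
         (auto intro!: continuous_intros cqs)
    ultimately have "homogeneous_polynomial (m - 2) q"
      using q(1) unfolding homogeneous_polynomial_def by metis
    with q False show ?thesis by blast
  qed
qed

section \<open>Fischer decomposition into \<open>k\<close>-harmonics\<close>

locale dunkl_weight =
  fixes P :: "'a::euclidean_space set" and k :: "'a \<Rightarrow> real"
  assumes finite_P: "finite P" and zero_notin_P: "0 \<notin> P" and k_nonneg: "\<alpha> \<in> P \<Longrightarrow> 0 \<le> k \<alpha>"
begin

text \<open>Each further factor of the squared norm increases the constant by a positive amount,
  because \<open>k\<close> is nonnegative on \<open>P\<close>. Positivity of \<open>C\<close> is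
  what allows a division by it when preimages are constructed.\<close>

lemma dunkl_laplacian_norm_power_mult_harmonic:
  assumes h: "homogeneous_polynomial d h" "dunkl_harmonic P k h"
  shows "\<exists>C::real. C > 0 \<and> (\<forall>x. (\<forall>\<alpha>\<in>P. \<alpha> \<bullet> x \<noteq> 0) \<longrightarrow>
     dunkl_laplacian P k (\<lambda>x. of_real ((norm x)\<^sup>2) ^ Suc e * h x) x
       = of_real C * (of_real ((norm x)\<^sup>2) ^ e * h x))"
proof (induction e)
  case 0
  have pos: "0 < 2 * real DIM('a) + 4 * real d + 4 * (\<Sum>\<alpha>\<in>P. k \<alpha>)"
    using sum_nonneg[of P k] k_nonneg by (simp add: add_pos_nonneg)
  show ?case
    using pos h(2) by (intro exI[of _ "2 * real DIM('a) + 4 * real d + 4 * (\<Sum>\<alpha>\<in>P. k \<alpha>)"])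
       (simp add: dunkl_laplacian_norm_power2_mult[OF h(1), simplified] dunkl_harmonic_def)
next
  case (Suc e)
  then obtain C where C: "C > 0" "\<And>x. (\<forall>\<alpha>\<in>P. \<alpha> \<bullet> x \<noteq> 0) \<Longrightarrow>
     dunkl_laplacian P k (\<lambda>x. of_real ((norm x)\<^sup>2) ^ Suc e * h x) x
       = of_real C * (of_real ((norm x)\<^sup>2) ^ e * h x)" by blast
  let ?c = "2 * real DIM('a) + 4 * real (d + 2 * Suc e) + 4 * (\<Sum>\<alpha>\<in>P. k \<alpha>)"
  have pos: "0 < ?c"
    using sum_nonneg[of P k] k_nonneg by (simp add: add_pos_nonneg)
  have "dunkl_laplacian P k (\<lambda>x. of_real ((norm x)\<^sup>2) ^ Suc (Suc e) * h x) x
       = of_real (?c + C) * (of_real ((norm x)\<^sup>2) ^ Suc e * h x)"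
    if "\<forall>\<alpha>\<in>P. \<alpha> \<bullet> x \<noteq> 0" for x
  proof -
    have "dunkl_laplacian P k (\<lambda>x. of_real ((norm x)\<^sup>2) ^ Suc (Suc e) * h x) x
      = dunkl_laplacian P k (\<lambda>x. of_real ((norm x)\<^sup>2) * (of_real ((norm x)\<^sup>2) ^ Suc e * h x)) x"
      by (simp add: mult.assoc)
    also have "\<dots> = of_real ?c * (of_real ((norm x)\<^sup>2) ^ Suc e * h x)
        + of_real ((norm x)\<^sup>2) * (of_real C * (of_real ((norm x)\<^sup>2) ^ e * h x))"
      unfolding dunkl_laplacian_norm_power2_mult[OF homogeneous_polynomial_norm_power_mult[OF h(1)] that] C(2)[OF that] ..
    also have "\<dots> = of_real (?c + C) * (of_real ((norm x)\<^sup>2) ^ Suc e * h x)"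
      by (simp add: algebra_simps)
    finally show ?thesis .
  qed
  with C(1) pos show ?case by (intro exI[of _ "?c + C"]) auto
qed

text \<open>Only the existence of the components is recorded. The total degree \<open>m\<close>
  stays visible, so that a preimage under the Dunkl Laplacian can be placed in degree
  \<open>m + 2\<close>.\<close>

inductive fischer_sum :: "nat \<Rightarrow> ('a \<Rightarrow> complex) \<Rightarrow> bool" where
  zero: "fischer_sum m (\<lambda>x. 0)"
| add: "fischer_sum m f \<Longrightarrow> homogeneous_polynomial d h \<Longrightarrow> dunkl_harmonic P k h \<Longrightarrow> d + 2 * e = m
    \<Longrightarrow> fischer_sum m (\<lambda>x. f x + of_real ((norm x)\<^sup>2) ^ e * h x)"

lemma dunkl_harmonic_cmult:
  assumes "polynomial_function f" "dunkl_harmonic P k f"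
  shows "dunkl_harmonic P k (\<lambda>x. c * f x)"
  using assms(2) dunkl_laplacian_lincomb[OF polynomial_function_const[of 0] assms(1), of P k c]
  by (simp add: dunkl_harmonic_def)

text \<open>The Dunkl Laplacian is inverted term by term: raise the power of the squared norm by one
  and divide by the positive constant of
  \<open>dunkl_laplacian_norm_power_mult_harmonic\<close>.\<close>

lemma fischer_sum_preimage:
  assumes "fischer_sum m q"
  shows "\<exists>g. fischer_sum (m + 2) g \<and> homogeneous_polynomial (m + 2) g \<and>
     (\<forall>x. (\<forall>\<alpha>\<in>P. \<alpha> \<bullet> x \<noteq> 0) \<longrightarrow> dunkl_laplacian P k g x = q x)"
  using assms
proof (induction rule: fischer_sum.induct)
  case (zero m)
  show ?case by (intro exI[of _ "\<lambda>x. 0"]) (simp add: fischer_sum.zero homogeneous_polynomial_zero)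
next
  case (add m f d h e)
  from add.IH obtain g where g: "fischer_sum (m + 2) g" "homogeneous_polynomial (m + 2) g"
     "\<And>x. (\<forall>\<alpha>\<in>P. \<alpha> \<bullet> x \<noteq> 0) \<Longrightarrow> dunkl_laplacian P k g x = f x" by blast
  obtain C :: real where C: "C > 0" "\<And>x. (\<forall>\<alpha>\<in>P. \<alpha> \<bullet> x \<noteq> 0) \<Longrightarrow>
     dunkl_laplacian P k (\<lambda>x. of_real ((norm x)\<^sup>2) ^ Suc e * h x) x
       = of_real C * (of_real ((norm x)\<^sup>2) ^ e * h x)"
    using dunkl_laplacian_norm_power_mult_harmonic[OF add.hyps(2,3)] by blast
  let ?g = "\<lambda>x. g x + of_real (inverse C) * (of_real ((norm x)\<^sup>2) ^ Suc e * h x)"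
  have hg: "homogeneous_polynomial (m + 2) (\<lambda>x. of_real ((norm x)\<^sup>2) ^ Suc e * h x)"
    using homogeneous_polynomial_norm_power_mult[OF add.hyps(2), of "Suc e"] add.hyps(4)
    by (metis add.assoc add_2_eq_Suc' mult_Suc_right add.commute)
  have "homogeneous_polynomial d (\<lambda>x. of_real (inverse C) * h x)"
    using homogeneous_polynomial_lincomb[OF homogeneous_polynomial_zero add.hyps(2)] by simp
  then have "fischer_sum (m + 2) (\<lambda>x. g x + of_real ((norm x)\<^sup>2) ^ Suc e * (of_real (inverse C) * h x))"
    using dunkl_harmonic_cmult[OF homogeneous_polynomialD(1)[OF add.hyps(2)] add.hyps(3)] add.hyps(4)
    by (intro fischer_sum.add[OF g(1)]) auto
  then have "fischer_sum (m + 2) ?g" by (simp only: mult.left_commute)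
  moreover have "homogeneous_polynomial (m + 2) ?g"
    by (rule homogeneous_polynomial_lincomb[OF g(2) hg])
  moreover have "dunkl_laplacian P k ?g x = f x + of_real ((norm x)\<^sup>2) ^ e * h x"
    if "\<forall>\<alpha>\<in>P. \<alpha> \<bullet> x \<noteq> 0" for x
    unfolding dunkl_laplacian_lincomb[OF homogeneous_polynomialD(1)[OF g(2)] homogeneous_polynomialD(1)[OF hg]]
      g(3)[OF that] C(2)[OF that] using C(1) by simp
  ultimately show ?case by blast
qed

text \<open>Strong induction on the degree. The Dunkl Laplacian of \<open>f\<close> has degree
  \<open>m - 2\<close>, so it is a Fischer sum and has a preimage \<open>g\<close> that is a Fischer
  sum of degree \<open>m\<close>. The difference of \<open>f\<close> and \<open>g\<close> is
  harmonic and supplies the one missing component.\<close>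

lemma homogeneous_fischer_sum:
  assumes "homogeneous_polynomial m f"
  shows "fischer_sum m f"
  using assms
proof (induction m arbitrary: f rule: less_induct)
  case (less m)
  have one: "fischer_sum m (\<lambda>x. g x + h x)"
    if "fischer_sum m g" "homogeneous_polynomial m h" "dunkl_harmonic P k h" for g h
    using fischer_sum.add[OF that, of 0] by simp
  obtain q where q: "homogeneous_polynomial (m - 2) q" "m < 2 \<longrightarrow> q = (\<lambda>x. 0)"
     "\<And>x. (\<forall>\<alpha>\<in>P. \<alpha> \<bullet> x \<noteq> 0) \<Longrightarrow> dunkl_laplacian P k f x = q x"
    using dunkl_laplacian_homogeneous[OF less.prems finite_P zero_notin_P, of k] by blast
  show ?case
  proof (cases "m < 2")
    case True
    then show ?thesis
      using one[OF fischer_sum.zero less.prems] q(2,3) by (simp add: dunkl_harmonic_def)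
  next
    case False
    then obtain g where g: "fischer_sum m g" "homogeneous_polynomial m g"
       "\<And>x. (\<forall>\<alpha>\<in>P. \<alpha> \<bullet> x \<noteq> 0) \<Longrightarrow> dunkl_laplacian P k g x = q x"
    proof -
      have "m - 2 < m" "m - 2 + 2 = m" using False by auto
      with fischer_sum_preimage[OF less.IH[OF _ q(1)]] that show thesis by metis
    qed
    have "homogeneous_polynomial m (\<lambda>x. f x + (-1) * g x)"
      by (rule homogeneous_polynomial_lincomb[OF less.prems g(2)])
    moreover have "dunkl_harmonic P k (\<lambda>x. f x + (-1) * g x)"
      unfolding dunkl_harmonic_def
      by (simp only: dunkl_laplacian_lincomb[OF homogeneous_polynomialD(1)[OF less.prems]
          homogeneous_polynomialD(1)[OF g(2)]]) (simp add: q(3) g(3))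
    ultimately show ?thesis using one[OF g(1)] by fastforce
  qed
qed

inductive harmonic_span :: "('a \<Rightarrow> complex) \<Rightarrow> bool" where
  zero: "harmonic_span (\<lambda>x. 0)"
| add: "harmonic_span f \<Longrightarrow> homogeneous_polynomial d h \<Longrightarrow> dunkl_harmonic P k h
    \<Longrightarrow> harmonic_span (\<lambda>x. f x + of_real ((norm x)\<^sup>2) ^ e * h x)"

lemma harmonic_span_add:
  assumes "harmonic_span f" "harmonic_span g"
  shows "harmonic_span (\<lambda>x. f x + g x)"
  using assms(2)
proof (induction rule: harmonic_span.induct)
  case (add g d h e)
  from harmonic_span.add[OF add(4,2,3), of e] show ?case by (simp add: add.assoc)
qed (simp add: assms)

lemma homogeneous_harmonic_span:
  assumes "homogeneous_polynomial m f"
  shows "harmonic_span f"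
  using homogeneous_fischer_sum[OF assms]
  by (induction rule: fischer_sum.induct) (rule harmonic_span.zero, rule harmonic_span.add)

end

section \<open>Reduction of polynomials to homogeneous ones\<close>

inductive homogeneous_span :: "('a::euclidean_space \<Rightarrow> complex) \<Rightarrow> bool" where
  zero: "homogeneous_span (\<lambda>x. 0)"
| add: "homogeneous_span f \<Longrightarrow> homogeneous_polynomial m h \<Longrightarrow> homogeneous_span (\<lambda>x. f x + h x)"

lemma homogeneous_span_homogeneous: "homogeneous_polynomial m h \<Longrightarrow> homogeneous_span h"
  using homogeneous_span.add[OF homogeneous_span.zero, of m h] by simp

lemma homogeneous_span_add:
  assumes "homogeneous_span f" "homogeneous_span g"
  shows "homogeneous_span (\<lambda>x. f x + g x)"
  using assms(2)
proof (induction rule: homogeneous_span.induct)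
  case (add g m h)
  from homogeneous_span.add[OF add(3,2)] show ?case by (simp add: add.assoc)
qed (simp add: assms)

lemma homogeneous_span_mult:
  assumes "homogeneous_span f" "homogeneous_span g"
  shows "homogeneous_span (\<lambda>x. f x * g x)"
proof -
  have *: "homogeneous_span (\<lambda>x. f x * h x)" if "homogeneous_polynomial n h" for n h
    using assms(1)
  proof (induction rule: homogeneous_span.induct)
    case (add f m h')
    from homogeneous_span.add[OF add(3) homogeneous_polynomial_mult[OF add(2) that]]
    show ?case by (simp add: algebra_simps)
  qed (simp add: homogeneous_span.zero)
  show ?thesis using assms(2)
  proof (induction rule: homogeneous_span.induct)
    case (add g m h)
    from homogeneous_span_add[OF add(3) *[OF add(2)]] show ?case by (simp add: algebra_simps)
  qed (simp add: homogeneous_span.zero)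
qed

lemma real_polynomial_homogeneous_span:
  assumes "real_polynomial_function (f :: 'a::euclidean_space \<Rightarrow> real)"
  shows "homogeneous_span (\<lambda>x. of_real (f x))"
  using assms
proof (induction rule: real_polynomial_function.induct)
  case (linear f)
  then have "polynomial_function (\<lambda>x. complex_of_real (f x))"
    by (intro polynomial_function_of_real_complex real_polynomial_function.intros(1))
  with linear have "homogeneous_polynomial 1 (\<lambda>x. complex_of_real (f x))"
    unfolding homogeneous_polynomial_def by (simp add: linear_scale bounded_linear.linear)
  then show ?case by (rule homogeneous_span_homogeneous)
next
  case (const c)
  have "homogeneous_polynomial 0 (\<lambda>x::'a. complex_of_real c)"
    by (simp add: homogeneous_polynomial_def)
  then show ?case by (rule homogeneous_span_homogeneous)
next
  case (add f g)
  then show ?case using homogeneous_span_add by force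
next
  case (mult f g)
  then show ?case using homogeneous_span_mult by force
qed

lemma polynomial_homogeneous_span:
  assumes "polynomial_function (f :: 'a::euclidean_space \<Rightarrow> complex)"
  shows "homogeneous_span f"
proof -
  have "real_polynomial_function (\<lambda>x. Re (f x))" "real_polynomial_function (\<lambda>x. Im (f x))"
    using assms bounded_linear_Re bounded_linear_Im by (auto simp: polynomial_function_def o_def)
  moreover have "homogeneous_polynomial 0 (\<lambda>x::'a. \<i>)"
    by (simp add: homogeneous_polynomial_def)
  ultimately have "homogeneous_span (\<lambda>x. of_real (Re (f x)) + \<i> * of_real (Im (f x)))"
    by (intro homogeneous_span_add homogeneous_span_mult real_polynomial_homogeneous_span
        homogeneous_span_homogeneous)
  then show ?thesis by (simp flip: complex_eq)
qed

lemma (in dunkl_weight) polynomial_harmonic_span: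
  assumes "polynomial_function f"
  shows "harmonic_span f"
  using polynomial_homogeneous_span[OF assms]
  by (induction rule: homogeneous_span.induct)
     (auto intro: harmonic_span.zero harmonic_span_add homogeneous_harmonic_span)

section \<open>Laguerre polynomials\<close>

lemma pochhammer_Suc_shift_diff:
  fixes c :: real
  shows "pochhammer (c + 1) (Suc i) - pochhammer c (Suc i) = real (Suc i) * pochhammer (c + 1) i"
  unfolding pochhammer_rec[of c] pochhammer_Suc[of "c + 1"] by (simp add: algebra_simps)

text \<open>Up to sign this is the \<open>l\<close>-th finite difference of a polynomial of degree
  \<open>i\<close> in \<open>j\<close>. By \<open>pochhammer_Suc_shift_diff\<close> one difference
  lowers the degree by one and shifts \<open>c\<close> by one, so nothing is left once
  \<open>l\<close> exceeds \<open>i\<close>.\<close>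

lemma alternating_sum_pochhammer:
  fixes c :: real
  shows "(\<Sum>j\<le>l. (-1) ^ j * real (l choose j) * pochhammer (c + real j) i)
    = (if i < l then 0 else (-1) ^ l * (fact i / fact (i - l)) * pochhammer (c + real l) (i - l))"
proof (induction l arbitrary: c i)
  case (Suc l)
  let ?f = "\<lambda>j. pochhammer (c + real j) i"
  have "(\<Sum>j\<le>Suc l. (-1) ^ j * real (Suc l choose j) * ?f j)
     = (\<Sum>j\<le>l. (-1) ^ j * real (l choose j) * (?f j - ?f (Suc j)))"
  proof -
    have "(\<Sum>j\<le>Suc l. (-1) ^ j * real (Suc l choose j) * ?f j)
      = ?f 0 + (\<Sum>j\<le>l. (-1) ^ Suc j * real (Suc l choose Suc j) * ?f (Suc j))"
      by (subst sum.atMost_Suc_shift) simp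
    also have "(\<Sum>j\<le>l. (-1) ^ Suc j * real (Suc l choose Suc j) * ?f (Suc j))
      = (\<Sum>j\<le>l. (-1) ^ Suc j * real (l choose j) * ?f (Suc j))
        + (\<Sum>j\<le>l. (-1) ^ Suc j * real (l choose Suc j) * ?f (Suc j))"
      by (simp add: sum.distrib[symmetric] algebra_simps)
    also have "(\<Sum>j\<le>l. (-1) ^ Suc j * real (l choose Suc j) * ?f (Suc j))
       = (\<Sum>j\<le>Suc l. (-1) ^ j * real (l choose j) * ?f j) - ?f 0"
      by (subst sum.atMost_Suc_shift) simp
    also have "\<dots> = (\<Sum>j\<le>l. (-1) ^ j * real (l choose j) * ?f j) - ?f 0"
      by simp
    finally show ?thesis
      by (simp add: sum_subtractf sum_negf algebra_simps)
  qed
  also have "\<dots> = (if i < Suc l then 0 else (-1) ^ Suc l * (fact i / fact (i - Suc l)) * pochhammer (c + real (Suc l)) (i - Suc l))"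
  proof (cases i)
    case 0
    then show ?thesis by simp
  next
    case (Suc i')
    have d: "?f j - ?f (Suc j) = - real (Suc i') * pochhammer (c + 1 + real j) i'" for j
      using pochhammer_Suc_shift_diff[of "c + real j" i'] by (simp add: Suc algebra_simps)
    have "(\<Sum>j\<le>l. (-1) ^ j * real (l choose j) * (?f j - ?f (Suc j)))
       = - real (Suc i') * (\<Sum>j\<le>l. (-1) ^ j * real (l choose j) * pochhammer (c + 1 + real j) i')"
      unfolding d sum_distrib_left by (intro sum.cong) (simp_all add: algebra_simps)
    also have "\<dots> = - real (Suc i') * (if i' < l then 0 else (-1) ^ l * (fact i' / fact (i' - l)) * pochhammer (c + 1 + real l) (i' - l))"
      unfolding Suc.IH ..
    finally show ?thesis
      by (rule trans) (auto simp: Suc field_simps)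
  qed
  finally show ?case .
qed simp

text \<open>A Laguerre coefficient times the first part of the moment it meets is a binomial
  coefficient with a prefactor free of \<open>j\<close>. This turns the moments of a Laguerre
  polynomial into finite differences.\<close>

lemma gbinomial_shifted_pochhammer:
  fixes \<nu> :: real
  assumes "j \<le> l"
  shows "((real l + \<nu>) gchoose (l - j)) * pochhammer (\<nu> + 1) j / fact j
     = pochhammer (\<nu> + 1) l / fact l * real (l choose j)"
proof -
  have "(real l + \<nu>) gchoose (l - j) = pochhammer (\<nu> + 1 + real j) (l - j) / fact (l - j)"
    using assms by (simp add: gbinomial_pochhammer' of_nat_diff algebra_simps)
  moreover have "pochhammer (\<nu> + 1) l = pochhammer (\<nu> + 1) j * pochhammer (\<nu> + 1 + real j) (l - j)"
    using assms by (rule pochhammer_product)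
  moreover have "real (l choose j) = fact l / (fact j * fact (l - j))"
    using assms by (rule binomial_fact)
  ultimately show ?thesis by (simp add: mult.commute)
qed

text \<open>The moments of the weight \<open>t powr \<nu> * exp (- t)\<close> on the half-line are Pochhammer
  symbols up to a common factor, so this is the orthogonality relation behind the norm of
  the Laguerre functions.\<close>

lemma laguerre_norm_moments:
  fixes \<nu> :: real
  shows "(\<Sum>i\<le>l. \<Sum>j\<le>l. ((-1) ^ i * ((real l + \<nu>) gchoose (l - i)) / fact i)
      * ((-1) ^ j * ((real l + \<nu>) gchoose (l - j)) / fact j) * pochhammer (\<nu> + 1) (i + j))
    = pochhammer (\<nu> + 1) l / fact l"
proof -
  let ?c = "\<lambda>i. (-1) ^ i * ((real l + \<nu>) gchoose (l - i)) / fact i"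
  \<comment> \<open>Orthogonality to lower powers: the inner sum is an \<open>l\<close>-th
    difference of a polynomial of degree \<open>i\<close>, so only \<open>i = l\<close>
    survives.\<close>
  have *: "(\<Sum>j\<le>l. ?c j * pochhammer (\<nu> + 1) (i + j)) = (if i = l then (-1) ^ l * pochhammer (\<nu> + 1) l else 0)"
    if "i \<le> l" for i
  proof -
    have "?c j * pochhammer (\<nu> + 1) (i + j) = pochhammer (\<nu> + 1) l / fact l *
         ((-1) ^ j * real (l choose j) * pochhammer (\<nu> + 1 + real j) i)" if "j \<le> l" for j
    proof -
      have "pochhammer (\<nu> + 1) (i + j) = pochhammer (\<nu> + 1) j * pochhammer (\<nu> + 1 + real j) i"
        using pochhammer_product'[of "\<nu> + 1" j i] by (simp add: add.commute)
      then have "?c j * pochhammer (\<nu> + 1) (i + j) =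
         (-1) ^ j * (((real l + \<nu>) gchoose (l - j)) * pochhammer (\<nu> + 1) j / fact j) * pochhammer (\<nu> + 1 + real j) i"
        by simp
      then show ?thesis unfolding gbinomial_shifted_pochhammer[OF that] by simp
    qed
    then have "(\<Sum>j\<le>l. ?c j * pochhammer (\<nu> + 1) (i + j)) = pochhammer (\<nu> + 1) l / fact l *
        (\<Sum>j\<le>l. (-1) ^ j * real (l choose j) * pochhammer (\<nu> + 1 + real j) i)"
      unfolding sum_distrib_left by (intro sum.cong) auto
    then show ?thesis
      unfolding alternating_sum_pochhammer using that by auto
  qed
  have "(\<Sum>i\<le>l. \<Sum>j\<le>l. ?c i * ?c j * pochhammer (\<nu> + 1) (i + j))
     = (\<Sum>i\<le>l. ?c i * (\<Sum>j\<le>l. ?c j * pochhammer (\<nu> + 1) (i + j)))"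
    by (simp add: sum_distrib_left mult.assoc)
  also have "\<dots> = (\<Sum>i\<le>l. if i = l then ?c i * ((-1) ^ l * pochhammer (\<nu> + 1) l) else 0)"
    by (intro sum.cong[OF HOL.refl]) (subst *, auto)
  also have "\<dots> = ?c l * ((-1) ^ l * pochhammer (\<nu> + 1) l)"
    by simp
  also have "\<dots> = pochhammer (\<nu> + 1) l / fact l"
    by (simp add: power_mult_distrib[symmetric] field_simps flip: power_add)
  finally show ?thesis .
qed

section \<open>The generating function of the Laguerre polynomials\<close>

lemma gbinomial_series_negative:
  fixes c w :: real
  assumes "\<bar>w\<bar> < 1"
  shows "(\<lambda>n. ((real n + c) gchoose n) * w ^ n) sums ((1 - w) powr (- c - 1))"
proof -
  have "((- c - 1) gchoose n) * (- w) ^ n = ((real n + c) gchoose n) * w ^ n" for n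
  proof -
    have "(- c - 1) gchoose n = (-1) ^ n * ((real n - (- c - 1) - 1) gchoose n)"
      by (rule gbinomial_negated_upper)
    also have "real n - (- c - 1) - 1 = real n + c" by simp
    finally have *: "(- c - 1) gchoose n = (-1) ^ n * ((real n + c) gchoose n)" .
    have "(-1) ^ n * (- w) ^ n = w ^ n" unfolding power_mult_distrib[symmetric] by simp
    then show ?thesis unfolding * by (metis mult.assoc mult.commute)
  qed
  then show ?thesis using gen_binomial_real[of "- w" "- c - 1"] assms by simp
qed

lemma gbinomial_nonneg:
  fixes c :: real
  assumes "c > -1"
  shows "((real n + c) gchoose n) \<ge> 0"
  unfolding gbinomial_pochhammer' using assms by (auto intro!: divide_nonneg_pos pochhammer_nonneg)

text \<open>Expanding each Laguerre polynomial gives a double series over \<open>(j, n)\<close> with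
  \<open>l = j + n\<close>. Summed over \<open>n\<close> first it is a binomial series, and then
  over \<open>j\<close> an exponential series. Absolute convergence permits the rearrangement along
  the diagonals.\<close>

lemma laguerre_generating_function:
  fixes \<nu> x w :: real
  assumes \<nu>: "\<nu> > -1" and w: "\<bar>w\<bar> < 1"
  shows "(\<lambda>l. laguerre l \<nu> x * w ^ l) sums ((1 - w) powr (- \<nu> - 1) * exp (- x * w / (1 - w)))"
proof -
  define a where "a x w = (\<lambda>(j, n). (- x * w) ^ j / fact j * (((real n + (real j + \<nu>)) gchoose n) * w ^ n))"
    for x w :: real
  define s where "s x w = (1 - w) powr (- \<nu> - 1) * exp (- x * w / (1 - w))" for x w :: real
  have inner: "(\<lambda>n. a x w (j, n)) sums ((- x * w) ^ j / fact j * (1 - w) powr (- (real j + \<nu>) - 1))"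
    if "\<bar>w\<bar> < 1" for x w j
    unfolding a_def prod.case by (intro sums_mult gbinomial_series_negative that)
  have outer: "(\<lambda>j. (- x * w) ^ j / fact j * (1 - w) powr (- (real j + \<nu>) - 1)) sums s x w"
    if "\<bar>w\<bar> < 1" for x w
  proof -
    have "(- x * w) ^ j / fact j * (1 - w) powr (- (real j + \<nu>) - 1)
        = (1 - w) powr (- \<nu> - 1) * ((- x * w / (1 - w)) ^ j /\<^sub>R fact j)" for j
    proof -
      have "(1 - w) powr (- (real j + \<nu>) - 1) = (1 - w) powr (- \<nu> - 1) * (1 - w) powr (- real j)"
        unfolding powr_add[symmetric] by (simp add: algebra_simps)
      also have "(1 - w) powr (- real j) = 1 / (1 - w) ^ j"
        using that by (simp add: powr_minus_divide powr_realpow)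
      finally have *: "(1 - w) powr (- (real j + \<nu>) - 1) = (1 - w) powr (- \<nu> - 1) * (1 / (1 - w) ^ j)" .
      show ?thesis unfolding * power_divide by (simp add: divide_inverse mult_ac)
    qed
    then show ?thesis
      unfolding s_def using sums_mult[OF exp_converges[of "- x * w / (1 - w)"], of "(1 - w) powr (- \<nu> - 1)"] by simp
  qed
  \<comment> \<open>Since \<open>\<nu> > -1\<close> the binomial coefficients are nonnegative. The
    series of norms is therefore the same double series with \<open>- \<bar>x\<bar>\<close> and
    \<open>\<bar>w\<bar>\<close> in place of \<open>x\<close> and \<open>w\<close>, and its iterated
    sum is already known.\<close>
  have norm_a: "norm (a x w p) = a (- \<bar>x\<bar>) \<bar>w\<bar> p" for p
  proof (cases p)
    case (Pair j n)
    have "((real n + (real j + \<nu>)) gchoose n) \<ge> 0"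
      by (rule gbinomial_nonneg) (use \<nu> in auto)
    then show ?thesis by (simp add: Pair a_def abs_mult power_abs)
  qed
  have nonneg: "a (- \<bar>x\<bar>) \<bar>w\<bar> p \<ge> 0" for p
    using norm_ge_zero[of "a x w p"] unfolding norm_a .
  have "(\<lambda>p. norm (a x w p)) summable_on UNIV \<times> UNIV"
    unfolding norm_a
  proof (rule summable_on_SigmaI)
    show "((\<lambda>n. a (- \<bar>x\<bar>) \<bar>w\<bar> (j, n)) has_sum
        ((\<bar>x\<bar> * \<bar>w\<bar>) ^ j / fact j * (1 - \<bar>w\<bar>) powr (- (real j + \<nu>) - 1))) UNIV" for j
      using inner[of "\<bar>w\<bar>" "- \<bar>x\<bar>" j] w nonneg by (intro sums_nonneg_imp_has_sum) auto
    have "(\<lambda>j. (\<bar>x\<bar> * \<bar>w\<bar>) ^ j / fact j * (1 - \<bar>w\<bar>) powr (- (real j + \<nu>) - 1)) sums s (- \<bar>x\<bar>) \<bar>w\<bar>"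
      using outer[of "\<bar>w\<bar>" "- \<bar>x\<bar>"] w by simp
    then show "(\<lambda>j. (\<bar>x\<bar> * \<bar>w\<bar>) ^ j / fact j * (1 - \<bar>w\<bar>) powr (- (real j + \<nu>) - 1)) summable_on UNIV"
      by (intro summable_nonneg_imp_summable_on) (auto simp: sums_iff)
  qed (use nonneg in auto)
  then have sa: "a x w summable_on UNIV \<times> UNIV"
    by (rule abs_summable_summable)
  have "(a x w has_sum s x w) (UNIV \<times> UNIV)"
  proof -
    let ?g = "\<lambda>j. (- x * w) ^ j / fact j * (1 - w) powr (- (real j + \<nu>) - 1)"
    have 1: "((\<lambda>n. a x w (j, n)) has_sum ?g j) UNIV" for j
    proof (rule norm_summable_imp_has_sum)
      show "summable (\<lambda>n. norm (a x w (j, n)))"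
        unfolding norm_a using inner[of "\<bar>w\<bar>" "- \<bar>x\<bar>" j] w by (auto simp: sums_iff)
    qed (rule inner[OF w])
    from has_sum_SigmaD[OF has_sum_infsum[OF sa] 1]
    have "(?g has_sum infsum (a x w) (UNIV \<times> UNIV)) UNIV" by simp
    from has_sum_imp_sums[OF this] outer[OF w] have "infsum (a x w) (UNIV \<times> UNIV) = s x w"
      by (rule sums_unique2)
    with has_sum_infsum[OF sa] show ?thesis by simp
  qed
  also have "?this \<longleftrightarrow> ((\<lambda>(l, j). a x w (j, l - j)) has_sum s x w) (SIGMA l:UNIV. {..l})"
    by (rule has_sum_reindex_bij_witness[of _ "\<lambda>(l, j). (j, l - j)" "\<lambda>(j, n). (j + n, j)"]) auto
  finally have diag: "((\<lambda>(l, j). a x w (j, l - j)) has_sum s x w) (SIGMA l:UNIV. {..l})" .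
  have "((\<lambda>j. a x w (j, l - j)) has_sum (laguerre l \<nu> x * w ^ l)) {..l}" for l
  proof -
    have "(\<Sum>j\<le>l. a x w (j, l - j)) = laguerre l \<nu> x * w ^ l"
      unfolding laguerre_def sum_distrib_right
    proof (rule sum.cong)
      fix j assume "j \<in> {..l}"
      then have "w ^ l = w ^ j * w ^ (l - j)" "real (l - j) + (real j + \<nu>) = real l + \<nu>"
        by (auto simp flip: power_add)
      moreover have "(- x * w) ^ j = (-1) ^ j * x ^ j * w ^ j"
        by (simp only: power_mult_distrib[symmetric]) simp
      ultimately show "a x w (j, l - j) = (-1) ^ j * ((real l + \<nu>) gchoose (l - j)) * x ^ j / fact j * w ^ l"
        by (simp add: a_def)
    qed simp
    then show ?thesis using has_sum_finite[of "{..l}" "\<lambda>j. a x w (j, l - j)"] by simp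
  qed
  from has_sum_SigmaD[OF diag, of "\<lambda>l. laguerre l \<nu> x * w ^ l"] this
  have "((\<lambda>l. laguerre l \<nu> x * w ^ l) has_sum s x w) UNIV" by simp
  then show ?thesis unfolding s_def by (rule has_sum_imp_sums)
qed

section \<open>The weighted measure and Gaussian integrals\<close>

lemma power_le_exp_bound:
  fixes y b :: real
  assumes "y \<ge> 0" "b > 0"
  shows "y ^ n \<le> fact n / b ^ n * exp (b * y)"
proof -
  have "(b * y) ^ n /\<^sub>R fact n \<le> (\<Sum>i. (b * y) ^ i /\<^sub>R fact i)"
    using sum_le_suminf[OF sums_summable[OF exp_converges[of "b * y"]], of "{n}"] assms by simp
  then have "(b * y) ^ n / fact n \<le> exp (b * y)"
    by (simp add: exp_def divide_inverse mult.commute)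
  then show ?thesis
    using assms by (simp add: field_simps power_mult_distrib)
qed

lemma homogeneous_polynomial_bound:
  fixes p :: "'a::euclidean_space \<Rightarrow> complex"
  assumes "homogeneous_polynomial m p"
  shows "\<exists>C\<ge>0. \<forall>x. norm (p x) \<le> C * norm x ^ m"
proof -
  have "continuous_on (sphere 0 1) p"
    by (rule continuous_on_polymonial_function[OF homogeneous_polynomialD(1)[OF assms]])
  then have "bounded (p ` sphere 0 1)"
    by (intro compact_imp_bounded compact_continuous_image) auto
  then obtain C where C: "C > 0" "\<And>x. norm x = 1 \<Longrightarrow> norm (p x) \<le> C"
    unfolding bounded_pos by auto
  have "norm (p x) \<le> C * norm x ^ m" for x
  proof (cases "x = 0")
    case True
    show ?thesis
    proof (cases "m = 0")
      case m0: True
      obtain b :: 'a where "b \<in> Basis" using nonempty_Basis by blast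
      then have "norm b = 1" by simp
      moreover have "p b = p 0"
        using homogeneous_polynomialD(2)[OF assms, of 0 b] m0 by simp
      ultimately show ?thesis using C(2)[of b] True m0 by simp
    next
      case False
      then have "p 0 = 0"
        using homogeneous_polynomialD(2)[OF assms, of 0 0] by (simp add: zero_power)
      then show ?thesis using True C by simp
    qed
  next
    case False
    have "norm (p (norm x *\<^sub>R (x /\<^sub>R norm x))) = norm x ^ m * norm (p (x /\<^sub>R norm x))"
      unfolding homogeneous_polynomialD(2)[OF assms] by (simp add: norm_mult norm_power)
    also have "\<dots> \<le> norm x ^ m * C"
      using False by (intro mult_left_mono C) auto
    finally show ?thesis using False by (simp add: mult.commute)
  qed
  with C(1) show ?thesis by (intro exI[of _ C]) auto
qed

section \<open>Homogeneity of the weighted measure and scaling of integrals\<close>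

locale ka_weight = dunkl_weight P k for P :: "'a::euclidean_space set" and k +
  fixes a :: real
  assumes a_pos: "a > 0" and dim_pos: "a + 2 * (\<Sum>\<alpha>\<in>P. k \<alpha>) + real DIM('a) > 2"
begin

abbreviation M :: "'a measure" where "M \<equiv> ka_measure P k a"

text \<open>The homogeneous dimension of \<open>M\<close>: dilating a set by \<open>s > 0\<close>
  multiplies its measure by \<open>s powr hdim\<close>.\<close>

definition hdim :: real where "hdim = a + 2 * (\<Sum>\<alpha>\<in>P. k \<alpha>) + real DIM('a) - 2"

text \<open>Normalised so that \<open>exp (- A x)\<close> is the Gaussian factor of the
  eigenfunctions and \<open>2 * A x\<close> the argument of their Laguerre polynomials.\<close>

definition A :: "'a \<Rightarrow> real" where "A x = norm x powr a / a"

lemma hdim_pos: "hdim > 0"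
  using dim_pos by (simp add: hdim_def)

lemma ka_lambda_eq: "ka_lambda P k a m + 1 = (2 * real m + hdim) / a"
  using a_pos by (simp add: ka_lambda_def hdim_def field_simps)

lemma ka_lambda_gt: "ka_lambda P k a m > -1"
proof -
  have "(2 * real m + hdim) / a > 0" using hdim_pos a_pos by (intro divide_pos_pos) auto
  then show ?thesis using ka_lambda_eq[of m] by linarith
qed

lemma A_nonneg: "A x \<ge> 0"
  using a_pos by (simp add: A_def)

lemma A_pos: "x \<noteq> 0 \<Longrightarrow> A x > 0"
  using a_pos by (simp add: A_def)

lemma A_measurable [measurable]: "A \<in> borel_measurable borel"
  unfolding A_def by measurable

lemma A_scale: "s > 0 \<Longrightarrow> A (s *\<^sub>R x) = s powr a * A x"
  by (simp add: A_def powr_mult)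

lemma continuous_on_A: "continuous_on S A"
  unfolding A_def using a_pos by (intro continuous_on_divide continuous_on_powr' continuous_intros) auto

lemma sets_M [simp, measurable_cong]: "sets M = sets borel"
  by (simp add: ka_measure_def)

lemma space_M [simp]: "space M = UNIV"
  by (simp add: ka_measure_def)

lemma ka_density_measurable [measurable]: "ka_density P k a \<in> borel_measurable borel"
  unfolding ka_density_def using finite_P by measurable

lemma ka_density_nonneg: "ka_density P k a x \<ge> 0"
  unfolding ka_density_def by (intro mult_nonneg_nonneg prod_nonneg) auto

lemma ka_density_scale:
  assumes "s > 0"
  shows "ka_density P k a (s *\<^sub>R x) = s powr (hdim - real DIM('a)) * ka_density P k a x"
proof -
  have "(\<Prod>\<alpha>\<in>P. \<bar>\<alpha> \<bullet> (s *\<^sub>R x)\<bar> powr (2 * k \<alpha>)) = (\<Prod>\<alpha>\<in>P. s powr (2 * k \<alpha>) * \<bar>\<alpha> \<bullet> x\<bar> powr (2 * k \<alpha>))"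
    using assms by (intro prod.cong) (auto simp: abs_mult powr_mult)
  also have "\<dots> = s powr (2 * (\<Sum>\<alpha>\<in>P. k \<alpha>)) * (\<Prod>\<alpha>\<in>P. \<bar>\<alpha> \<bullet> x\<bar> powr (2 * k \<alpha>))"
    using assms finite_P by (simp add: prod.distrib powr_sum sum_distrib_left)
  finally have "ka_density P k a (s *\<^sub>R x) = (s powr (a - 2) * s powr (2 * (\<Sum>\<alpha>\<in>P. k \<alpha>))) * ka_density P k a x"
    using assms unfolding ka_density_def by (simp add: powr_mult mult_ac)
  also have "s powr (a - 2) * s powr (2 * (\<Sum>\<alpha>\<in>P. k \<alpha>)) = s powr (hdim - real DIM('a))"
    unfolding powr_add[symmetric] hdim_def by (simp add: algebra_simps)
  finally show ?thesis .
qed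

lemma nn_integral_M:
  assumes [measurable]: "f \<in> borel_measurable borel"
  shows "(\<integral>\<^sup>+x. f x \<partial>M) = (\<integral>\<^sup>+x. ennreal (ka_density P k a x) * f x \<partial>lborel)"
  unfolding ka_measure_def by (subst nn_integral_density) auto

lemma sigma_finite_M: "sigma_finite_measure M"
  unfolding ka_measure_def by (subst sigma_finite_measure.sigma_finite_iff_density_finite'[OF sigma_finite_lborel]) auto

lemma AE_M_nonzero: "AE x in M. x \<noteq> 0"
  unfolding ka_measure_def by (subst AE_density) (use AE_lborel_singleton[of "0::'a"] in auto)

lemma nn_integral_scale:
  assumes f [measurable]: "f \<in> borel_measurable borel" and s: "s > 0"
  shows "(\<integral>\<^sup>+x. f (s *\<^sub>R x) \<partial>M) = ennreal (s powr (- hdim)) * (\<integral>\<^sup>+x. f x \<partial>M)"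
proof -
  have s': "inverse s > 0" using s by simp
  have "(\<integral>\<^sup>+x. f x \<partial>M) = (\<integral>\<^sup>+x. ennreal (ka_density P k a x) * f x \<partial>lborel)"
    by (rule nn_integral_M[OF f])
  also have "\<dots> = (\<integral>\<^sup>+x. ennreal (ka_density P k a x) * f x
      \<partial>density (distr lborel borel (\<lambda>x. 0 + s *\<^sub>R x)) (\<lambda>_. \<bar>s\<bar> ^ DIM('a)))"
    using s by (subst lborel_affine[of s "0::'a"]) auto
  also have "\<dots> = (\<integral>\<^sup>+x. ennreal (\<bar>s\<bar> ^ DIM('a)) * (ennreal (ka_density P k a (s *\<^sub>R x)) * f (s *\<^sub>R x)) \<partial>lborel)"
    by (simp add: nn_integral_density nn_integral_distr)
  also have "\<dots> = (\<integral>\<^sup>+x. ennreal (s powr hdim) * (ennreal (ka_density P k a x) * f (s *\<^sub>R x)) \<partial>lborel)"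
  proof (intro nn_integral_cong)
    fix x :: 'a
    have "\<bar>s\<bar> ^ DIM('a) * ka_density P k a (s *\<^sub>R x) = s powr hdim * ka_density P k a x"
      unfolding ka_density_scale[OF s] using s by (simp add: powr_diff powr_realpow)
    then have "ennreal (\<bar>s\<bar> ^ DIM('a)) * ennreal (ka_density P k a (s *\<^sub>R x)) = ennreal (s powr hdim) * ennreal (ka_density P k a x)"
      using ka_density_nonneg by (simp add: ennreal_mult[symmetric])
    then show "ennreal (\<bar>s\<bar> ^ DIM('a)) * (ennreal (ka_density P k a (s *\<^sub>R x)) * f (s *\<^sub>R x))
       = ennreal (s powr hdim) * (ennreal (ka_density P k a x) * f (s *\<^sub>R x))"
      by (simp add: mult.assoc[symmetric])
  qed
  also have "\<dots> = ennreal (s powr hdim) * (\<integral>\<^sup>+x. f (s *\<^sub>R x) \<partial>M)"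
    by (subst nn_integral_cmult) (simp_all add: nn_integral_M)
  finally have "ennreal (s powr (- hdim)) * (\<integral>\<^sup>+x. f x \<partial>M)
     = ennreal (s powr (- hdim)) * ennreal (s powr hdim) * (\<integral>\<^sup>+x. f (s *\<^sub>R x) \<partial>M)"
    by (simp add: mult.assoc)
  also have "ennreal (s powr (- hdim)) * ennreal (s powr hdim) = 1"
    using s by (simp add: ennreal_mult[symmetric] powr_add[symmetric])
  finally show ?thesis by simp
qed

text \<open>The dilation with \<open>s powr a = z\<close> absorbs \<open>z\<close> into the
  Gaussian. Stated in \<open>ennreal\<close>, the law is available before any of these integrals is
  known to be finite.\<close>

lemma nn_integral_gauss_scale:
  assumes q [measurable]: "q \<in> borel_measurable borel"
    and hom: "\<And>s x. s > 0 \<Longrightarrow> q (s *\<^sub>R x) = ennreal (s powr d) * q x" and z: "z > 0"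
  shows "(\<integral>\<^sup>+x. q x * ennreal (exp (- z * A x)) \<partial>M)
    = ennreal (z powr (- ((d + hdim) / a))) * (\<integral>\<^sup>+x. q x * ennreal (exp (- A x)) \<partial>M)"
proof -
  define s where "s = z powr (1 / a)"
  have s: "s > 0" "s powr a = z" using z a_pos by (auto simp: s_def powr_powr)
  have "ennreal (s powr d) * (\<integral>\<^sup>+x. q x * ennreal (exp (- z * A x)) \<partial>M)
     = (\<integral>\<^sup>+x. q (s *\<^sub>R x) * ennreal (exp (- A (s *\<^sub>R x))) \<partial>M)"
    by (subst nn_integral_cmult[symmetric]) (auto simp: hom s A_scale mult.assoc)
  also have "\<dots> = ennreal (s powr (- hdim)) * (\<integral>\<^sup>+x. q x * ennreal (exp (- A x)) \<partial>M)"
    by (rule nn_integral_scale[OF _ s(1)]) measurable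
  finally have "ennreal (s powr (- d)) * ennreal (s powr d) * (\<integral>\<^sup>+x. q x * ennreal (exp (- z * A x)) \<partial>M)
     = ennreal (s powr (- d)) * ennreal (s powr (- hdim)) * (\<integral>\<^sup>+x. q x * ennreal (exp (- A x)) \<partial>M)"
    by (simp add: mult.assoc)
  moreover have "ennreal (s powr (- d)) * ennreal (s powr d) = 1"
    using s by (simp add: ennreal_mult[symmetric] powr_add[symmetric])
  moreover have "ennreal (s powr (- d)) * ennreal (s powr (- hdim)) = ennreal (z powr (- ((d + hdim) / a)))"
    by (simp add: ennreal_mult[symmetric] powr_add[symmetric] s_def powr_powr)
       (simp add: add_divide_distrib diff_divide_distrib)
  ultimately show ?thesis by simp
qed

text \<open>With \<open>exp (- A x)\<close> written as the integral of \<open>A x * exp (- y * A x)\<close> over \<open>y \<ge> 1\<close>, Tonelli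
  reduces the moment to the scaling law.\<close>

lemma nn_integral_gauss_moment:
  assumes q [measurable]: "q \<in> borel_measurable borel"
    and hom: "\<And>s x. s > 0 \<Longrightarrow> q (s *\<^sub>R x) = ennreal (s powr d) * q x" and d: "d + hdim > 0"
  shows "(\<integral>\<^sup>+x. q x * ennreal (A x) * ennreal (exp (- A x)) \<partial>M)
    = ennreal ((d + hdim) / a) * (\<integral>\<^sup>+x. q x * ennreal (exp (- A x)) \<partial>M)"
proof -
  interpret sigma_finite_measure M by (rule sigma_finite_M)
  interpret pair_sigma_finite M "lborel :: real measure" ..
  define I where "I = (\<integral>\<^sup>+x. q x * ennreal (A x) * ennreal (exp (- A x)) \<partial>M)"
  define \<kappa> where "\<kappa> = (d + hdim) / a"
  have \<kappa>: "\<kappa> > 0" using d a_pos by (simp add: \<kappa>_def)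
  have 1: "(\<integral>\<^sup>+y. ennreal (A x * exp (- y * A x)) * indicator {1..} y \<partial>lborel) = ennreal (exp (- A x))"
    if "x \<noteq> 0" for x
  proof -
    have "A x > 0" by (rule A_pos[OF that])
    then have "((\<lambda>y. - exp (- y * A x)) \<longlongrightarrow> - 0) at_top"
      by (intro tendsto_minus filterlim_compose[OF exp_at_bot])
         (auto intro!: filterlim_uminus_at_bot_at_top filterlim_at_top_mult_tendsto_pos[OF tendsto_const]
            simp: filterlim_uminus_at_bot filterlim_ident mult.commute)
    then have "(\<integral>\<^sup>+y. ennreal (A x * exp (- y * A x)) * indicator {1..} y \<partial>lborel) = 0 - (- exp (- 1 * A x))"
      by (intro nn_integral_FTC_atLeast) (auto intro!: derivative_eq_intros simp: A_nonneg)
    then show ?thesis by simp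
  qed
  have 2: "(\<integral>\<^sup>+y. ennreal (y powr (- \<kappa> - 1)) * indicator {1..} y \<partial>lborel) = ennreal (1 / \<kappa>)"
  proof -
    have "((\<lambda>y. - (y powr (- \<kappa>)) / \<kappa>) \<longlongrightarrow> - 0 / \<kappa>) at_top"
      using \<kappa> by (intro tendsto_divide tendsto_minus tendsto_neg_powr filterlim_ident tendsto_const) auto
    then have "(\<integral>\<^sup>+y. ennreal (y powr (- \<kappa> - 1)) * indicator {1..} y \<partial>lborel) = - 0 / \<kappa> - (- (1 powr (- \<kappa>)) / \<kappa>)"
      using \<kappa> by (intro nn_integral_FTC_atLeast) (auto intro!: derivative_eq_intros)
    then show ?thesis by simp
  qed
  have hom': "q (s *\<^sub>R x) * ennreal (A (s *\<^sub>R x)) = ennreal (s powr (d + a)) * (q x * ennreal (A x))"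
    if "s > 0" for s x
    using that by (simp add: hom A_scale powr_add ennreal_mult A_nonneg mult_ac)
  have "(\<integral>\<^sup>+x. q x * ennreal (exp (- A x)) \<partial>M)
     = (\<integral>\<^sup>+x. (\<integral>\<^sup>+y. q x * ennreal (A x) * ennreal (exp (- y * A x)) * indicator {1..} y \<partial>lborel) \<partial>M)"
  proof (rule nn_integral_cong_AE, use AE_M_nonzero in eventually_elim)
    fix x :: 'a assume "x \<noteq> 0"
    have "(\<integral>\<^sup>+y. q x * ennreal (A x) * ennreal (exp (- y * A x)) * indicator {1..} y \<partial>lborel)
       = (\<integral>\<^sup>+y. q x * (ennreal (A x * exp (- y * A x)) * indicator {1..} y) \<partial>lborel)"
      by (simp add: ennreal_mult A_nonneg mult.assoc)
    also have "\<dots> = q x * ennreal (exp (- A x))"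
      using 1[OF \<open>x \<noteq> 0\<close>] by (subst nn_integral_cmult) auto
    finally show "q x * ennreal (exp (- A x)) =
      (\<integral>\<^sup>+y. q x * ennreal (A x) * ennreal (exp (- y * A x)) * indicator {1..} y \<partial>lborel)" ..
  qed
  also have "\<dots> = (\<integral>\<^sup>+y. (\<integral>\<^sup>+x. q x * ennreal (A x) * ennreal (exp (- y * A x)) * indicator {1..} y \<partial>M) \<partial>lborel)"
    by (rule Fubini'[symmetric]) measurable
  also have "\<dots> = (\<integral>\<^sup>+y. I * (ennreal (y powr (- \<kappa> - 1)) * indicator {1..} y) \<partial>lborel)"
  proof (intro nn_integral_cong)
    fix y :: real
    show "(\<integral>\<^sup>+x. q x * ennreal (A x) * ennreal (exp (- y * A x)) * indicator {1..} y \<partial>M)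
      = I * (ennreal (y powr (- \<kappa> - 1)) * indicator {1..} y)"
    proof (cases "y \<ge> 1")
      case True
      have e: "- ((d + a + hdim) / a) = - \<kappa> - 1"
        using a_pos by (simp add: \<kappa>_def field_simps)
      have "(\<integral>\<^sup>+x. q x * ennreal (A x) * ennreal (exp (- y * A x)) \<partial>M) = ennreal (y powr (- ((d + a + hdim) / a))) * I"
        unfolding I_def using True by (intro nn_integral_gauss_scale hom') auto
      then show ?thesis using True e by (simp add: mult.commute)
    qed simp
  qed
  also have "\<dots> = I * ennreal (1 / \<kappa>)"
    using 2 by (subst nn_integral_cmult) auto
  finally have "ennreal \<kappa> * (\<integral>\<^sup>+x. q x * ennreal (exp (- A x)) \<partial>M) = I * (ennreal (1 / \<kappa>) * ennreal \<kappa>)"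
    by (simp add: mult_ac)
  also have "ennreal (1 / \<kappa>) * ennreal \<kappa> = 1"
    using \<kappa> by (simp add: ennreal_mult[symmetric])
  finally show ?thesis by (simp add: I_def \<kappa>_def)
qed

section \<open>Finiteness of balls and of Gaussian integrals\<close>

lemma emeasure_scaled_set:
  assumes S: "S \<in> sets borel" and s: "s > 0"
  shows "emeasure M {x. s *\<^sub>R x \<in> S} = ennreal (s powr (- hdim)) * emeasure M S"
proof -
  have "{x. s *\<^sub>R x \<in> S} = (\<lambda>x. s *\<^sub>R x) -` S \<inter> space borel" by auto
  also have "\<dots> \<in> sets borel" by (rule measurable_sets[OF _ S]) measurable
  finally have "emeasure M {x. s *\<^sub>R x \<in> S} = (\<integral>\<^sup>+x. indicator {x. s *\<^sub>R x \<in> S} x \<partial>M)"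
    by simp
  also have "\<dots> = (\<integral>\<^sup>+x. indicator S (s *\<^sub>R x) \<partial>M)"
    by (intro nn_integral_cong) (auto simp: indicator_def)
  also have "\<dots> = ennreal (s powr (- hdim)) * emeasure M S"
    using S by (subst nn_integral_scale[OF _ s]) auto
  finally show ?thesis .
qed

lemma emeasure_M_singleton_zero: "emeasure M {0} = 0"
  using AE_M_nonzero by (subst (asm) AE_iff_measurable[of "{0}"]) auto

text \<open>For \<open>a < 2\<close> the density may be unbounded near the origin, so it is
  estimated only on the shell \<open>1/2 < norm x \<le> 1\<close>. The dyadic dilates of this shell
  cover the ball up to the origin, and their measures form a geometric series of ratio
  \<open>2 powr (- hdim)\<close>, which is below 1.\<close>

lemma emeasure_unit_cball_finite: "emeasure M (cball 0 1) < \<infinity>"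
proof -
  define S where "S n = {x::'a. (1/2) ^ Suc n < norm x \<and> norm x \<le> (1/2) ^ n}" for n
  have S_meas [measurable]: "S n \<in> sets borel" for n
    unfolding S_def by measurable
  have S0: "emeasure M (S 0) < \<infinity>"
  proof -
    define C where "C = (1 + (1/2) powr (a - 2)) * (\<Prod>\<alpha>\<in>P. norm \<alpha> powr (2 * k \<alpha>))"
    have "ka_density P k a x \<le> C" if "x \<in> S 0" for x
    proof -
      have x: "1/2 < norm x" "norm x \<le> 1" using that by (auto simp: S_def)
      have "norm x powr (a - 2) \<le> 1 + (1/2) powr (a - 2)"
      proof (cases "a \<ge> 2")
        case True
        then have "norm x powr (a - 2) \<le> 1 powr (a - 2)" using x by (intro powr_mono2) auto
        then show ?thesis by (simp add: add_increasing2)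
      next
        case False
        then have "norm x powr (a - 2) \<le> (1/2) powr (a - 2)" using x by (intro powr_mono2') auto
        then show ?thesis by simp
      qed
      moreover have "(\<Prod>\<alpha>\<in>P. \<bar>\<alpha> \<bullet> x\<bar> powr (2 * k \<alpha>)) \<le> (\<Prod>\<alpha>\<in>P. norm \<alpha> powr (2 * k \<alpha>))"
      proof (intro prod_mono conjI powr_mono2)
        fix \<alpha> assume "\<alpha> \<in> P"
        then show "0 \<le> 2 * k \<alpha>" using k_nonneg by simp
        have "\<bar>\<alpha> \<bullet> x\<bar> \<le> norm \<alpha> * norm x" by (rule Cauchy_Schwarz_ineq2)
        also have "\<dots> \<le> norm \<alpha> * 1" using x by (intro mult_left_mono) auto
        finally show "\<bar>\<alpha> \<bullet> x\<bar> \<le> norm \<alpha>" by simp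
      qed auto
      ultimately show ?thesis
        unfolding ka_density_def C_def by (intro mult_mono prod_nonneg) auto
    qed
    then have "emeasure M (S 0) \<le> (\<integral>\<^sup>+x. ennreal C * indicator (S 0) x \<partial>lborel)"
      by (subst nn_integral_indicator[symmetric], simp, subst nn_integral_M)
         (auto intro!: nn_integral_mono ennreal_leI split: split_indicator)
    also have "\<dots> = ennreal C * emeasure lborel (S 0)"
      by (rule nn_integral_cmult_indicator) simp
    also have "\<dots> < \<infinity>"
    proof -
      have "bounded (S 0)" by (rule bounded_subset[OF bounded_cball[of 0 1]]) (auto simp: S_def)
      then have "emeasure lborel (S 0) < \<infinity>" by (rule emeasure_bounded_finite)
      then show ?thesis by (simp add: ennreal_mult_less_top)
    qed
    finally show ?thesis .
  qed
  have Sn: "emeasure M (S n) = ennreal ((2 powr (- hdim)) ^ n) * emeasure M (S 0)" for n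
  proof -
    have "S n = {x. (2 ^ n) *\<^sub>R x \<in> S 0}"
      unfolding S_def by (auto simp: field_simps power_divide)
    then have "emeasure M (S n) = ennreal ((2 ^ n) powr (- hdim)) * emeasure M (S 0)"
      using emeasure_scaled_set[of "S 0" "2 ^ n"] by simp
    also have "(2 ^ n :: real) powr (- hdim) = (2 powr (- hdim)) ^ n"
      by (simp add: powr_realpow[symmetric] powr_powr mult.commute)
    finally show ?thesis .
  qed
  have cover: "cball 0 1 \<subseteq> (\<Union>n. S n) \<union> {0}"
  proof
    fix x :: 'a assume x: "x \<in> cball 0 1"
    show "x \<in> (\<Union>n. S n) \<union> {0}"
    proof (cases "x = 0")
      case False
      have ex: "\<exists>n. (1/2) ^ Suc n < norm x"
      proof -
        obtain n where "(1/2) ^ n < norm x"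
          using real_arch_pow_inv[of "norm x" "1/2"] False by auto
        moreover have "(1/2) ^ Suc n \<le> ((1/2) ^ n :: real)" by simp
        ultimately show ?thesis by (intro exI[of _ n]) linarith
      qed
      \<comment> \<open>Minimality supplies the upper bound: the predecessor of \<open>n\<close>
        fails the condition, or \<open>n\<close> is 0 and \<open>norm x \<le> 1\<close>.\<close>
      define n where "n = (LEAST n. (1/2) ^ Suc n < norm x)"
      have n: "(1/2) ^ Suc n < norm x"
        unfolding n_def by (rule LeastI_ex[OF ex])
      moreover have "norm x \<le> (1/2) ^ n"
      proof (cases n)
        case 0
        then show ?thesis using x by simp
      next
        case (Suc n')
        then have "\<not> (1/2) ^ Suc n' < norm x"
          using not_less_Least[of n' "\<lambda>n. (1/2) ^ Suc n < norm x"] by (simp add: n_def)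
        then show ?thesis using Suc by simp
      qed
      ultimately show ?thesis by (auto simp: S_def)
    qed simp
  qed
  define r :: real where "r = 2 powr (- hdim)"
  have r: "0 \<le> r" "r < 1"
    using hdim_pos by (auto simp: r_def powr_less_one)
  have "emeasure M (cball 0 1) \<le> emeasure M ((\<Union>n. S n) \<union> {0})"
    using cover by (intro emeasure_mono) auto
  also have "\<dots> \<le> emeasure M (\<Union>n. S n) + emeasure M {0}"
    by (intro emeasure_subadditive) auto
  also have "\<dots> = emeasure M (\<Union>n. S n)"
    by (simp add: emeasure_M_singleton_zero)
  also have "\<dots> \<le> (\<Sum>n. emeasure M (S n))"
    by (intro emeasure_subadditive_countably) auto
  also have "\<dots> = (\<Sum>n. ennreal (r ^ n)) * emeasure M (S 0)"
    unfolding r_def by (subst ennreal_suminf_multc[symmetric]) (rule suminf_cong[OF Sn])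
  also have "(\<Sum>n. ennreal (r ^ n)) = ennreal (\<Sum>n. r ^ n)"
    using r by (intro suminf_ennreal2 summable_geometric zero_le_power) auto
  also have "\<dots> * emeasure M (S 0) < \<infinity>"
    using S0 by (simp add: ennreal_mult_less_top)
  finally show ?thesis .
qed

lemma emeasure_cball_finite: "emeasure M (cball 0 r) < \<infinity>"
proof -
  define R where "R = max r 1"
  have R: "R > 0" "r \<le> R" by (auto simp: R_def)
  have "cball 0 1 = {x. R *\<^sub>R x \<in> cball (0::'a) R}" using R by (auto simp: )
  then have "emeasure M (cball 0 1) = ennreal (R powr (- hdim)) * emeasure M (cball 0 R)"
    using emeasure_scaled_set[of "cball 0 R" R] R by simp
  then have "ennreal (R powr (- hdim)) * emeasure M (cball 0 R) < \<infinity>"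
    using emeasure_unit_cball_finite by simp
  then have "emeasure M (cball 0 R) < \<infinity>"
    using R by (auto simp: ennreal_mult_less_top)
  moreover have "emeasure M (cball 0 r) \<le> emeasure M (cball 0 R)"
    using R by (intro emeasure_mono) auto
  ultimately show ?thesis by (rule le_less_trans[rotated])
qed

text \<open>Slice the space by the integer part of \<open>A\<close>. The set where
  \<open>A x \<le> r\<close> has \<open>r powr c\<close> times the measure of the set where
  \<open>A x \<le> 1\<close>, so slice \<open>n\<close> contributes at most a multiple of
  \<open>exp (- n) * (n + 1) powr c\<close>. Half of the exponential absorbs the power and leaves a
  geometric series.\<close>

lemma nn_integral_exp_A_finite:
  assumes z: "z > 0"
  shows "(\<integral>\<^sup>+x. ennreal (exp (- z * A x)) \<partial>M) < \<infinity>"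
proof -
  define c where "c = hdim / a"
  have c: "c > 0" using hdim_pos a_pos by (simp add: c_def)
  define m where "m = emeasure M {x. A x \<le> 1}"
  have "m \<le> emeasure M (cball 0 (a powr (1/a)))"
  proof -
    have "norm x \<le> a powr (1 / a)" if "A x \<le> 1" for x
    proof -
      have "(norm x powr a) powr (1 / a) \<le> a powr (1 / a)"
        using that a_pos by (intro powr_mono2) (auto simp: A_def)
      then show ?thesis using a_pos by (simp add: powr_powr)
    qed
    then show ?thesis unfolding m_def by (intro emeasure_mono) auto
  qed
  then have m: "m < \<infinity>" using emeasure_cball_finite by (rule le_less_trans)
  have lev: "emeasure M {x. A x \<le> r} = ennreal (r powr c) * m" if "r > 0" for r
  proof -
    have "A ((r powr (- 1 / a)) *\<^sub>R x) = A x / r" for x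
    proof -
      have "(r powr (- 1 / a)) powr a = 1 / r"
        using that a_pos by (simp only: powr_powr) (simp add: powr_minus_divide)
      moreover have "A ((r powr (- 1 / a)) *\<^sub>R x) = (r powr (- 1 / a)) powr a * A x"
        using that by (intro A_scale) simp
      ultimately show ?thesis by simp
    qed
    then have "{x. A x \<le> r} = {x. (r powr (- 1 / a)) *\<^sub>R x \<in> {x. A x \<le> 1}}"
      using that by auto
    then show ?thesis
      using that a_pos emeasure_scaled_set[of "{x. A x \<le> 1}" "r powr (- 1 / a)"]
      by (simp add: m_def powr_powr c_def)
  qed
  define N where "N = nat \<lceil>c\<rceil>"
  have N: "c \<le> real N" using c unfolding N_def by linarith
  define q :: real where "q = exp (- (1/2))"
  have q: "0 \<le> q" "q < 1" by (auto simp: q_def)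
  define K :: real where "K = fact N / (1/2) ^ N * exp (1/2)"
  have summand_le: "exp (- real n) * real (n + 1) powr c \<le> K * q ^ n" for n
  proof -
    have "real (n + 1) powr c \<le> real (n + 1) powr real N"
      using N by (intro powr_mono) auto
    also have "\<dots> = real (n + 1) ^ N" by (simp add: powr_realpow)
    also have "\<dots> \<le> fact N / (1/2) ^ N * exp (1/2 * real (n + 1))"
      by (rule power_le_exp_bound) auto
    also have "\<dots> = K * exp (real n / 2)"
      unfolding K_def by (simp add: exp_add[symmetric] mult.assoc field_simps)
    finally have "exp (- real n) * real (n + 1) powr c \<le> exp (- real n) * (K * exp (real n / 2))"
      by (intro mult_left_mono) auto
    also have "\<dots> = K * q ^ n"
      by (simp add: q_def exp_of_nat_mult[symmetric] exp_add[symmetric] mult.left_commute)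
    finally show ?thesis .
  qed
  have K: "K \<ge> 0" by (simp add: K_def)
  have "(\<integral>\<^sup>+x. ennreal (exp (- A x)) \<partial>M)
      \<le> (\<integral>\<^sup>+x. (\<Sum>n. ennreal (exp (- real n)) * indicator {x. A x \<le> real (n + 1)} x) \<partial>M)"
  proof (intro nn_integral_mono)
    fix x :: 'a
    define n where "n = nat \<lfloor>A x\<rfloor>"
    have n: "real n \<le> A x" "A x \<le> real (n + 1)"
      using A_nonneg[of x] unfolding n_def by linarith+
    have "ennreal (exp (- A x)) \<le> ennreal (exp (- real n)) * indicator {x. A x \<le> real (n + 1)} x"
      using n by (auto intro!: ennreal_leI)
    also have "\<dots> \<le> (\<Sum>n. ennreal (exp (- real n)) * indicator {x. A x \<le> real (n + 1)} x)"
    proof -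
      define f :: "nat \<Rightarrow> ennreal" where "f n = ennreal (exp (- real n)) * indicator {x. A x \<le> real (n + 1)} x" for n
      have "f n \<le> suminf f" using sum_le_suminf[of f "{n}"] by simp
      then show ?thesis unfolding f_def .
    qed
    finally show "ennreal (exp (- A x)) \<le> (\<Sum>n. ennreal (exp (- real n)) * indicator {x. A x \<le> real (n + 1)} x)" .
  qed
  also have "\<dots> = (\<Sum>n. ennreal (exp (- real n)) * emeasure M {x. A x \<le> real (n + 1)})"
    by (subst nn_integral_suminf) (auto intro!: suminf_cong nn_integral_cmult_indicator)
  also have "\<dots> = (\<Sum>n. ennreal (exp (- real n) * real (n + 1) powr c) * m)"
    by (intro suminf_cong) (subst lev, auto simp: ennreal_mult mult.assoc)
  also have "\<dots> \<le> (\<Sum>n. ennreal (K * q ^ n) * m)"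
    by (intro suminf_le mult_right_mono ennreal_leI summand_le) auto
  also have "\<dots> = (\<Sum>n. ennreal (K * q ^ n)) * m" by simp
  also have "(\<Sum>n. ennreal (K * q ^ n)) = ennreal (\<Sum>n. K * q ^ n)"
    using K q by (intro suminf_ennreal2 summable_mult summable_geometric mult_nonneg_nonneg zero_le_power) auto
  also have "\<dots> * m < \<infinity>" using m by (simp add: ennreal_mult_less_top)
  finally have "(\<integral>\<^sup>+x. ennreal (exp (- A x)) \<partial>M) < \<infinity>" .
  then show ?thesis
    using nn_integral_gauss_scale[of "\<lambda>_. 1" 0 z] z by (simp add: ennreal_mult_less_top)
qed

text \<open>Half of the rate is spent on the polynomial growth. For \<open>norm x > 1\<close> the
  exponent \<open>j\<close> is rounded up to a multiple of \<open>a\<close>, which makes the power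
  of the norm an integer power of \<open>a * A x\<close>; for \<open>norm x \<le> 1\<close> the
  bound 1 suffices.\<close>

lemma gauss_polynomial_bound:
  assumes z: "z > 0"
  shows "\<exists>C\<ge>0. \<forall>x::'a. norm x ^ j * A x ^ i * exp (- z * A x) \<le> C * exp (- (z / 2) * A x)"
proof -
  define N where "N = nat \<lceil>real j / a\<rceil>"
  have N: "real j \<le> a * real N"
  proof -
    have "real j / a \<le> real N" using a_pos unfolding N_def by linarith
    then show ?thesis using a_pos by (simp add: field_simps)
  qed
  define B where "B n = fact n / (z / 2) ^ n" for n
  have B: "A x ^ n \<le> B n * exp (z / 2 * A x)" for x n
    unfolding B_def using z by (intro power_le_exp_bound A_nonneg) auto
  have nB: "B n \<ge> 0" for n using z by (simp add: B_def)
  have "norm x ^ j * A x ^ i * exp (- z * A x) \<le> (B i + a ^ N * B (N + i)) * exp (- (z / 2) * A x)" for x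
  proof -
    have "norm x ^ j \<le> 1 + (a * A x) ^ N"
    proof (cases "norm x \<le> 1")
      case True
      then have "norm x ^ j \<le> 1" by (intro power_le_one) auto
      moreover have "(a * A x) ^ N \<ge> 0" using A_nonneg a_pos by simp
      ultimately show ?thesis by linarith
    next
      case False
      then have "norm x > 0" by linarith
      then have "norm x ^ j = norm x powr real j" by (simp add: powr_realpow)
      also have "\<dots> \<le> norm x powr (a * real N)" using False N by (intro powr_mono) auto
      also have "\<dots> = (norm x powr a) ^ N"
        using \<open>norm x > 0\<close> unfolding powr_powr[symmetric] by (intro powr_realpow) simp
      also have "norm x powr a = a * A x" using a_pos by (simp add: A_def)
      finally show ?thesis by simp
    qed
    then have "norm x ^ j * A x ^ i \<le> (1 + (a * A x) ^ N) * A x ^ i"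
      by (rule mult_right_mono) (simp add: A_nonneg)
    also have "\<dots> = A x ^ i + a ^ N * A x ^ (N + i)"
      by (simp add: algebra_simps power_add power_mult_distrib)
    also have "\<dots> \<le> B i * exp (z / 2 * A x) + a ^ N * (B (N + i) * exp (z / 2 * A x))"
      using a_pos by (intro add_mono B mult_left_mono) auto
    finally have "norm x ^ j * A x ^ i * exp (- z * A x) \<le>
        (B i * exp (z / 2 * A x) + a ^ N * (B (N + i) * exp (z / 2 * A x))) * exp (- z * A x)"
      by (rule mult_right_mono) simp
    also have "\<dots> = (B i + a ^ N * B (N + i)) * (exp (z / 2 * A x) * exp (- z * A x))"
      by (simp add: algebra_simps)
    also have "exp (z / 2 * A x) * exp (- z * A x) = exp (- (z / 2) * A x)"
      by (simp add: exp_add[symmetric] algebra_simps)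
    finally show ?thesis .
  qed
  moreover have "B i + a ^ N * B (N + i) \<ge> 0" using nB a_pos by simp
  ultimately show ?thesis by blast
qed

lemma nn_integral_gauss_bound_finite:
  fixes f :: "'a \<Rightarrow> 'b::real_normed_vector"
  assumes z: "z > 0" and C: "C \<ge> 0" and f: "\<And>x. norm (f x) \<le> C * (norm x ^ j * A x ^ i * exp (- z * A x))"
  shows "(\<integral>\<^sup>+x. ennreal (norm (f x)) \<partial>M) < \<infinity>"
proof -
  obtain B where B: "B \<ge> 0" "\<And>x. norm x ^ j * A x ^ i * exp (- z * A x) \<le> B * exp (- (z / 2) * A x)"
    using gauss_polynomial_bound[OF z] by blast
  have "norm (f x) \<le> C * B * exp (- (z / 2) * A x)" for x
    using order.trans[OF f mult_left_mono[OF B(2) C]] by (simp add: mult.assoc)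
  then have "(\<integral>\<^sup>+x. ennreal (norm (f x)) \<partial>M) \<le> (\<integral>\<^sup>+x. ennreal (C * B) * ennreal (exp (- (z / 2) * A x)) \<partial>M)"
    using C B(1) by (intro nn_integral_mono) (auto simp: ennreal_mult[symmetric] intro!: ennreal_leI)
  also have "\<dots> = ennreal (C * B) * (\<integral>\<^sup>+x. ennreal (exp (- (z / 2) * A x)) \<partial>M)"
    by (rule nn_integral_cmult) measurable
  also have "\<dots> < \<infinity>"
    using nn_integral_exp_A_finite[of "z / 2"] z by (simp add: ennreal_mult_less_top)
  finally show ?thesis .
qed

lemma integrable_gauss_bound:
  fixes f :: "'a \<Rightarrow> 'b::{banach, second_countable_topology}"
  assumes "f \<in> borel_measurable borel" "z > 0" "C \<ge> 0"
    and "\<And>x. norm (f x) \<le> C * (norm x ^ j * A x ^ i * exp (- z * A x))"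
  shows "integrable M f"
  using nn_integral_gauss_bound_finite[OF assms(2-4)] assms(1)
  by (intro integrableI_bounded) auto

section \<open>Gaussian integrals of signed and complex polynomials\<close>

definition gauss :: "('a \<Rightarrow> complex) \<Rightarrow> real \<Rightarrow> 'a \<Rightarrow> complex" where
  "gauss p z x = p x * of_real (exp (- z * A x))"

lemma gauss_mult_cnj: "gauss p z x * cnj (gauss q y x) = p x * cnj (q x) * of_real (exp (- (z + y) * A x))"
  unfolding gauss_def by (simp add: exp_add[symmetric] algebra_simps flip: of_real_mult)

lemma gauss_integral_nonneg:
  fixes q :: "'a \<Rightarrow> real"
  assumes q [measurable]: "q \<in> borel_measurable borel" and nn: "\<And>x. 0 \<le> q x"
    and hom: "\<And>s x. s > 0 \<Longrightarrow> q (s *\<^sub>R x) = s powr d * q x" and d: "d + hdim > 0" and z: "z > 0"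
  shows "(LINT x|M. q x * exp (- z * A x)) = z powr (- ((d + hdim) / a)) * (LINT x|M. q x * exp (- A x))"
    and "(LINT x|M. q x * A x * exp (- z * A x))
      = (d + hdim) / a * z powr (- ((d + hdim) / a) - 1) * (LINT x|M. q x * exp (- A x))"
proof -
  have hom': "ennreal (q (s *\<^sub>R x)) = ennreal (s powr d) * ennreal (q x)" if "s > 0" for s x
    using that by (simp add: hom ennreal_mult nn)
  have conv: "(LINT x|M. q x * A x ^ i * exp (- z * A x)) = enn2real (\<integral>\<^sup>+x. ennreal (q x) * ennreal (A x ^ i) * ennreal (exp (- z * A x)) \<partial>M)"
    for i z
    by (subst integral_eq_nn_integral) (auto simp: nn A_nonneg ennreal_mult)
  show scale: "(LINT x|M. q x * exp (- z * A x)) = z powr (- ((d + hdim) / a)) * (LINT x|M. q x * exp (- A x))"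
    using conv[of 0 z] conv[of 0 1] nn_integral_gauss_scale[of "\<lambda>x. ennreal (q x)" d z, OF _ hom' z]
    by (simp add: enn2real_mult)
  have hom2: "ennreal (q (s *\<^sub>R x)) * ennreal (A (s *\<^sub>R x)) = ennreal (s powr (d + a)) * (ennreal (q x) * ennreal (A x))"
    if "s > 0" for s x
    using that by (simp add: hom A_scale ennreal_mult nn A_nonneg powr_add mult_ac)
  have "(\<integral>\<^sup>+x. ennreal (q x) * ennreal (A x) * ennreal (exp (- z * A x)) \<partial>M)
     = ennreal (z powr (- ((d + a + hdim) / a))) * (\<integral>\<^sup>+x. ennreal (q x) * ennreal (A x) * ennreal (exp (- A x)) \<partial>M)"
    by (rule nn_integral_gauss_scale[OF _ hom2 z]) measurable
  also have "(\<integral>\<^sup>+x. ennreal (q x) * ennreal (A x) * ennreal (exp (- A x)) \<partial>M)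
     = ennreal ((d + hdim) / a) * (\<integral>\<^sup>+x. ennreal (q x) * ennreal (exp (- A x)) \<partial>M)"
    by (rule nn_integral_gauss_moment[OF _ hom' d]) measurable
  also have "- ((d + a + hdim) / a) = - ((d + hdim) / a) - 1"
    using a_pos by (simp add: field_simps)
  finally show "(LINT x|M. q x * A x * exp (- z * A x))
      = (d + hdim) / a * z powr (- ((d + hdim) / a) - 1) * (LINT x|M. q x * exp (- A x))"
    using conv[of 1 z] conv[of 0 1] d a_pos by (simp add: enn2real_mult)
qed

text \<open>Positive and negative part of a homogeneous function are homogeneous of the same degree,
  so the nonnegative case applies to each. Integrability serves to recombine them.\<close>

lemma gauss_integral_real:
  fixes q :: "'a \<Rightarrow> real"
  assumes q [measurable]: "q \<in> borel_measurable borel"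
    and hom: "\<And>s x. s > 0 \<Longrightarrow> q (s *\<^sub>R x) = s powr d * q x" and d: "d + hdim > 0" and z: "z > 0"
    and int: "\<And>i z. z > 0 \<Longrightarrow> integrable M (\<lambda>x. q x * A x ^ i * exp (- z * A x))"
  shows "(LINT x|M. q x * exp (- z * A x)) = z powr (- ((d + hdim) / a)) * (LINT x|M. q x * exp (- A x))"
    and "(LINT x|M. q x * A x * exp (- z * A x))
      = (d + hdim) / a * z powr (- ((d + hdim) / a) - 1) * (LINT x|M. q x * exp (- A x))"
proof -
  define p n where "p x = max 0 (q x)" and "n x = max 0 (- q x)" for x
  have pn: "q x = p x - n x" for x by (auto simp: p_def n_def)
  have [measurable]: "p \<in> borel_measurable borel" "n \<in> borel_measurable borel"
    unfolding p_def n_def by measurable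
  have nn: "0 \<le> p x" "0 \<le> n x" for x by (auto simp: p_def n_def)
  have homp: "p (s *\<^sub>R x) = s powr d * p x" and homn: "n (s *\<^sub>R x) = s powr d * n x" if "s > 0" for s x
    using that by (auto simp: p_def n_def hom max_def zero_le_mult_iff mult_le_0_iff)
  have intp: "integrable M (\<lambda>x. p x * A x ^ i * exp (- z * A x))" and intn: "integrable M (\<lambda>x. n x * A x ^ i * exp (- z * A x))"
    if "z > 0" for i z
    using that by (auto intro!: Bochner_Integration.integrable_bound[OF int[OF that, of i]]
        simp: abs_mult p_def n_def intro!: AE_I2 mult_right_mono)
  have diff: "(LINT x|M. q x * A x ^ i * exp (- z * A x))
     = (LINT x|M. p x * A x ^ i * exp (- z * A x)) - (LINT x|M. n x * A x ^ i * exp (- z * A x))" if "z > 0" for i z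
    unfolding pn left_diff_distrib by (rule Bochner_Integration.integral_diff[OF intp[OF that] intn[OF that]])
  note gp = gauss_integral_nonneg[of p d z, OF _ nn(1) homp d z] and gn = gauss_integral_nonneg[of n d z, OF _ nn(2) homn d z]
  show "(LINT x|M. q x * exp (- z * A x)) = z powr (- ((d + hdim) / a)) * (LINT x|M. q x * exp (- A x))"
    using diff[OF z, of 0] diff[of 1 0] gp(1) gn(1) by (simp add: right_diff_distrib)
  show "(LINT x|M. q x * A x * exp (- z * A x))
      = (d + hdim) / a * z powr (- ((d + hdim) / a) - 1) * (LINT x|M. q x * exp (- A x))"
    using diff[OF z, of 1] diff[of 1 0] gp(2) gn(2) by (simp add: right_diff_distrib)
qed

lemma homogeneous_polynomial_measurable [measurable_dest]:
  "homogeneous_polynomial m p \<Longrightarrow> p \<in> borel_measurable borel"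
  by (intro borel_measurable_continuous_onI continuous_on_polymonial_function)
     (rule homogeneous_polynomialD(1))

lemma gauss_moment_integrable:
  assumes q: "homogeneous_polynomial m q" and z: "z > 0"
  shows "integrable M (\<lambda>x. q x * of_real (A x ^ i * exp (- z * A x)))"
proof -
  obtain C where C: "C \<ge> 0" "\<And>x. norm (q x) \<le> C * norm x ^ m"
    using homogeneous_polynomial_bound[OF q] by blast
  have [measurable]: "q \<in> borel_measurable borel" by (rule homogeneous_polynomial_measurable[OF q])
  show ?thesis
  proof (rule integrable_gauss_bound[OF _ z C(1)])
    show "norm (q x * of_real (A x ^ i * exp (- z * A x))) \<le> C * (norm x ^ m * A x ^ i * exp (- z * A x))" for x
      using mult_right_mono[OF C(2)[of x], of "A x ^ i * exp (- z * A x)"] A_nonneg[of x]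
      by (simp add: norm_mult norm_power abs_of_nonneg mult.assoc)
  qed measurable
qed

text \<open>Formally the second identity is minus the derivative of the first in \<open>z\<close>.
  It rests on \<open>nn_integral_gauss_moment\<close>, so no differentiation under the integral sign
  occurs.\<close>

lemma gauss_integral_polynomial:
  assumes q: "homogeneous_polynomial m q" and z: "z > 0"
  defines "\<kappa> \<equiv> (real m + hdim) / a"
  shows "(LINT x|M. q x * of_real (exp (- z * A x))) = of_real (z powr (- \<kappa>)) * (LINT x|M. q x * of_real (exp (- A x)))"
    and "(LINT x|M. q x * of_real (A x * exp (- z * A x)))
      = of_real (\<kappa> * z powr (- \<kappa> - 1)) * (LINT x|M. q x * of_real (exp (- A x)))"
proof -
  have [measurable]: "q \<in> borel_measurable borel" by (rule homogeneous_polynomial_measurable[OF q])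
  have d: "real m + hdim > 0" using hdim_pos by simp
  have int: "integrable M (\<lambda>x. q x * of_real (A x ^ i * exp (- z * A x)))" if "z > 0" for i z
    by (rule gauss_moment_integrable[OF q that])
  have Re: "Re (LINT x|M. q x * of_real (A x ^ i * exp (- z * A x))) = (LINT x|M. Re (q x) * A x ^ i * exp (- z * A x))"
    and Im: "Im (LINT x|M. q x * of_real (A x ^ i * exp (- z * A x))) = (LINT x|M. Im (q x) * A x ^ i * exp (- z * A x))"
    if "z > 0" for i z
    using integral_Re[OF int[OF that, of i]] integral_Im[OF int[OF that, of i]] by (simp_all add: mult.assoc)
  have hom: "q (s *\<^sub>R x) = of_real (s powr real m) * q x" if "s > 0" for s x
    using that homogeneous_polynomialD(2)[OF q] by (simp add: powr_realpow)
  have intRe: "integrable M (\<lambda>x. Re (q x) * A x ^ i * exp (- z * A x))"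
    and intIm: "integrable M (\<lambda>x. Im (q x) * A x ^ i * exp (- z * A x))" if "z > 0" for i z
    using integrable_Re[OF int[OF that, of i]] integrable_Im[OF int[OF that, of i]] by (simp_all add: mult.assoc)
  have homRe: "Re (q (s *\<^sub>R x)) = s powr real m * Re (q x)" and homIm: "Im (q (s *\<^sub>R x)) = s powr real m * Im (q x)"
    if "s > 0" for s x using hom[OF that] by simp_all
  note R = gauss_integral_real[of "\<lambda>x. Re (q x)" "real m", OF _ homRe d z intRe]
    and I = gauss_integral_real[of "\<lambda>x. Im (q x)" "real m", OF _ homIm d z intIm]
  show "(LINT x|M. q x * of_real (exp (- z * A x))) = of_real (z powr (- \<kappa>)) * (LINT x|M. q x * of_real (exp (- A x)))"
    unfolding \<kappa>_def using Re[OF z, of 0] Im[OF z, of 0] Re[of 1 0] Im[of 1 0] R(1) I(1)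
    by (simp add: complex_eq_iff)
  show "(LINT x|M. q x * of_real (A x * exp (- z * A x)))
      = of_real (\<kappa> * z powr (- \<kappa> - 1)) * (LINT x|M. q x * of_real (exp (- A x)))"
    unfolding \<kappa>_def using Re[OF z, of 1] Im[OF z, of 1] Re[of 1 0] Im[of 1 0] R(2) I(2)
    by (simp add: complex_eq_iff)
qed

lemma homogeneous_polynomial_cnj:
  assumes "homogeneous_polynomial m p"
  shows "homogeneous_polynomial m (\<lambda>x. cnj (p x))"
  using homogeneous_polynomialD[OF assms]
    polynomial_function_compose[OF _ polynomial_function_bounded_linear[OF bounded_linear_cnj], of p]
  by (simp add: homogeneous_polynomial_def o_def)

lemma L2_gauss:
  assumes p: "homogeneous_polynomial m p" and z: "z > 0"
  shows "gauss p z \<in> L2_functions M"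
proof -
  have [measurable]: "p \<in> borel_measurable borel" by (rule homogeneous_polynomial_measurable[OF p])
  have "integrable M (\<lambda>x. (p x * cnj (p x)) * of_real (A x ^ 0 * exp (- (2 * z) * A x)))"
    using z by (intro gauss_moment_integrable[OF homogeneous_polynomial_mult[OF p homogeneous_polynomial_cnj[OF p]]]) auto
  then have "integrable M (\<lambda>x. Re ((p x * cnj (p x)) * of_real (A x ^ 0 * exp (- (2 * z) * A x))))"
    by (rule integrable_Re)
  moreover have "Re ((p x * cnj (p x)) * of_real (A x ^ 0 * exp (- (2 * z) * A x))) = (norm (gauss p z x))\<^sup>2" for x
    unfolding complex_norm_square[symmetric] gauss_def
    by (simp add: norm_mult power_mult_distrib exp_double[symmetric] algebra_simps power2_eq_square flip: exp_add)
  ultimately show ?thesis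
    unfolding L2_functions_def gauss_def by simp
qed

end

section \<open>Expansion of Gaussians into Laguerre functions\<close>

lemma norm_add_power2_le:
  fixes u v :: "'b::real_normed_vector"
  shows "(norm (u + v))\<^sup>2 \<le> 2 * (norm u)\<^sup>2 + 2 * (norm v)\<^sup>2"
proof -
  have "(norm (u + v))\<^sup>2 \<le> (norm u + norm v)\<^sup>2"
    by (intro power_mono norm_triangle_ineq) auto
  also have "\<dots> \<le> 2 * (norm u)\<^sup>2 + 2 * (norm v)\<^sup>2"
    using sum_squares_bound[of "norm u" "norm v"] by (simp add: power2_sum)
  finally show ?thesis .
qed

text \<open>Squared and with values in \<open>ennreal\<close>, so that convergence can be stated
  without integrability conditions. The bound \<open>sqnorm_add_le\<close>, with factors 2, takes
  the place of the triangle inequality.\<close>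

definition sqnorm :: "'b measure \<Rightarrow> ('b \<Rightarrow> complex) \<Rightarrow> ennreal" where
  "sqnorm M f = (\<integral>\<^sup>+x. ennreal ((norm (f x))\<^sup>2) \<partial>M)"

lemma L2_functions_iff:
  "f \<in> L2_functions M \<longleftrightarrow> f \<in> borel_measurable M \<and> sqnorm M f < \<infinity>"
  unfolding L2_functions_def sqnorm_def by (auto simp: integrable_iff_bounded)

lemma L2_functions_measurable [measurable_dest]: "f \<in> L2_functions M \<Longrightarrow> f \<in> borel_measurable M"
  by (simp add: L2_functions_def)

lemma sqnorm_add_le:
  assumes [measurable]: "f \<in> borel_measurable M" "g \<in> borel_measurable M"
  shows "sqnorm M (\<lambda>x. f x + g x) \<le> 2 * sqnorm M f + 2 * sqnorm M g"
proof -
  have "sqnorm M (\<lambda>x. f x + g x) \<le> (\<integral>\<^sup>+x. 2 * ennreal ((norm (f x))\<^sup>2) + 2 * ennreal ((norm (g x))\<^sup>2) \<partial>M)"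
    unfolding sqnorm_def
  proof (intro nn_integral_mono)
    fix x
    have "ennreal ((norm (f x + g x))\<^sup>2) \<le> ennreal (2 * (norm (f x))\<^sup>2 + 2 * (norm (g x))\<^sup>2)"
      by (intro ennreal_leI norm_add_power2_le)
    then show "ennreal ((norm (f x + g x))\<^sup>2) \<le> 2 * ennreal ((norm (f x))\<^sup>2) + 2 * ennreal ((norm (g x))\<^sup>2)"
      by (simp add: ennreal_mult)
  qed
  also have "\<dots> = 2 * sqnorm M f + 2 * sqnorm M g"
    unfolding sqnorm_def by (simp add: nn_integral_add nn_integral_cmult)
  finally show ?thesis .
qed

lemma sqnorm_cmult:
  assumes [measurable]: "f \<in> borel_measurable M"
  shows "sqnorm M (\<lambda>x. c * f x) = ennreal ((norm c)\<^sup>2) * sqnorm M f"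
  unfolding sqnorm_def by (subst nn_integral_cmult[symmetric]) (auto simp: norm_mult power_mult_distrib ennreal_mult)

lemma sqnorm_minus_commute: "sqnorm M (\<lambda>x. f x - g x) = sqnorm M (\<lambda>x. g x - f x)"
  unfolding sqnorm_def by (simp add: norm_minus_commute)

lemma L2_functions_lincomb:
  assumes "f \<in> L2_functions M" "g \<in> L2_functions M"
  shows "(\<lambda>x. c * f x + d * g x) \<in> L2_functions M"
proof -
  have [measurable]: "f \<in> borel_measurable M" "g \<in> borel_measurable M"
    using assms by (auto simp: L2_functions_iff)
  have "sqnorm M (\<lambda>x. c * f x + d * g x) \<le> 2 * sqnorm M (\<lambda>x. c * f x) + 2 * sqnorm M (\<lambda>x. d * g x)"
    by (rule sqnorm_add_le) measurable
  also have "\<dots> < \<infinity>"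
    using assms unfolding sqnorm_cmult[OF \<open>f \<in> borel_measurable M\<close>] sqnorm_cmult[OF \<open>g \<in> borel_measurable M\<close>]
    by (auto simp: L2_functions_iff ennreal_mult_less_top)
  finally show ?thesis by (auto simp: L2_functions_iff)
qed

lemma L2_functions_cmult: "f \<in> L2_functions M \<Longrightarrow> (\<lambda>x. c * f x) \<in> L2_functions M"
  using L2_functions_lincomb[of f M f c 0] by simp

lemma L2_functions_diff: "f \<in> L2_functions M \<Longrightarrow> g \<in> L2_functions M \<Longrightarrow> (\<lambda>x. f x - g x) \<in> L2_functions M"
  using L2_functions_lincomb[of f M g 1 "-1"] by simp

lemma L2_functions_zero: "(\<lambda>x. 0) \<in> L2_functions M"
  by (simp add: L2_functions_def)

lemma L2_functions_sum:
  assumes "finite I" "\<And>i. i \<in> I \<Longrightarrow> f i \<in> L2_functions M"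
  shows "(\<lambda>x. \<Sum>i\<in>I. c i * f i x) \<in> L2_functions M"
  using assms
proof (induction rule: finite_induct)
  case (insert i I)
  then show ?case
    using L2_functions_lincomb[of "f i" M "\<lambda>x. \<Sum>i\<in>I. c i * f i x" "c i" 1] by simp
qed (simp add: L2_functions_zero)

lemma sqnorm_eq_0_iff:
  assumes "f \<in> borel_measurable M"
  shows "sqnorm M f = 0 \<longleftrightarrow> (AE x in M. f x = 0)"
proof -
  have [measurable]: "f \<in> borel_measurable M" by fact
  show ?thesis
    unfolding sqnorm_def by (subst nn_integral_0_iff_AE) (auto simp: )
qed

lemma sqnorm_cong_AE:
  "AE x in M. f x = g x \<Longrightarrow> sqnorm M f = sqnorm M g"
  unfolding sqnorm_def by (intro nn_integral_cong_AE) (auto elim: eventually_mono)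

text \<open>Cauchy-Schwarz after splitting each weight \<open>b l\<close> into two square roots: the
  squared tail is at most the geometric sum times the weighted sum of squares. Once integrated, the
  right-hand side depends on the \<open>u l\<close> only through their norms.\<close>

lemma series_tail_square_le:
  fixes u :: "nat \<Rightarrow> complex"
  assumes r: "0 \<le> r" "r < 1" and c: "\<And>l. norm (c l) \<le> r ^ l" and s: "(\<lambda>l. c l * u l) sums S"
  shows "ennreal ((norm (S - (\<Sum>l<n. c l * u l)))\<^sup>2)
    \<le> ennreal (1 / (1 - r)) * (\<Sum>l. ennreal (r ^ (l + n)) * ennreal ((norm (u (l + n)))\<^sup>2))"
proof -
  define v where "v l = c (l + n) * u (l + n)" for l
  have "v sums (S - (\<Sum>l<n. c l * u l))"
    unfolding v_def using s by (subst sums_iff_shift) simp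
  then have "(\<lambda>K. ennreal ((norm (\<Sum>l<K. v l))\<^sup>2)) \<longlonglongrightarrow> ennreal ((norm (S - (\<Sum>l<n. c l * u l)))\<^sup>2)"
    unfolding sums_def by (intro tendsto_ennrealI tendsto_intros)
  then show ?thesis
  proof (rule LIMSEQ_le_const2, intro exI allI impI)
    fix K :: nat
    define b where "b l = r ^ (l + n)" for l
    have b: "b l \<ge> 0" for l using r by (simp add: b_def)
    have "norm (\<Sum>l<K. v l) \<le> (\<Sum>l<K. sqrt (b l) * (sqrt (b l) * norm (u (l + n))))"
    proof (intro order.trans[OF norm_sum] sum_mono)
      fix l
      have "norm (v l) \<le> b l * norm (u (l + n))"
        unfolding v_def b_def norm_mult by (intro mult_right_mono c) auto
      also have "\<dots> = sqrt (b l) * (sqrt (b l) * norm (u (l + n)))"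
        using b[of l] by (simp add: mult.assoc[symmetric])
      finally show "norm (v l) \<le> sqrt (b l) * (sqrt (b l) * norm (u (l + n)))" .
    qed
    then have "(norm (\<Sum>l<K. v l))\<^sup>2 \<le> (\<Sum>l<K. sqrt (b l) * (sqrt (b l) * norm (u (l + n))))\<^sup>2"
      by (intro power_mono) auto
    also have "\<dots> \<le> (\<Sum>l<K. (sqrt (b l))\<^sup>2) * (\<Sum>l<K. (sqrt (b l) * norm (u (l + n)))\<^sup>2)"
      by (rule Cauchy_Schwarz_ineq_sum)
    also have "\<dots> = (\<Sum>l<K. b l) * (\<Sum>l<K. b l * (norm (u (l + n)))\<^sup>2)"
      using b by (simp add: power_mult_distrib)
    also have "\<dots> \<le> 1 / (1 - r) * (\<Sum>l<K. b l * (norm (u (l + n)))\<^sup>2)"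
    proof (intro mult_right_mono sum_nonneg mult_nonneg_nonneg b)
      have "(\<Sum>l<K. b l) \<le> (\<Sum>l<K. r ^ l)"
        unfolding b_def using r by (intro sum_mono power_decreasing) auto
      also have "\<dots> \<le> (\<Sum>l. r ^ l)"
        using r by (intro sum_le_suminf summable_geometric) auto
      also have "\<dots> = 1 / (1 - r)" using r by (intro suminf_geometric) auto
      finally show "(\<Sum>l<K. b l) \<le> 1 / (1 - r)" .
    qed auto
    finally have "ennreal ((norm (\<Sum>l<K. v l))\<^sup>2) \<le> ennreal (1 / (1 - r) * (\<Sum>l<K. b l * (norm (u (l + n)))\<^sup>2))"
      by (rule ennreal_leI)
    also have "\<dots> = ennreal (1 / (1 - r)) * (\<Sum>l<K. ennreal (b l) * ennreal ((norm (u (l + n)))\<^sup>2))"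
      using r b by (subst ennreal_mult) (auto simp: ennreal_mult[symmetric] intro!: sum_nonneg)
    also have "\<dots> \<le> ennreal (1 / (1 - r)) * (\<Sum>l. ennreal (b l) * ennreal ((norm (u (l + n)))\<^sup>2))"
      by (intro mult_left_mono sum_le_suminf) auto
    finally show "ennreal ((norm (\<Sum>l<K. v l))\<^sup>2)
      \<le> ennreal (1 / (1 - r)) * (\<Sum>l. ennreal (r ^ (l + n)) * ennreal ((norm (u (l + n)))\<^sup>2))"
      unfolding b_def .
  qed
qed

text \<open>A generating function is a pointwise sum, while the transform respects mean-square
  limits. The geometric coefficients make the two kinds of convergence agree as long as the norms of
  the \<open>u l\<close> grow moderately.\<close>

lemma series_sqnorm_convergence:
  fixes u :: "nat \<Rightarrow> 'b \<Rightarrow> complex"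
  assumes meas [measurable]: "\<And>l. u l \<in> borel_measurable M"
    and r: "0 \<le> r" "r < 1" and c: "\<And>l. norm (c l) \<le> r ^ l"
    and s: "\<And>x. (\<lambda>l. c l * u l x) sums S x"
    and b: "\<And>l. sqnorm M (u l) = ennreal (b l)" "\<And>l. b l \<ge> 0" "summable (\<lambda>l. r ^ l * b l)"
  shows "(\<lambda>n. sqnorm M (\<lambda>x. S x - (\<Sum>l<n. c l * u l x))) \<longlonglongrightarrow> 0"
proof -
  have le: "sqnorm M (\<lambda>x. S x - (\<Sum>l<n. c l * u l x)) \<le> ennreal (1 / (1 - r) * (\<Sum>l. r ^ (l + n) * b (l + n)))" for n
  proof -
    have "sqnorm M (\<lambda>x. S x - (\<Sum>l<n. c l * u l x))
      \<le> (\<integral>\<^sup>+x. ennreal (1 / (1 - r)) * (\<Sum>l. ennreal (r ^ (l + n)) * ennreal ((norm (u (l + n) x))\<^sup>2)) \<partial>M)"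
      unfolding sqnorm_def by (intro nn_integral_mono series_tail_square_le r c s)
    also have "\<dots> = ennreal (1 / (1 - r)) * (\<Sum>l. \<integral>\<^sup>+x. ennreal (r ^ (l + n)) * ennreal ((norm (u (l + n) x))\<^sup>2) \<partial>M)"
      by (subst nn_integral_cmult) (auto simp: nn_integral_suminf)
    also have "\<dots> = ennreal (1 / (1 - r)) * (\<Sum>l. ennreal (r ^ (l + n) * b (l + n)))"
      using r b(2) by (simp add: nn_integral_cmult b(1)[unfolded sqnorm_def] ennreal_mult)
    also have "(\<Sum>l. ennreal (r ^ (l + n) * b (l + n))) = ennreal (\<Sum>l. r ^ (l + n) * b (l + n))"
      using r b(2) b(3)[THEN summable_ignore_initial_segment, of n] by (intro suminf_ennreal2) auto
    finally show ?thesis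
      using r by (subst ennreal_mult) (auto intro!: suminf_nonneg b(3)[THEN summable_ignore_initial_segment, of n] simp: b(2))
  qed
  have "(\<lambda>n. (\<Sum>l. r ^ (l + n) * b (l + n))) \<longlonglongrightarrow> 0"
  proof -
    have "(\<lambda>n. (\<Sum>l. r ^ l * b l) - (\<Sum>l<n. r ^ l * b l)) \<longlonglongrightarrow> (\<Sum>l. r ^ l * b l) - (\<Sum>l. r ^ l * b l)"
      by (intro tendsto_intros summable_LIMSEQ b(3))
    then show ?thesis using suminf_minus_initial_segment[OF b(3)] by simp
  qed
  then have "(\<lambda>n. 1 / (1 - r) * (\<Sum>l. r ^ (l + n) * b (l + n))) \<longlonglongrightarrow> 1 / (1 - r) * 0"
    by (intro tendsto_intros)
  then have "(\<lambda>n. ennreal (1 / (1 - r) * (\<Sum>l. r ^ (l + n) * b (l + n)))) \<longlonglongrightarrow> ennreal 0"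
    by (intro tendsto_ennrealI) simp
  then have "(\<lambda>n. ennreal (1 / (1 - r) * (\<Sum>l. r ^ (l + n) * b (l + n)))) \<longlonglongrightarrow> 0" by simp
  then show ?thesis
    by (rule tendsto_sandwich[rotated 3]) (use le in auto)
qed

section \<open>Norms and generating series of the Laguerre functions\<close>

context ka_weight
begin

lemma ka_Phi_eq:
  "ka_Phi P k a l m p x = p x * of_real (laguerre l (ka_lambda P k a m) (2 * A x) * exp (- A x))"
  by (simp add: ka_Phi_def A_def)

lemma laguerre_measurable [measurable]:
  assumes [measurable]: "f \<in> borel_measurable N"
  shows "(\<lambda>x. laguerre l \<nu> (f x)) \<in> borel_measurable N"
  unfolding laguerre_def by measurable

lemma ka_Phi_measurable [measurable]:
  assumes "homogeneous_polynomial m p"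
  shows "ka_Phi P k a l m p \<in> borel_measurable borel"
proof -
  have [measurable]: "p \<in> borel_measurable borel" by (rule homogeneous_polynomial_measurable[OF assms])
  show ?thesis unfolding ka_Phi_eq[abs_def] by measurable
qed

text \<open>The moment law raises \<open>j\<close> by one at the cost of the factor
  \<open>ka_lambda P k a m + 1 + j\<close>, the next factor of the Pochhammer symbol. The 2 in
  \<open>2 * A x\<close> cancels the factor \<open>1/2\<close> produced by a Gaussian of rate
  2.\<close>

lemma gauss_norm_moments:
  assumes p: "homogeneous_polynomial m p"
  shows "(LINT x|M. (norm (p x))\<^sup>2 * (2 * A x) ^ j * exp (- 2 * A x))
    = pochhammer (ka_lambda P k a m + 1) j * (LINT x|M. (norm (p x))\<^sup>2 * exp (- 2 * A x))"
proof (induction j)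
  case (Suc j)
  have [measurable]: "p \<in> borel_measurable borel" by (rule homogeneous_polynomial_measurable[OF p])
  define q where "q x = (norm (p x))\<^sup>2 * (2 * A x) ^ j" for x
  define d where "d = 2 * real m + a * real j"
  have [measurable]: "q \<in> borel_measurable borel" unfolding q_def by measurable
  have q: "q x \<ge> 0" for x using A_nonneg by (simp add: q_def)
  have d: "d + hdim > 0" using hdim_pos a_pos by (simp add: d_def add_nonneg_pos)
  have hom: "q (s *\<^sub>R x) = s powr d * q x" if "s > 0" for s x
  proof -
    have "(norm (p (s *\<^sub>R x)))\<^sup>2 = (s ^ m)\<^sup>2 * (norm (p x))\<^sup>2"
      using that unfolding homogeneous_polynomialD(2)[OF p]
      by (simp add: norm_mult norm_power power_mult_distrib)
    also have "(s ^ m)\<^sup>2 = s powr (2 * real m)"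
      using powr_realpow[OF that, of "2 * m"] by (simp add: power_even_eq)
    finally have "(norm (p (s *\<^sub>R x)))\<^sup>2 = s powr (2 * real m) * (norm (p x))\<^sup>2" .
    moreover have "(2 * A (s *\<^sub>R x)) ^ j = (s powr a) ^ j * (2 * A x) ^ j"
      unfolding A_scale[OF that] by (simp add: power_mult_distrib)
    moreover have "(s powr a) ^ j = s powr (a * real j)"
      using powr_realpow[of "s powr a" j] that by (simp add: powr_powr)
    ultimately show ?thesis by (simp add: q_def d_def powr_add mult_ac)
  qed
  note G = gauss_integral_nonneg[of q d 2, OF _ q hom d]
  define I where "I = (LINT x|M. q x * exp (- A x))"
  define \<kappa> where "\<kappa> = (d + hdim) / a"
  have \<kappa>: "\<kappa> = ka_lambda P k a m + 1 + real j"
    unfolding ka_lambda_eq \<kappa>_def d_def using a_pos by (simp add: field_simps)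
  have "(LINT x|M. (norm (p x))\<^sup>2 * (2 * A x) ^ Suc j * exp (- 2 * A x)) = 2 * (LINT x|M. q x * A x * exp (- 2 * A x))"
    unfolding q_def by (simp add: mult_ac flip: integral_mult_right_zero)
  also have "\<dots> = 2 * (\<kappa> * 2 powr (- \<kappa> - 1) * I)"
    using G(2) by (simp add: \<kappa>_def I_def)
  also have "\<dots> = \<kappa> * (2 powr (- \<kappa>) * I)"
    by (simp add: powr_diff)
  also have "2 powr (- \<kappa>) * I = (LINT x|M. q x * exp (- 2 * A x))"
    using G(1) by (simp add: \<kappa>_def I_def)
  also have "\<dots> = pochhammer (ka_lambda P k a m + 1) j * (LINT x|M. (norm (p x))\<^sup>2 * exp (- 2 * A x))"
    using Suc.IH unfolding q_def .
  finally show ?case unfolding \<kappa> by (simp add: pochhammer_Suc)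
qed simp

lemma sqnorm_ka_Phi:
  assumes p: "homogeneous_polynomial m p"
  shows "sqnorm M (ka_Phi P k a l m p)
    = ennreal (pochhammer (ka_lambda P k a m + 1) l / fact l * (LINT x|M. (norm (p x))\<^sup>2 * exp (- 2 * A x)))"
proof -
  have [measurable]: "p \<in> borel_measurable borel" by (rule homogeneous_polynomial_measurable[OF p])
  define \<nu> where "\<nu> = ka_lambda P k a m"
  define c where "c i = (-1) ^ i * ((real l + \<nu>) gchoose (l - i)) / fact i" for i
  define h where "h j x = (norm (p x))\<^sup>2 * (2 * A x) ^ j * exp (- 2 * A x)" for j x
  have int: "integrable M (h j)" for j
  proof -
    have "integrable M (\<lambda>x. (p x * cnj (p x)) * of_real (A x ^ j * exp (- 2 * A x)))"
      by (rule gauss_moment_integrable[OF homogeneous_polynomial_mult[OF p homogeneous_polynomial_cnj[OF p]]]) simp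
    then have "integrable M (\<lambda>x. 2 ^ j * Re ((p x * cnj (p x)) * of_real (A x ^ j * exp (- 2 * A x))))"
      by (intro integrable_mult_right integrable_Re)
    moreover have "2 ^ j * Re ((p x * cnj (p x)) * of_real (A x ^ j * exp (- 2 * A x))) = h j x" for x
      unfolding complex_norm_square[symmetric] h_def of_real_mult[symmetric] Re_complex_of_real
      by (simp add: power_mult_distrib)
    ultimately show ?thesis by (simp only:)
  qed
  have eq: "(norm (ka_Phi P k a l m p x))\<^sup>2 = (\<Sum>i\<le>l. \<Sum>j\<le>l. c i * c j * h (i + j) x)" for x
  proof -
    have L: "laguerre l \<nu> (2 * A x) = (\<Sum>i\<le>l. c i * (2 * A x) ^ i)"
      unfolding laguerre_def c_def by (intro sum.cong) auto
    have "(norm (ka_Phi P k a l m p x))\<^sup>2 = (norm (p x))\<^sup>2 * (laguerre l \<nu> (2 * A x))\<^sup>2 * (exp (- A x))\<^sup>2"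
      unfolding ka_Phi_eq \<nu>_def by (simp add: norm_mult power_mult_distrib)
    also have "(exp (- A x))\<^sup>2 = exp (- 2 * A x)" by (simp add: exp_double[symmetric])
    also have "(laguerre l \<nu> (2 * A x))\<^sup>2 = (\<Sum>i\<le>l. \<Sum>j\<le>l. (c i * (2 * A x) ^ i) * (c j * (2 * A x) ^ j))"
      unfolding L power2_eq_square by (rule sum_product)
    finally show ?thesis
      unfolding h_def by (simp add: sum_distrib_left sum_distrib_right power_add mult_ac)
  qed
  have "sqnorm M (ka_Phi P k a l m p) = ennreal (LINT x|M. (\<Sum>i\<le>l. \<Sum>j\<le>l. c i * c j * h (i + j) x))"
  proof -
    have "integrable M (\<lambda>x. (norm (ka_Phi P k a l m p x))\<^sup>2)"
      unfolding eq by (intro Bochner_Integration.integrable_sum integrable_mult_right int)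
    then show ?thesis
      unfolding sqnorm_def eq[symmetric] by (intro nn_integral_eq_integral) auto
  qed
  also have "(LINT x|M. (\<Sum>i\<le>l. \<Sum>j\<le>l. c i * c j * h (i + j) x)) = (\<Sum>i\<le>l. \<Sum>j\<le>l. c i * c j * (LINT x|M. h (i + j) x))"
    using int by (simp add: Bochner_Integration.integral_sum)
  also have "\<dots> = (\<Sum>i\<le>l. \<Sum>j\<le>l. c i * c j * pochhammer (\<nu> + 1) (i + j)) * (LINT x|M. (norm (p x))\<^sup>2 * exp (- 2 * A x))"
    unfolding h_def gauss_norm_moments[OF p] \<nu>_def[symmetric] by (simp add: sum_distrib_right mult.assoc)
  also have "(\<Sum>i\<le>l. \<Sum>j\<le>l. c i * c j * pochhammer (\<nu> + 1) (i + j)) = pochhammer (\<nu> + 1) l / fact l"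
    unfolding c_def by (rule laguerre_norm_moments)
  finally show ?thesis unfolding \<nu>_def .
qed

lemma L2_ka_Phi: "homogeneous_polynomial m p \<Longrightarrow> ka_Phi P k a l m p \<in> L2_functions M"
  using ka_Phi_measurable[of m p l] by (simp add: L2_functions_iff sqnorm_ka_Phi)

text \<open>At the argument \<open>2 * A x\<close> the exponents combine to
  \<open>- ((1 + w) / (1 - w)) * A x\<close>, so the generating series is a Gaussian with polynomial
  factor. Its rate \<open>(1 + w) / (1 - w)\<close> takes every positive value as \<open>w\<close>
  ranges over the open interval from -1 to 1.\<close>

lemma ka_Phi_series:
  assumes w: "\<bar>w\<bar> < 1"
  shows "(\<lambda>l. of_real (w ^ l) * ka_Phi P k a l m p x) sums
    (of_real ((1 - w) powr (- ka_lambda P k a m - 1)) * gauss p ((1 + w) / (1 - w)) x)"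
proof -
  let ?\<nu> = "ka_lambda P k a m"
  have "(\<lambda>l. laguerre l ?\<nu> (2 * A x) * w ^ l * exp (- A x)) sums
     ((1 - w) powr (- ?\<nu> - 1) * exp (- (2 * A x) * w / (1 - w)) * exp (- A x))"
    by (intro sums_mult2 laguerre_generating_function ka_lambda_gt w)
  also have "(1 - w) powr (- ?\<nu> - 1) * exp (- (2 * A x) * w / (1 - w)) * exp (- A x)
     = (1 - w) powr (- ?\<nu> - 1) * exp (- ((1 + w) / (1 - w)) * A x)"
  proof -
    have "- (2 * A x) * w / (1 - w) + - A x = - ((1 + w) / (1 - w)) * A x"
      using w by (simp add: field_simps)
    then show ?thesis by (metis exp_add mult.assoc)
  qed
  finally have "(\<lambda>l. complex_of_real (laguerre l ?\<nu> (2 * A x) * w ^ l * exp (- A x))) sums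
     of_real ((1 - w) powr (- ?\<nu> - 1) * exp (- ((1 + w) / (1 - w)) * A x))"
    by (rule sums_of_real)
  from sums_mult[OF this, of "p x"] show ?thesis
    unfolding ka_Phi_eq gauss_def by (simp add: mult_ac)
qed

lemma ka_Phi_series_sqnorm:
  assumes p: "homogeneous_polynomial m p" and w: "\<bar>w\<bar> < 1"
  shows "(\<lambda>n. sqnorm M (\<lambda>x. of_real ((1 - w) powr (- ka_lambda P k a m - 1)) * gauss p ((1 + w) / (1 - w)) x
     - (\<Sum>l<n. of_real (w ^ l) * ka_Phi P k a l m p x))) \<longlonglongrightarrow> 0"
proof (rule series_sqnorm_convergence[where r = "\<bar>w\<bar>"])
  let ?\<nu> = "ka_lambda P k a m" and ?I = "LINT x|M. (norm (p x))\<^sup>2 * exp (- 2 * A x)"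
  show "sqnorm M (ka_Phi P k a l m p) = ennreal (pochhammer (?\<nu> + 1) l / fact l * ?I)" for l
    by (rule sqnorm_ka_Phi[OF p])
  show "0 \<le> pochhammer (?\<nu> + 1) l / fact l * ?I" for l
    using ka_lambda_gt[of m] by (intro mult_nonneg_nonneg divide_nonneg_pos pochhammer_nonneg integral_nonneg) auto
  have "summable (\<lambda>l. ((real l + ?\<nu>) gchoose l) * \<bar>w\<bar> ^ l)"
    using gbinomial_series_negative[of "\<bar>w\<bar>" ?\<nu>] w by (simp add: sums_iff)
  then have "summable (\<lambda>l. ((real l + ?\<nu>) gchoose l) * \<bar>w\<bar> ^ l * ?I)"
    by (rule summable_mult2)
  then show "summable (\<lambda>l. \<bar>w\<bar> ^ l * (pochhammer (?\<nu> + 1) l / fact l * ?I))"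
    by (simp add: gbinomial_pochhammer' add.commute mult_ac)
  show "(\<lambda>l. of_real (w ^ l) * ka_Phi P k a l m p x) sums
    (of_real ((1 - w) powr (- ka_lambda P k a m - 1)) * gauss p ((1 + w) / (1 - w)) x)" for x
    by (rule ka_Phi_series[OF w])
qed (use w ka_Phi_measurable[OF p] in \<open>auto simp: norm_power\<close>)

end

section \<open>The transform of Gaussians\<close>

lemma sqnorm_eq_integral:
  assumes "f \<in> L2_functions M"
  shows "sqnorm M f = ennreal (LINT x|M. (norm (f x))\<^sup>2)"
  using assms unfolding sqnorm_def L2_functions_def by (intro nn_integral_eq_integral) auto

lemma integral_mult_cnj_self:
  "(LINT x|M. f x * cnj (f x)) = complex_of_real (LINT x|M. (norm (f x))\<^sup>2)"
  unfolding complex_norm_square[symmetric] by (rule integral_complex_of_real)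

locale ka_fourier = ka_weight P k a for P :: "'a::euclidean_space set" and k a +
  fixes F :: "('a \<Rightarrow> complex) \<Rightarrow> 'a \<Rightarrow> complex"
  assumes fourier: "is_ka_fourier P k a F"
begin

lemma F_L2: "f \<in> L2_functions M \<Longrightarrow> F f \<in> L2_functions M"
  using fourier by (simp add: is_ka_fourier_def unitary_on_L2_def)

lemma F_lincomb:
  "f \<in> L2_functions M \<Longrightarrow> g \<in> L2_functions M \<Longrightarrow> AE x in M. F (\<lambda>y. c * f y + d * g y) x = c * F f x + d * F g x"
  using fourier by (simp add: is_ka_fourier_def unitary_on_L2_def)

lemma F_inner:
  "f \<in> L2_functions M \<Longrightarrow> g \<in> L2_functions M \<Longrightarrow> (LINT x|M. F f x * cnj (F g x)) = (LINT x|M. f x * cnj (g x))"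
  using fourier by (simp add: is_ka_fourier_def unitary_on_L2_def)

lemma F_Phi:
  "homogeneous_polynomial m p \<Longrightarrow> dunkl_harmonic P k p \<Longrightarrow>
    AE x in M. F (ka_Phi P k a l m p) x = cis (- pi * (real l + real m / a)) * ka_Phi P k a l m p x"
  using fourier by (simp add: is_ka_fourier_def)

lemma F_sqnorm:
  assumes "f \<in> L2_functions M"
  shows "sqnorm M (F f) = sqnorm M f"
  using F_inner[OF assms assms] unfolding integral_mult_cnj_self sqnorm_eq_integral[OF assms]
    sqnorm_eq_integral[OF F_L2[OF assms]] by simp

lemma F_cmult: "f \<in> L2_functions M \<Longrightarrow> AE x in M. F (\<lambda>y. c * f y) x = c * F f x"
  using F_lincomb[of f f c 0] by simp

lemma F_sum:
  assumes "finite I" "\<And>i. i \<in> I \<Longrightarrow> f i \<in> L2_functions M"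
  shows "AE x in M. F (\<lambda>y. \<Sum>i\<in>I. c i * f i y) x = (\<Sum>i\<in>I. c i * F (f i) x)"
  using assms
proof (induction rule: finite_induct)
  case empty
  show ?case using F_cmult[OF L2_functions_zero, of 0] by simp
next
  case (insert i I)
  have "AE x in M. F (\<lambda>y. c i * f i y + 1 * (\<Sum>i\<in>I. c i * f i y)) x
      = c i * F (f i) x + 1 * F (\<lambda>y. \<Sum>i\<in>I. c i * f i y) x"
    using insert by (intro F_lincomb L2_functions_sum) auto
  moreover have "AE x in M. F (\<lambda>y. \<Sum>i\<in>I. c i * f i y) x = (\<Sum>i\<in>I. c i * F (f i) x)"
    using insert by simp
  ultimately show ?case
    by eventually_elim (use insert(1,2) in simp)
qed

text \<open>Isometry bounds the distance between \<open>F f\<close> and \<open>g\<close> by the two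
  approximation errors, both of which tend to 0. The values of \<open>F\<close> on the sequence are
  needed only almost everywhere.\<close>

lemma F_limit:
  assumes f: "f \<in> L2_functions M" "\<And>n. s n \<in> L2_functions M"
    and g: "g \<in> borel_measurable M" "\<And>n. t n \<in> borel_measurable M"
    and F: "\<And>n. AE x in M. F (s n) x = t n x"
    and lim: "(\<lambda>n. sqnorm M (\<lambda>x. f x - s n x)) \<longlonglongrightarrow> 0" "(\<lambda>n. sqnorm M (\<lambda>x. g x - t n x)) \<longlonglongrightarrow> 0"
  shows "AE x in M. F f x = g x"
proof -
  have [measurable]: "F f \<in> borel_measurable M" "F (s n) \<in> borel_measurable M" "g \<in> borel_measurable M" "t n \<in> borel_measurable M" for n
    using F_L2[OF f(1)] F_L2[OF f(2)] g by auto
  have "sqnorm M (\<lambda>x. F f x - g x) \<le> 2 * sqnorm M (\<lambda>x. f x - s n x) + 2 * sqnorm M (\<lambda>x. g x - t n x)" for n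
  proof -
    have "AE x in M. F (\<lambda>y. 1 * f y + (-1) * s n y) x = 1 * F f x + (-1) * F (s n) x"
      by (rule F_lincomb[OF f(1) f(2)])
    then have "AE x in M. F (\<lambda>y. f y - s n y) x = F f x - t n x"
      using F[of n] by eventually_elim simp
    then have "sqnorm M (\<lambda>x. F f x - t n x) = sqnorm M (F (\<lambda>y. f y - s n y))"
      by (intro sqnorm_cong_AE) (auto elim: eventually_mono)
    also have "\<dots> = sqnorm M (\<lambda>y. f y - s n y)"
      by (intro F_sqnorm L2_functions_diff f)
    finally have 1: "sqnorm M (\<lambda>x. F f x - t n x) = sqnorm M (\<lambda>y. f y - s n y)" .
    have "sqnorm M (\<lambda>x. (F f x - t n x) + (t n x - g x)) \<le> 2 * sqnorm M (\<lambda>x. F f x - t n x) + 2 * sqnorm M (\<lambda>x. t n x - g x)"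
      by (rule sqnorm_add_le) measurable
    then show ?thesis unfolding 1 sqnorm_minus_commute[of M "t n" g] by simp
  qed
  moreover have "(\<lambda>n. 2 * sqnorm M (\<lambda>x. f x - s n x) + 2 * sqnorm M (\<lambda>x. g x - t n x)) \<longlonglongrightarrow> 2 * 0 + 2 * 0"
    by (intro tendsto_add ennreal_tendsto_cmult lim) auto
  ultimately have "sqnorm M (\<lambda>x. F f x - g x) \<le> 0"
    by (intro LIMSEQ_le_const[where X = "\<lambda>n. 2 * sqnorm M (\<lambda>x. f x - s n x) + 2 * sqnorm M (\<lambda>x. g x - t n x)"]) auto
  then have "AE x in M. F f x - g x = 0"
    by (subst sqnorm_eq_0_iff[symmetric]) auto
  then show ?thesis by simp
qed

text \<open>On the series in \<open>ka_Phi\<close> the transform multiplies the \<open>l\<close>-th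
  term by a fixed phase times \<open>(-1) ^ l\<close>. It thereby replaces \<open>w\<close> by
  \<open>- w\<close>, that is, the rate \<open>z\<close> by \<open>1 / z\<close>; the power of
  \<open>z\<close> is the quotient of the two prefactors of the generating function.\<close>

lemma F_gauss:
  assumes p: "homogeneous_polynomial m p" "dunkl_harmonic P k p" and z: "z > 0"
  shows "AE x in M. F (gauss p z) x
    = cis (- pi * (real m / a)) * of_real (z powr (- ka_lambda P k a m - 1)) * gauss p (1 / z) x"
proof -
  define \<nu> where "\<nu> = ka_lambda P k a m"
  \<comment> \<open>The solution of \<open>(1 + w) / (1 - w) = z\<close>.\<close>
  define w where "w = (z - 1) / (z + 1)"
  have w: "\<bar>w\<bar> < 1" using z by (auto simp: w_def abs_less_iff field_simps)
  have w12: "1 + w = 2 * z / (z + 1)" "1 - w = 2 / (z + 1)" using z by (simp_all add: w_def field_simps)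
  have zw1: "(1 + w) / (1 - w) = z" unfolding w12 using z by simp
  have "(1 + - w) / (1 - - w) = inverse ((1 + w) / (1 - w))" by simp
  then have zw: "(1 + w) / (1 - w) = z" "(1 + - w) / (1 - - w) = 1 / z"
    unfolding zw1 by (simp_all add: divide_inverse)
  define ph where "ph = cis (- pi * (real m / a))"
  define s where "s n x = (\<Sum>l<n. of_real (w ^ l) * ka_Phi P k a l m p x)" for n x
  define t where "t n x = (\<Sum>l<n. of_real ((- w) ^ l) * ka_Phi P k a l m p x)" for n x
  define b c where "b = (1 - w) powr (- \<nu> - 1)" and "c = (1 - (- w)) powr (- \<nu> - 1)"
  have b0: "b > 0" using w by (simp add: b_def)
  have cb: "c / b = z powr (- \<nu> - 1)"
    using w z unfolding b_def c_def zw(1)[symmetric] by (subst powr_divide) auto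
  have sL2: "s n \<in> L2_functions M" for n
    unfolding s_def by (intro L2_functions_sum L2_ka_Phi p) auto
  have tL2: "t n \<in> L2_functions M" for n
    unfolding t_def by (intro L2_functions_sum L2_ka_Phi p) auto
  have gL2: "gauss p z' \<in> L2_functions M" if "z' > 0" for z' by (rule L2_gauss[OF p(1) that])
  have "AE x in M. F (\<lambda>x. of_real b * gauss p z x) x = ph * (of_real c * gauss p (1 / z) x)"
  proof (rule F_limit[where s = s and t = "\<lambda>n x. ph * t n x"])
    show "(\<lambda>x. of_real b * gauss p z x) \<in> L2_functions M" by (intro L2_functions_cmult gL2 z)
    show "s n \<in> L2_functions M" for n by (rule sL2)
    show "(\<lambda>x. ph * (of_real c * gauss p (1 / z) x)) \<in> borel_measurable M"
      using gL2[of "1 / z"] z by (intro borel_measurable_times) auto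
    show "(\<lambda>x. ph * t n x) \<in> borel_measurable M" for n
      using tL2[of n] by (intro borel_measurable_times) auto
    show "AE x in M. F (s n) x = ph * t n x" for n
    proof -
      have "AE x in M. F (s n) x = (\<Sum>l<n. of_real (w ^ l) * F (ka_Phi P k a l m p) x)"
        unfolding s_def[abs_def] by (intro F_sum L2_ka_Phi p) auto
      moreover have "AE x in M. \<forall>l. F (ka_Phi P k a l m p) x = cis (- pi * (real l + real m / a)) * ka_Phi P k a l m p x"
        using F_Phi[OF p] by (simp add: AE_all_countable)
      ultimately show ?thesis
      proof eventually_elim
        fix x
        assume 1: "F (s n) x = (\<Sum>l<n. of_real (w ^ l) * F (ka_Phi P k a l m p) x)"
          and 2: "\<forall>l. F (ka_Phi P k a l m p) x = cis (- pi * (real l + real m / a)) * ka_Phi P k a l m p x"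
        have "cis (- pi * (real l + real m / a)) = (-1) ^ l * ph" for l :: nat
        proof -
          have "cis (- pi * (real l + real m / a)) = cis (real l * (- pi)) * ph"
            unfolding ph_def cis_mult by (simp add: algebra_simps)
          moreover have "cis (real l * (- pi)) = (-1) ^ l"
            unfolding DeMoivre[of "- pi" l, symmetric] by (simp add: cis.code complex_eq_iff)
          ultimately show ?thesis by simp
        qed
        then have "of_real (w ^ l) * F (ka_Phi P k a l m p) x = ph * (of_real ((- w) ^ l) * ka_Phi P k a l m p x)" for l
          using 2 by (simp add: power_minus[of w] mult_ac)
        then show "F (s n) x = ph * t n x"
          unfolding 1 t_def by (simp add: sum_distrib_left)
      qed
    qed
    show "(\<lambda>n. sqnorm M (\<lambda>x. of_real b * gauss p z x - s n x)) \<longlonglongrightarrow> 0"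
      using ka_Phi_series_sqnorm[OF p(1) w] unfolding zw s_def b_def \<nu>_def .
    have "(\<lambda>n. sqnorm M (\<lambda>x. of_real c * gauss p (1 / z) x - t n x)) \<longlonglongrightarrow> 0"
      using ka_Phi_series_sqnorm[OF p(1), of "- w"] w unfolding zw t_def c_def \<nu>_def by simp
    moreover have "sqnorm M (\<lambda>x. ph * (of_real c * gauss p (1 / z) x) - ph * t n x) = sqnorm M (\<lambda>x. of_real c * gauss p (1 / z) x - t n x)" for n
      unfolding sqnorm_def right_diff_distrib[symmetric] norm_mult by (simp add: ph_def)
    ultimately show "(\<lambda>n. sqnorm M (\<lambda>x. ph * (of_real c * gauss p (1 / z) x) - ph * t n x)) \<longlonglongrightarrow> 0"
      by simp
  qed
  moreover have "AE x in M. F (\<lambda>x. of_real b * gauss p z x) x = of_real b * F (gauss p z) x"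
    by (rule F_cmult[OF gL2[OF z]])
  ultimately show ?thesis
  proof eventually_elim
    fix x
    assume "F (\<lambda>x. of_real b * gauss p z x) x = ph * (of_real c * gauss p (1 / z) x)"
      and "F (\<lambda>x. of_real b * gauss p z x) x = of_real b * F (gauss p z) x"
    then have "of_real b * F (gauss p z) x = ph * (of_real c * gauss p (1 / z) x)" by simp
    then have "F (gauss p z) x = ph * of_real (c / b) * gauss p (1 / z) x"
      using b0 by (simp add: field_simps)
    then show "F (gauss p z) x = cis (- pi * (real m / a)) * of_real (z powr (- ka_lambda P k a m - 1)) * gauss p (1 / z) x"
      unfolding cb ph_def \<nu>_def .
  qed
qed

text \<open>Unitarity is tested on Gaussians of rates 2 and 1. By scaling, the inner products before
  and after the transform are both multiples of \<open>S\<close>; comparing moduli yields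
  \<open>norm S * 2 powr ((n - m) / a) = norm S\<close>, so \<open>S\<close> vanishes when the
  degrees differ.\<close>

lemma harmonic_orthogonal:
  assumes p: "homogeneous_polynomial m p" "dunkl_harmonic P k p"
    and q: "homogeneous_polynomial n q" "dunkl_harmonic P k q" and "m \<noteq> n"
  shows "(LINT x|M. p x * cnj (q x) * of_real (exp (- A x))) = 0"
proof -
  define S where "S = (LINT x|M. p x * cnj (q x) * of_real (exp (- A x)))"
  define \<mu> where "\<mu> = (real (m + n) + hdim) / a"
  have pair: "(LINT x|M. gauss p z x * cnj (gauss q y x)) = of_real ((z + y) powr (- \<mu>)) * S" if "z > 0" "y > 0" for z y
    unfolding gauss_mult_cnj S_def \<mu>_def using that
    by (intro gauss_integral_polynomial homogeneous_polynomial_mult homogeneous_polynomial_cnj p q) auto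
  have "norm S * 2 powr (- ka_lambda P k a m - 1 + \<mu>) = norm S"
  proof -
    have [measurable]: "cnj \<in> borel_measurable borel"
      by (intro borel_measurable_continuous_onI continuous_intros)
    have [measurable]: "gauss p (1/2) \<in> borel_measurable M" "F (gauss p 2) \<in> borel_measurable M"
      "gauss q 1 \<in> borel_measurable M" "F (gauss q 1) \<in> borel_measurable M"
      by (auto intro!: L2_functions_measurable F_L2 L2_gauss p q)
    have "AE x in M. F (gauss p 2) x * cnj (F (gauss q 1) x)
       = (cis (- pi * (real m / a)) * of_real (2 powr (- ka_lambda P k a m - 1)) * cnj (cis (- pi * (real n / a))))
         * (gauss p (1 / 2) x * cnj (gauss q 1 x))"
      using F_gauss[OF p zero_less_numeral, of "num.Bit0 num.One"] F_gauss[OF q zero_less_one] by eventually_elim simp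
    then have "(LINT x|M. F (gauss p 2) x * cnj (F (gauss q 1) x))
       = (LINT x|M. (cis (- pi * (real m / a)) * of_real (2 powr (- ka_lambda P k a m - 1)) * cnj (cis (- pi * (real n / a))))
         * (gauss p (1 / 2) x * cnj (gauss q 1 x)))"
      by (intro integral_cong_AE) measurable
    then have "(LINT x|M. gauss p 2 x * cnj (gauss q 1 x))
       = (cis (- pi * (real m / a)) * of_real (2 powr (- ka_lambda P k a m - 1)) * cnj (cis (- pi * (real n / a))))
         * (LINT x|M. gauss p (1 / 2) x * cnj (gauss q 1 x))"
      by (simp add: F_inner L2_gauss[OF p(1)] L2_gauss[OF q(1)])
    moreover have P1: "(LINT x|M. gauss p 2 x * cnj (gauss q 1 x)) = of_real (3 powr (- \<mu>)) * S"
      and P2: "(LINT x|M. gauss p (1 / 2) x * cnj (gauss q 1 x)) = of_real ((3 / 2) powr (- \<mu>)) * S"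
      using pair[of 2 1] pair[of "1/2" 1] by simp_all
    ultimately have "norm (complex_of_real (3 powr (- \<mu>)) * S)
       = norm ((cis (- pi * (real m / a)) * of_real (2 powr (- ka_lambda P k a m - 1)) * cnj (cis (- pi * (real n / a))))
         * (complex_of_real ((3 / 2) powr (- \<mu>)) * S))"
      by (simp only:)
    then have "3 powr (- \<mu>) * norm S = 2 powr (- ka_lambda P k a m - 1) * ((3 / 2) powr (- \<mu>) * norm S)"
      by (simp add: norm_mult)
    also have "(3 / 2) powr (- \<mu>) = 3 powr (- \<mu>) * 2 powr \<mu>"
      by (simp add: powr_divide powr_minus_divide)
    finally show ?thesis by (simp add: powr_add mult_ac)
  qed
  moreover have "2 powr (- ka_lambda P k a m - 1 + \<mu>) \<noteq> 1"
  proof -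
    have "- ka_lambda P k a m - 1 = - ((2 * real m + hdim) / a)" using ka_lambda_eq[of m] by linarith
    then have "- ka_lambda P k a m - 1 + \<mu> = (real n - real m) / a"
      unfolding \<mu>_def using a_pos by (simp add: field_simps)
    then show ?thesis using \<open>m \<noteq> n\<close> a_pos by simp
  qed
  ultimately have "norm S = 0" unfolding mult_cancel_left2 by blast
  then show ?thesis unfolding S_def by simp
qed

end

section \<open>The energy inequality on spans of Gaussians\<close>

context ka_weight
begin

text \<open>There are no scalar coefficients: multiples of harmonic polynomials are harmonic, so
  scalars are absorbed into \<open>p\<close>.\<close>

definition gsum :: "nat set \<Rightarrow> (nat \<Rightarrow> 'a \<Rightarrow> complex) \<Rightarrow> (nat \<Rightarrow> real) \<Rightarrow> 'a \<Rightarrow> complex" where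
  "gsum I p z x = (\<Sum>i\<in>I. gauss (p i) (z i) x)"

text \<open>The sesquilinear forms into which weighted inner products of Gaussian sums expand;
  \<open>u\<close> collects the rates of the two factors and of the weight.\<close>

definition gmom :: "nat \<Rightarrow> real \<Rightarrow> ('a \<Rightarrow> complex) \<Rightarrow> ('a \<Rightarrow> complex) \<Rightarrow> complex" where
  "gmom e u p q = (LINT x|M. p x * cnj (q x) * of_real (A x ^ e * exp (- u * A x)))"

lemma gsum_inner:
  assumes p: "\<And>i. i \<in> I \<Longrightarrow> homogeneous_polynomial (m i) (p i)" and q: "\<And>i. i \<in> I \<Longrightarrow> homogeneous_polynomial (m i) (q i)"
    and z: "\<And>i. i \<in> I \<Longrightarrow> z i > 0" and t: "t \<ge> 0"
  shows "integrable M (\<lambda>x. of_real (A x ^ e * exp (- t * A x)) * (gsum I p z x * cnj (gsum I q z x)))"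
    and "(LINT x|M. of_real (A x ^ e * exp (- t * A x)) * (gsum I p z x * cnj (gsum I q z x)))
      = (\<Sum>i\<in>I. \<Sum>j\<in>I. gmom e (z i + z j + t) (p i) (q j))"
proof -
  have eq: "of_real (A x ^ e * exp (- t * A x)) * (gsum I p z x * cnj (gsum I q z x))
    = (\<Sum>i\<in>I. \<Sum>j\<in>I. p i x * cnj (q j x) * of_real (A x ^ e * exp (- (z i + z j + t) * A x)))" for x
  proof -
    have "gsum I p z x * cnj (gsum I q z x) = (\<Sum>i\<in>I. \<Sum>j\<in>I. gauss (p i) (z i) x * cnj (gauss (q j) (z j) x))"
      unfolding gsum_def by (simp add: sum_product)
    moreover have "exp (- (z i + z j + t) * A x) = exp (- t * A x) * exp (- (z i + z j) * A x)" for i j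
      unfolding exp_add[symmetric] by (simp add: algebra_simps)
    ultimately show ?thesis
      unfolding gauss_mult_cnj by (simp add: sum_distrib_left mult_ac)
  qed
  have int: "integrable M (\<lambda>x. p i x * cnj (q j x) * of_real (A x ^ e * exp (- (z i + z j + t) * A x)))"
    if "i \<in> I" "j \<in> I" for i j
    using z[OF that(1)] z[OF that(2)] t
    by (intro gauss_moment_integrable[OF homogeneous_polynomial_mult[OF p[OF that(1)] homogeneous_polynomial_cnj[OF q[OF that(2)]]]]) auto
  show "integrable M (\<lambda>x. of_real (A x ^ e * exp (- t * A x)) * (gsum I p z x * cnj (gsum I q z x)))"
    unfolding eq by (intro Bochner_Integration.integrable_sum int)
  show "(LINT x|M. of_real (A x ^ e * exp (- t * A x)) * (gsum I p z x * cnj (gsum I q z x)))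
      = (\<Sum>i\<in>I. \<Sum>j\<in>I. gmom e (z i + z j + t) (p i) (q j))"
    unfolding eq gmom_def using int by (simp add: Bochner_Integration.integral_sum)
qed

lemma gsum_sqnorm_weighted:
  assumes p: "\<And>i. i \<in> I \<Longrightarrow> homogeneous_polynomial (m i) (p i)"
    and z: "\<And>i. i \<in> I \<Longrightarrow> z i > 0" and t: "t \<ge> 0"
  shows "integrable M (\<lambda>x. A x ^ e * exp (- t * A x) * (norm (gsum I p z x))\<^sup>2)"
    and "complex_of_real (LINT x|M. A x ^ e * exp (- t * A x) * (norm (gsum I p z x))\<^sup>2)
      = (\<Sum>i\<in>I. \<Sum>j\<in>I. gmom e (z i + z j + t) (p i) (p j))"
proof -
  have eq: "complex_of_real (A x ^ e * exp (- t * A x)) * (gsum I p z x * cnj (gsum I p z x))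
    = of_real (A x ^ e * exp (- t * A x) * (norm (gsum I p z x))\<^sup>2)" for x
    unfolding complex_norm_square[symmetric] by simp
  show "integrable M (\<lambda>x. A x ^ e * exp (- t * A x) * (norm (gsum I p z x))\<^sup>2)"
    using integrable_Re[OF gsum_inner(1)[of I m p p z t e, OF p p z t]] unfolding eq Re_complex_of_real .
  show "complex_of_real (LINT x|M. A x ^ e * exp (- t * A x) * (norm (gsum I p z x))\<^sup>2)
      = (\<Sum>i\<in>I. \<Sum>j\<in>I. gmom e (z i + z j + t) (p i) (p j))"
    using gsum_inner(2)[of I m p p z t e, OF p p z t] unfolding eq integral_complex_of_real .
qed

lemma gmom_scale:
  assumes p: "homogeneous_polynomial m p" and q: "homogeneous_polynomial n q" and u: "u > 0"
  defines "\<kappa> \<equiv> (real (m + n) + hdim) / a"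
  shows "gmom 0 u p q = of_real (u powr (- \<kappa>)) * gmom 0 1 p q"
    and "gmom 1 u p q = of_real (\<kappa> * u powr (- \<kappa> - 1)) * gmom 0 1 p q"
  using gauss_integral_polynomial[OF homogeneous_polynomial_mult[OF p homogeneous_polynomial_cnj[OF q]] u]
  unfolding gmom_def \<kappa>_def by simp_all

lemma gmom_cmult: "gmom e u (\<lambda>x. c * p x) (\<lambda>x. d * q x) = c * cnj d * gmom e u p q"
  unfolding gmom_def by (subst integral_mult_right_zero[symmetric]) (simp add: mult_ac)

definition admissible :: "nat set \<Rightarrow> (nat \<Rightarrow> nat) \<Rightarrow> (nat \<Rightarrow> 'a \<Rightarrow> complex) \<Rightarrow> (nat \<Rightarrow> real) \<Rightarrow> bool" where
  "admissible I m p z \<longleftrightarrow> finite I \<and>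
    (\<forall>i\<in>I. homogeneous_polynomial (m i) (p i) \<and> dunkl_harmonic P k (p i) \<and> z i > 0)"

end

context ka_fourier
begin

lemma gmom_orthogonal:
  assumes p: "homogeneous_polynomial m p" "dunkl_harmonic P k p"
    and q: "homogeneous_polynomial n q" "dunkl_harmonic P k q" and "m \<noteq> n" and u: "u > 0" and e: "e \<le> 1"
  shows "gmom e u p q = 0"
proof -
  have "gmom 0 1 p q = 0"
    using harmonic_orthogonal[OF p q \<open>m \<noteq> n\<close>] by (simp add: gmom_def)
  then show ?thesis
    using gmom_scale[OF p(1) q(1) u] e by (cases e) auto
qed

text \<open>The integration by parts behind the energy bound. For equal degrees it is the moment
  law. For different degrees both sides vanish, as they must, since the factor on the left knows
  only the degree of \<open>p\<close>.\<close>

lemma gmom_recurrence: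
  assumes p: "homogeneous_polynomial m p" "dunkl_harmonic P k p"
    and q: "homogeneous_polynomial n q" "dunkl_harmonic P k q" and u: "u > 0"
  shows "of_real ((2 * real m + hdim) / a) * gmom 0 u p q = of_real u * gmom 1 u p q"
proof (cases "m = n")
  case True
  define \<kappa> where "\<kappa> = (real (m + n) + hdim) / a"
  have \<kappa>: "(2 * real m + hdim) / a = \<kappa>" using True by (simp add: \<kappa>_def)
  have h: "\<kappa> * u powr (- \<kappa>) = u * (\<kappa> * u powr (- \<kappa> - 1))"
    using u by (simp add: powr_diff)
  show ?thesis
    unfolding gmom_scale[OF p(1) q(1) u] \<kappa>_def[symmetric] \<kappa> mult.assoc[symmetric] of_real_mult[symmetric]
    by (simp only: h mult.assoc)
next
  case False
  from gmom_orthogonal[OF p q False u, of 0] gmom_orthogonal[OF p q False u, of 1] show ?thesis by simp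
qed

text \<open>For equal degrees the phases cancel, and
  \<open>1 / z + 1 / y = (z + y) / (z * y)\<close>. The powers from \<open>F_gauss\<close> then
  leave exactly one factor \<open>z * y\<close>, which is distributed over the two arguments.
  Different degrees give zero on both sides.\<close>

lemma gmom_fourier:
  assumes p: "homogeneous_polynomial m p" "dunkl_harmonic P k p"
    and q: "homogeneous_polynomial n q" "dunkl_harmonic P k q" and z: "z > 0" and y: "y > 0"
  shows "gmom 1 (1 / z + 1 / y)
      (\<lambda>x. cis (- pi * (real m / a)) * of_real (z powr (- ka_lambda P k a m - 1)) * p x)
      (\<lambda>x. cis (- pi * (real n / a)) * of_real (y powr (- ka_lambda P k a n - 1)) * q x)
    = gmom 1 (z + y) (\<lambda>x. of_real z * p x) (\<lambda>x. of_real y * q x)"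
proof (cases "m = n")
  case True
  define \<kappa> where "\<kappa> = (2 * real n + hdim) / a"
  have e: "- ka_lambda P k a n - 1 = - \<kappa>" using ka_lambda_eq[of n] unfolding \<kappa>_def by linarith
  have "1 / z + 1 / y = (z + y) / (z * y)" using z y by (simp add: field_simps)
  then have "(1 / z + 1 / y) powr (- \<kappa> - 1) = (z + y) powr (- \<kappa> - 1) * (z * y) powr (\<kappa> + 1)"
    using z y by (simp add: powr_divide) (simp add: divide_inverse add.commute flip: powr_minus)
  also have "(z * y) powr (\<kappa> + 1) = z * y * (z powr \<kappa> * y powr \<kappa>)"
    using z y by (simp add: powr_add powr_mult)
  finally have R: "z powr (- \<kappa>) * y powr (- \<kappa>) * (\<kappa> * (1 / z + 1 / y) powr (- \<kappa> - 1)) = z * y * (\<kappa> * (z + y) powr (- \<kappa> - 1))"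
    using z y by (simp add: powr_minus field_simps)
  have c: "cis (- pi * (real n / a)) * cnj (cis (- pi * (real n / a))) = 1"
    by (simp flip: complex_norm_square)
  have "(cis (- pi * (real n / a)) * of_real (z powr (- \<kappa>))) * cnj (cis (- pi * (real n / a)) * of_real (y powr (- \<kappa>)))
     = of_real (z powr (- \<kappa>) * y powr (- \<kappa>))"
    using c by (simp add: mult_ac)
  moreover have \<kappa>: "(real (n + n) + hdim) / a = \<kappa>" by (simp add: \<kappa>_def)
  moreover have "1 / z + 1 / y > 0" "z + y > 0" using z y by (auto intro: add_pos_pos)
  ultimately show ?thesis
    unfolding gmom_cmult True e
    using gmom_scale(2)[OF p(1)[unfolded True] q(1) \<open>1 / z + 1 / y > 0\<close>] gmom_scale(2)[OF p(1)[unfolded True] q(1) \<open>z + y > 0\<close>] R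
    unfolding \<kappa> by (simp flip: of_real_mult mult.assoc)
next
  case False
  have "1 / z + 1 / y > 0" "z + y > 0" using z y by (auto intro: add_pos_pos)
  then show ?thesis
    unfolding gmom_cmult using gmom_orthogonal[OF p q False] by simp
qed

section \<open>The inequality for a fixed Gaussian sum\<close>

context
  fixes I m p z
  assumes adm: "admissible I m p z"
begin

lemma admD: "finite I" "i \<in> I \<Longrightarrow> homogeneous_polynomial (m i) (p i)"
    "i \<in> I \<Longrightarrow> dunkl_harmonic P k (p i)" "i \<in> I \<Longrightarrow> z i > 0"
  using adm by (auto simp: admissible_def)

lemma gsum_L2: "gsum I p z \<in> L2_functions M"
proof -
  have "(\<lambda>x. \<Sum>i\<in>I. 1 * gauss (p i) (z i) x) \<in> L2_functions M"
    by (intro L2_functions_sum admD L2_gauss[OF admD(2,4)])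
  then show ?thesis by (simp add: gsum_def[abs_def])
qed

text \<open>The scalar factor of \<open>F_gauss\<close> is absorbed into the polynomial, so that the
  transform of a Gaussian sum is again a Gaussian sum, with rates \<open>1 / z i\<close>.\<close>

definition fp :: "nat \<Rightarrow> 'a \<Rightarrow> complex" where
  "fp i x = cis (- pi * (real (m i) / a)) * of_real (z i powr (- ka_lambda P k a (m i) - 1)) * p i x"

lemma F_gsum: "AE x in M. F (gsum I p z) x = gsum I fp (\<lambda>i. 1 / z i) x"
proof -
  have "AE x in M. F (\<lambda>y. \<Sum>i\<in>I. 1 * gauss (p i) (z i) y) x = (\<Sum>i\<in>I. 1 * F (gauss (p i) (z i)) x)"
    by (intro F_sum admD L2_gauss[OF admD(2,4)])
  moreover have "AE x in M. \<forall>i\<in>I. F (gauss (p i) (z i)) x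
      = cis (- pi * (real (m i) / a)) * of_real (z i powr (- ka_lambda P k a (m i) - 1)) * gauss (p i) (1 / z i) x"
    using F_gauss[OF admD(2,3,4)] admD(1) by (simp add: AE_finite_all)
  ultimately show ?thesis
    by eventually_elim (simp add: gsum_def[abs_def] fp_def gauss_def mult.assoc)
qed

lemma fp_homogeneous: "i \<in> I \<Longrightarrow> homogeneous_polynomial (m i) (fp i)"
  using homogeneous_polynomial_lincomb[OF homogeneous_polynomial_zero admD(2),
      of i "cis (- pi * (real (m i) / a)) * of_real (z i powr (- ka_lambda P k a (m i) - 1))"]
  by (simp add: fp_def[abs_def])

lemma scaled_homogeneous: "i \<in> I \<Longrightarrow> homogeneous_polynomial (m i) (\<lambda>x. of_real (z i) * p i x)"
  using homogeneous_polynomial_lincomb[OF homogeneous_polynomial_zero admD(2), of i "of_real (z i)"] by simp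

text \<open>Minus the derivative of the Gaussian sum with respect to \<open>A\<close>, the
  polynomial factors being held fixed.\<close>

abbreviation "dg \<equiv> gsum I (\<lambda>i x. of_real (z i) * p i x) z"

text \<open>This is how the energy of the transform becomes a Dirichlet form with weight
  \<open>A\<close>: \<open>gmom_fourier\<close> matches the two double sums term by term.\<close>

lemma fourier_energy:
  "(LINT x|M. A x * (norm (gsum I fp (\<lambda>i. 1 / z i) x))\<^sup>2) = (LINT x|M. A x * (norm (dg x))\<^sup>2)"
proof -
  have "complex_of_real (LINT x|M. A x ^ 1 * exp (- 0 * A x) * (norm (gsum I fp (\<lambda>i. 1 / z i) x))\<^sup>2)
      = complex_of_real (LINT x|M. A x ^ 1 * exp (- 0 * A x) * (norm (dg x))\<^sup>2)"
  proof (subst (1 2) gsum_sqnorm_weighted(2))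
    show "(\<Sum>i\<in>I. \<Sum>j\<in>I. gmom 1 (1 / z i + 1 / z j + 0) (fp i) (fp j))
      = (\<Sum>i\<in>I. \<Sum>j\<in>I. gmom 1 (z i + z j + 0) (\<lambda>x. of_real (z i) * p i x) (\<lambda>x. of_real (z j) * p j x))"
      unfolding fp_def[abs_def] add_0_right by (intro sum.cong HOL.refl gmom_fourier admD)
  qed (auto intro: fp_homogeneous scaled_homogeneous admD)
  then show ?thesis by simp
qed

text \<open>Pairs of different degree drop out by orthogonality. Within one degree
  \<open>\<mu>\<close> the coefficient is constant, and the remaining double sum is a weighted
  squared norm of the part of the sum of that degree.\<close>

lemma degree_form_nonneg:
  assumes t: "t \<ge> 0"
  shows "Re (\<Sum>i\<in>I. \<Sum>j\<in>I. of_real (real (m i)) * gmom 0 (z i + z j + t) (p i) (p j)) \<ge> 0"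
proof -
  let ?X = "\<lambda>i j. gmom 0 (z i + z j + t) (p i) (p j)"
  have "(\<Sum>i\<in>I. \<Sum>j\<in>I. of_real (real (m i)) * ?X i j)
    = (\<Sum>\<mu>\<in>m ` I. \<Sum>i\<in>{i \<in> I. m i = \<mu>}. \<Sum>j\<in>I. of_real (real (m i)) * ?X i j)"
    by (rule sum.image_gen[OF admD(1)])
  also have "\<dots> = (\<Sum>\<mu>\<in>m ` I. of_real (real \<mu>) * (\<Sum>i\<in>{i \<in> I. m i = \<mu>}. \<Sum>j\<in>{i \<in> I. m i = \<mu>}. ?X i j))"
  proof (intro sum.cong HOL.refl)
    fix \<mu>
    have "(\<Sum>j\<in>I. of_real (real (m i)) * ?X i j) = of_real (real \<mu>) * (\<Sum>j\<in>{i \<in> I. m i = \<mu>}. ?X i j)"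
      if "i \<in> {i \<in> I. m i = \<mu>}" for i
    proof -
      have "(\<Sum>j\<in>I. ?X i j) = (\<Sum>j\<in>{i \<in> I. m i = \<mu>}. ?X i j)"
      proof (intro sum.mono_neutral_right admD ballI)
        fix j assume "j \<in> I - {i \<in> I. m i = \<mu>}"
        with that t admD(4)[of i] admD(4)[of j] show "?X i j = 0"
          by (intro gmom_orthogonal[of "m i" "p i" "m j" "p j"] admD) auto
      qed auto
      with that show ?thesis by (simp flip: sum_distrib_left)
    qed
    then show "(\<Sum>i\<in>{i \<in> I. m i = \<mu>}. \<Sum>j\<in>I. of_real (real (m i)) * ?X i j)
       = of_real (real \<mu>) * (\<Sum>i\<in>{i \<in> I. m i = \<mu>}. \<Sum>j\<in>{i \<in> I. m i = \<mu>}. ?X i j)"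
      by (simp add: sum_distrib_left)
  qed
  also have "\<dots> = (\<Sum>\<mu>\<in>m ` I. of_real (real \<mu>) *
      of_real (LINT x|M. A x ^ 0 * exp (- t * A x) * (norm (gsum {i \<in> I. m i = \<mu>} p z x))\<^sup>2))"
    by (subst gsum_sqnorm_weighted(2)) (auto intro: admD t)
  finally show ?thesis
    by (simp flip: of_real_mult of_real_sum) (intro sum_nonneg mult_nonneg_nonneg integral_nonneg, auto)
qed

text \<open>\<open>gmom_recurrence\<close> summed over all pairs. On the left, the excess over
  \<open>hdim / a\<close> is \<open>2 / a\<close> times the degree form; discarding it makes the
  constant independent of the degrees. On the right, \<open>z i + z j + t\<close> records the
  derivative falling on either factor or on \<open>exp (- t * A x)\<close>.\<close>

lemma form_lower_bound:
  assumes t: "t > 0"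
  shows "hdim / a * (LINT x|M. exp (- t * A x) * (norm (gsum I p z x))\<^sup>2)
    \<le> (LINT x|M. t * A x * exp (- t * A x) * (norm (gsum I p z x))\<^sup>2
          + 2 * (A x * exp (- t * A x) * Re (dg x * cnj (gsum I p z x))))"
proof -
  let ?g = "gsum I p z"
  let ?u = "\<lambda>i j. z i + z j + t"
  let ?d = "\<lambda>i x. of_real (z i) * p i x"
  have t0: "t \<ge> 0" using t by simp
  have u: "?u i j > 0" if "i \<in> I" "j \<in> I" for i j
    using t admD(4)[OF that(1)] admD(4)[OF that(2)] by simp
  define W where "W = (LINT x|M. exp (- t * A x) * (norm (?g x))\<^sup>2)"
  define V where "V = (LINT x|M. A x * exp (- t * A x) * (norm (?g x))\<^sup>2)"
  define D1 where "D1 = (LINT x|M. of_real (A x * exp (- t * A x)) * (dg x * cnj (?g x)))"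
  define D2 where "D2 = (LINT x|M. of_real (A x * exp (- t * A x)) * (?g x * cnj (dg x)))"
  have W: "of_real W = (\<Sum>i\<in>I. \<Sum>j\<in>I. gmom 0 (?u i j) (p i) (p j))"
    using gsum_sqnorm_weighted(2)[of I m p z t 0, OF admD(2,4) t0] by (simp add: W_def)
  have V: "of_real V = (\<Sum>i\<in>I. \<Sum>j\<in>I. gmom 1 (?u i j) (p i) (p j))"
    using gsum_sqnorm_weighted(2)[of I m p z t 1, OF admD(2,4) t0] by (simp add: V_def)
  have D1: "D1 = (\<Sum>i\<in>I. \<Sum>j\<in>I. of_real (z i) * gmom 1 (?u i j) (p i) (p j))"
    using gsum_inner(2)[of I m ?d p z t 1, OF scaled_homogeneous admD(2,4) t0]
      gmom_cmult[of 1 _ "of_real (z i)" "p i" 1 "p j" for i j] by (simp add: D1_def)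
  have D2: "D2 = (\<Sum>i\<in>I. \<Sum>j\<in>I. of_real (z j) * gmom 1 (?u i j) (p i) (p j))"
    using gsum_inner(2)[of I m p ?d z t 1, OF admD(2) scaled_homogeneous admD(4) t0]
      gmom_cmult[of 1 _ 1 "p i" "of_real (z j)" "p j" for i j] by (simp add: D2_def)
  have "of_real (hdim / a) * of_real W + of_real (2 / a) * (\<Sum>i\<in>I. \<Sum>j\<in>I. of_real (real (m i)) * gmom 0 (?u i j) (p i) (p j))
     = (\<Sum>i\<in>I. \<Sum>j\<in>I. of_real ((2 * real (m i) + hdim) / a) * gmom 0 (?u i j) (p i) (p j))"
    unfolding W by (simp add: sum_distrib_left sum.distrib[symmetric] add_divide_distrib algebra_simps)
  also have "\<dots> = (\<Sum>i\<in>I. \<Sum>j\<in>I. of_real (?u i j) * gmom 1 (?u i j) (p i) (p j))"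
    by (intro sum.cong HOL.refl gmom_recurrence[OF admD(2,3) admD(2,3) u])
  also have "\<dots> = of_real t * of_real V + D1 + D2"
    unfolding V D1 D2 by (simp add: sum_distrib_left sum.distrib[symmetric] algebra_simps)
  finally have id: "of_real (hdim / a) * of_real W + of_real (2 / a) * (\<Sum>i\<in>I. \<Sum>j\<in>I. of_real (real (m i)) * gmom 0 (?u i j) (p i) (p j))
     = of_real t * of_real V + D1 + D2" .
  have Rm: "Re (of_real c * S) = c * Re S" for c S by simp
  have "hdim / a * W + 2 / a * Re (\<Sum>i\<in>I. \<Sum>j\<in>I. of_real (real (m i)) * gmom 0 (?u i j) (p i) (p j))
     = t * V + Re D1 + Re D2"
    using arg_cong[OF id, of Re] unfolding plus_complex.simps Re_complex_of_real of_real_mult[symmetric]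
    by (simp only: Rm)
  moreover have "2 / a * Re (\<Sum>i\<in>I. \<Sum>j\<in>I. of_real (real (m i)) * gmom 0 (?u i j) (p i) (p j)) \<ge> 0"
    using degree_form_nonneg[OF t0] a_pos by (intro mult_nonneg_nonneg) auto
  ultimately have "hdim / a * W \<le> t * V + Re D1 + Re D2" by linarith
  also have "\<dots> = (LINT x|M. t * A x * exp (- t * A x) * (norm (?g x))\<^sup>2
          + 2 * (A x * exp (- t * A x) * Re (dg x * cnj (?g x))))"
  proof -
    have iV: "integrable M (\<lambda>x. A x * exp (- t * A x) * (norm (?g x))\<^sup>2)"
      using gsum_sqnorm_weighted(1)[of I m p z t 1, OF admD(2,4) t0] by simp
    have iD1: "integrable M (\<lambda>x. of_real (A x * exp (- t * A x)) * (dg x * cnj (?g x)))"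
      using gsum_inner(1)[of I m ?d p z t 1, OF scaled_homogeneous admD(2,4) t0] by simp
    have iD2: "integrable M (\<lambda>x. of_real (A x * exp (- t * A x)) * (?g x * cnj (dg x)))"
      using gsum_inner(1)[of I m p ?d z t 1, OF admD(2) scaled_homogeneous admD(4) t0] by simp
    let ?v = "\<lambda>x. t * (A x * exp (- t * A x) * (norm (?g x))\<^sup>2)"
      and ?d1 = "\<lambda>x. Re (of_real (A x * exp (- t * A x)) * (dg x * cnj (?g x)))"
      and ?d2 = "\<lambda>x. Re (of_real (A x * exp (- t * A x)) * (?g x * cnj (dg x)))"
    have "t * V + Re D1 + Re D2 = (LINT x|M. ?v x) + (LINT x|M. ?d1 x) + (LINT x|M. ?d2 x)"
      unfolding V_def D1_def D2_def by (simp only: integral_Re[OF iD1] integral_Re[OF iD2] integral_mult_right_zero)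
    also have "(LINT x|M. ?v x) + (LINT x|M. ?d1 x) = (LINT x|M. ?v x + ?d1 x)"
      by (rule Bochner_Integration.integral_add[OF integrable_mult_right[OF iV] integrable_Re[OF iD1], symmetric])
    also have "\<dots> + (LINT x|M. ?d2 x) = (LINT x|M. ?v x + ?d1 x + ?d2 x)"
      by (rule Bochner_Integration.integral_add[OF Bochner_Integration.integrable_add[OF
            integrable_mult_right[OF iV] integrable_Re[OF iD1]] integrable_Re[OF iD2], symmetric])
    also have "\<dots> = (LINT x|M. t * A x * exp (- t * A x) * (norm (?g x))\<^sup>2
          + 2 * (A x * exp (- t * A x) * Re (dg x * cnj (?g x))))"
      by (intro Bochner_Integration.integral_cong HOL.refl) (simp add: algebra_simps)
    finally show ?thesis .
  qed
  finally show ?thesis unfolding W_def .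
qed

text \<open>Because \<open>1 \<le> exp (- y) + min 1 y\<close> at \<open>y = t * A x\<close>, only
  the mass weighted by \<open>exp (- y)\<close> has to be bounded. \<open>form_lower_bound\<close>
  does this once its cross term is split into a derivative part and a truncated part.\<close>

lemma span_inequality_real:
  assumes t: "t > 0"
  shows "(LINT x|M. (norm (gsum I p z x))\<^sup>2)
    \<le> (1 + 2 / (hdim / a)) * (LINT x|M. min 1 (t * A x) * (norm (gsum I p z x))\<^sup>2)
      + 1 / (hdim / a * t) * (LINT x|M. A x * (norm (dg x))\<^sup>2)"
proof -
  let ?g = "gsum I p z"
  define \<kappa> where "\<kappa> = hdim / a"
  have \<kappa>: "\<kappa> > 0" using hdim_pos a_pos by (simp add: \<kappa>_def)
  have [measurable]: "?g \<in> borel_measurable borel"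
    using L2_functions_measurable[OF gsum_L2] by simp
  have t0: "t \<ge> 0" using t by simp
  have i0: "integrable M (\<lambda>x. (norm (?g x))\<^sup>2)"
    using gsum_sqnorm_weighted(1)[of I m p z 0 0, OF admD(2,4)] by simp
  have imin: "integrable M (\<lambda>x. min 1 (t * A x) * (norm (?g x))\<^sup>2)"
  proof (rule Bochner_Integration.integrable_bound[OF i0])
    show "AE x in M. norm (min 1 (t * A x) * (norm (?g x))\<^sup>2) \<le> norm ((norm (?g x))\<^sup>2)"
      using t A_nonneg by (intro AE_I2) (auto simp: abs_mult intro!: mult_left_le_one_le)
  qed measurable
  have iexp: "integrable M (\<lambda>x. exp (- t * A x) * (norm (?g x))\<^sup>2)"
    using gsum_sqnorm_weighted(1)[of I m p z t 0, OF admD(2,4) t0] by simp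
  have id: "integrable M (\<lambda>x. A x * (norm (dg x))\<^sup>2)"
    using gsum_sqnorm_weighted(1)[of I m "\<lambda>i x. of_real (z i) * p i x" z 0 1, OF scaled_homogeneous admD(4)] by simp
  have iV: "integrable M (\<lambda>x. A x * exp (- t * A x) * (norm (?g x))\<^sup>2)"
    using gsum_sqnorm_weighted(1)[of I m p z t 1, OF admD(2,4) t0] by simp
  have iD1: "integrable M (\<lambda>x. of_real (A x * exp (- t * A x)) * (dg x * cnj (?g x)))"
    using gsum_inner(1)[of I m "\<lambda>i x. of_real (z i) * p i x" p z t 1, OF scaled_homogeneous admD(2,4) t0] by simp
  have pointwise: "t * A x * exp (- t * A x) * (norm (?g x))\<^sup>2 + 2 * (A x * exp (- t * A x) * Re (dg x * cnj (?g x)))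
     \<le> 2 * (min 1 (t * A x) * (norm (?g x))\<^sup>2) + 1 / t * (A x * (norm (dg x))\<^sup>2)" for x
  proof -
    define y where "y = t * A x"
    define e where "e = exp (- y)"
    have y: "y \<ge> 0" using t A_nonneg by (simp add: y_def)
    have e: "0 < e" "e \<le> 1" using y by (auto simp: e_def)
    \<comment> \<open>Both \<open>y * e\<close> and \<open>y * e * e\<close> lie below
      \<open>min 1 y\<close>. The first bounds the term without derivative, the second what the
      cross term leaves on \<open>?g\<close>; together they give the 2 in the constant.\<close>
    have "y \<le> exp y" using exp_ge_add_one_self[of y] by linarith
    then have "y * e \<le> 1" by (simp add: e_def exp_minus field_simps)
    moreover have "y * e \<le> y" using y e by (simp add: mult_left_le)
    ultimately have ye: "y * e \<le> min 1 y" by simp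
    have "y * e * e \<le> y * e" using y e by (intro mult_left_le) auto
    with ye have yee: "y * e * e \<le> min 1 y" by linarith
    define u v where "u = norm (dg x)" and "v = norm (?g x)"
    have "Re (dg x * cnj (?g x)) \<le> u * v"
      using complex_Re_le_cmod[of "dg x * cnj (?g x)"] by (simp add: norm_mult u_def v_def)
    then have "2 * (A x * e * Re (dg x * cnj (?g x))) \<le> A x * (2 * e * (u * v))"
      using A_nonneg[of x] e by (simp add: mult_left_mono)
    \<comment> \<open>A completed square, weighted so that the derivative term is divided by
      \<open>t\<close>.\<close>
    also have "2 * e * (u * v) \<le> 1 / t * u\<^sup>2 + t * (e * e) * v\<^sup>2"
    proof -
      have "0 \<le> (u - t * e * v)\<^sup>2 / t" using t by simp
      also have "\<dots> = 1 / t * u\<^sup>2 + t * (e * e) * v\<^sup>2 - 2 * e * (u * v)"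
        using t by (simp add: power2_diff field_simps power2_eq_square)
      finally show ?thesis by simp
    qed
    then have "A x * (2 * e * (u * v)) \<le> A x * (1 / t * u\<^sup>2 + t * (e * e) * v\<^sup>2)"
      by (rule mult_left_mono) (rule A_nonneg)
    also have "\<dots> = 1 / t * (A x * u\<^sup>2) + y * e * e * v\<^sup>2"
      by (simp add: y_def algebra_simps)
    finally have "2 * (A x * e * Re (dg x * cnj (?g x))) \<le> 1 / t * (A x * u\<^sup>2) + y * e * e * v\<^sup>2" .
    moreover have "y * e * e * v\<^sup>2 \<le> min 1 y * v\<^sup>2" "y * e * v\<^sup>2 \<le> min 1 y * v\<^sup>2"
      using ye yee by (auto intro: mult_right_mono)
    ultimately show ?thesis
      unfolding u_def v_def e_def y_def by simp
  qed
  have "\<kappa> * (LINT x|M. exp (- t * A x) * (norm (?g x))\<^sup>2)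
    \<le> (LINT x|M. t * A x * exp (- t * A x) * (norm (?g x))\<^sup>2 + 2 * (A x * exp (- t * A x) * Re (dg x * cnj (?g x))))"
    unfolding \<kappa>_def by (rule form_lower_bound[OF t])
  also have "\<dots> \<le> (LINT x|M. 2 * (min 1 (t * A x) * (norm (?g x))\<^sup>2) + 1 / t * (A x * (norm (dg x))\<^sup>2))"
  proof (intro integral_mono pointwise)
    show "integrable M (\<lambda>x. t * A x * exp (- t * A x) * (norm (?g x))\<^sup>2 + 2 * (A x * exp (- t * A x) * Re (dg x * cnj (?g x))))"
      using integrable_mult_right[OF iV, of t] integrable_mult_right[OF integrable_Re[OF iD1], of 2]
      by (intro Bochner_Integration.integrable_add) (simp_all add: mult.assoc)
    show "integrable M (\<lambda>x. 2 * (min 1 (t * A x) * (norm (?g x))\<^sup>2) + 1 / t * (A x * (norm (dg x))\<^sup>2))"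
      by (intro Bochner_Integration.integrable_add integrable_mult_right imin id)
  qed
  also have "\<dots> = 2 * (LINT x|M. min 1 (t * A x) * (norm (?g x))\<^sup>2) + 1 / t * (LINT x|M. A x * (norm (dg x))\<^sup>2)"
    by (simp only: Bochner_Integration.integral_add[OF integrable_mult_right[OF imin] integrable_mult_right[OF id]] integral_mult_right_zero)
  finally have E: "(LINT x|M. exp (- t * A x) * (norm (?g x))\<^sup>2)
    \<le> 2 / \<kappa> * (LINT x|M. min 1 (t * A x) * (norm (?g x))\<^sup>2) + 1 / (\<kappa> * t) * (LINT x|M. A x * (norm (dg x))\<^sup>2)"
    using \<kappa> by (simp add: field_simps)
  have "(LINT x|M. (norm (?g x))\<^sup>2)
    \<le> (LINT x|M. exp (- t * A x) * (norm (?g x))\<^sup>2 + min 1 (t * A x) * (norm (?g x))\<^sup>2)"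
  proof (intro integral_mono i0 Bochner_Integration.integrable_add iexp imin)
    fix x
    have "1 \<le> exp (- t * A x) + min 1 (t * A x)"
      using exp_ge_add_one_self[of "- t * A x"] exp_gt_zero[of "- t * A x"] by (simp only: min_def split: if_split) linarith
    from mult_right_mono[OF this, of "(norm (?g x))\<^sup>2"]
    show "(norm (?g x))\<^sup>2 \<le> exp (- t * A x) * (norm (?g x))\<^sup>2 + min 1 (t * A x) * (norm (?g x))\<^sup>2"
      by (simp add: distrib_right)
  qed
  also have "\<dots> = (LINT x|M. exp (- t * A x) * (norm (?g x))\<^sup>2) + (LINT x|M. min 1 (t * A x) * (norm (?g x))\<^sup>2)"
    by (rule Bochner_Integration.integral_add[OF iexp imin])
  finally show ?thesis
    using E unfolding \<kappa>_def[symmetric] by (simp add: algebra_simps)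
qed

text \<open>\<open>fourier_energy\<close> exchanges the Dirichlet form for the energy of the
  transform. The factor \<open>1 / \<kappa>\<close> of the energy is below
  \<open>1 + 2 / \<kappa>\<close>, so one constant serves both terms.\<close>

lemma span_inequality:
  assumes t: "t > 0"
  shows "sqnorm M (gsum I p z) \<le> ennreal (1 + 2 / (hdim / a)) *
     ((\<integral>\<^sup>+x. ennreal (min 1 (t * A x) * (norm (gsum I p z x))\<^sup>2) \<partial>M)
      + (\<integral>\<^sup>+x. ennreal (A x / t * (norm (F (gsum I p z) x))\<^sup>2) \<partial>M))"
proof -
  let ?g = "gsum I p z"
  define \<kappa> where "\<kappa> = hdim / a"
  have \<kappa>: "\<kappa> > 0" using hdim_pos a_pos by (simp add: \<kappa>_def)
  have [measurable]: "?g \<in> borel_measurable borel"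
    using L2_functions_measurable[OF gsum_L2] by simp
  have i0: "integrable M (\<lambda>x. (norm (?g x))\<^sup>2)"
    using gsum_sqnorm_weighted(1)[of I m p z 0 0, OF admD(2,4)] by simp
  have imin: "integrable M (\<lambda>x. min 1 (t * A x) * (norm (?g x))\<^sup>2)"
  proof (rule Bochner_Integration.integrable_bound[OF i0])
    show "AE x in M. norm (min 1 (t * A x) * (norm (?g x))\<^sup>2) \<le> norm ((norm (?g x))\<^sup>2)"
      using t A_nonneg by (intro AE_I2) (auto simp: abs_mult intro!: mult_left_le_one_le)
  qed measurable
  have iF: "integrable M (\<lambda>x. A x * (norm (gsum I fp (\<lambda>i. 1 / z i) x))\<^sup>2)"
    using gsum_sqnorm_weighted(1)[of I m fp "\<lambda>i. 1 / z i" 0 1, OF fp_homogeneous] admD(4) by simp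
  define X where "X = (LINT x|M. min 1 (t * A x) * (norm (?g x))\<^sup>2)"
  define Y where "Y = (LINT x|M. A x * (norm (dg x))\<^sup>2)"
  have nn: "X \<ge> 0" "Y \<ge> 0"
    unfolding X_def Y_def using t A_nonneg by (auto intro!: integral_nonneg)
  have eX: "(\<integral>\<^sup>+x. ennreal (min 1 (t * A x) * (norm (?g x))\<^sup>2) \<partial>M) = ennreal X"
    unfolding X_def using t A_nonneg by (intro nn_integral_eq_integral imin) auto
  have "(\<integral>\<^sup>+x. ennreal (A x / t * (norm (F ?g x))\<^sup>2) \<partial>M)
     = (\<integral>\<^sup>+x. ennreal (1 / t * (A x * (norm (gsum I fp (\<lambda>i. 1 / z i) x))\<^sup>2)) \<partial>M)"
    by (intro nn_integral_cong_AE) (use F_gsum in \<open>eventually_elim, simp\<close>)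
  also have "\<dots> = ennreal (LINT x|M. 1 / t * (A x * (norm (gsum I fp (\<lambda>i. 1 / z i) x))\<^sup>2))"
    using t A_nonneg by (intro nn_integral_eq_integral integrable_mult_right iF) auto
  also have "\<dots> = ennreal (1 / t * Y)"
    unfolding Y_def integral_mult_right_zero fourier_energy ..
  finally have eY: "(\<integral>\<^sup>+x. ennreal (A x / t * (norm (F ?g x))\<^sup>2) \<partial>M) = ennreal (1 / t * Y)" .
  have "(LINT x|M. (norm (?g x))\<^sup>2) \<le> (1 + 2 / \<kappa>) * X + 1 / \<kappa> * (1 / t * Y)"
    using span_inequality_real[OF t] unfolding \<kappa>_def X_def Y_def by simp
  also have "\<dots> \<le> (1 + 2 / \<kappa>) * X + (1 + 2 / \<kappa>) * (1 / t * Y)"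
    using \<kappa> t nn by (intro add_left_mono mult_right_mono) (auto simp: field_simps)
  also have "\<dots> = (1 + 2 / \<kappa>) * (X + 1 / t * Y)" by (simp only: distrib_left)
  finally have "sqnorm M ?g \<le> ennreal ((1 + 2 / \<kappa>) * (X + 1 / t * Y))"
    unfolding sqnorm_eq_integral[OF gsum_L2] by (rule ennreal_leI)
  also have "\<dots> = ennreal (1 + 2 / \<kappa>) * (ennreal X + ennreal (1 / t * Y))"
    using \<kappa> t nn by (simp add: ennreal_mult ennreal_plus)
  finally show ?thesis unfolding eX eY \<kappa>_def .
qed

end

end

section \<open>Density of spans of Gaussians\<close>

lemma closed_indicator_limit:
  fixes C :: "'a::metric_space set"
  assumes "closed C" "C \<noteq> {}"
  shows "(\<lambda>n. max 0 (1 - real n * infdist x C)) \<longlonglongrightarrow> indicator C x"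
proof (cases "x \<in> C")
  case True
  then show ?thesis by simp
next
  case False
  then have d: "infdist x C > 0"
    using assms in_closed_iff_infdist_zero[of C x] infdist_nonneg[of x C] by fastforce
  obtain N :: nat where N: "1 / infdist x C < real N" using reals_Archimedean2 by blast
  have "eventually (\<lambda>n. max 0 (1 - real n * infdist x C) = 0) sequentially"
  proof (rule eventually_sequentiallyI[of N])
    fix n assume "N \<le> n"
    then have "1 / infdist x C < real n" using N by linarith
    then have "1 < real n * infdist x C" using d by (simp add: field_simps)
    then show "max 0 (1 - real n * infdist x C) = 0" by simp
  qed
  then show ?thesis using False by (simp add: tendsto_eventually)
qed

context ka_weight
begin

inductive gauss_span :: "('a \<Rightarrow> complex) \<Rightarrow> bool" where
  zero: "gauss_span (\<lambda>x. 0)"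
| add: "gauss_span g \<Longrightarrow> homogeneous_polynomial m h \<Longrightarrow> dunkl_harmonic P k h \<Longrightarrow> z > 0
    \<Longrightarrow> gauss_span (\<lambda>x. g x + gauss h z x)"

lemma gauss_span_gsum:
  assumes "gauss_span g"
  shows "\<exists>I m p z. admissible I m p z \<and> g = gsum I p z"
proof -
  have "\<exists>n m p z. admissible {..<n} m p z \<and> g = gsum {..<n} p z"
    using assms
  proof (induction rule: gauss_span.induct)
    case zero
    show ?case by (intro exI[of _ 0]) (auto simp: admissible_def gsum_def)
  next
    case (add g m h z)
    then obtain n m' p z' where *: "admissible {..<n} m' p z'" "g = gsum {..<n} p z'" by blast
    have "admissible {..<Suc n} (m'(n := m)) (p(n := h)) (z'(n := z))"
      using * add.hyps by (auto simp: admissible_def)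
    moreover have "(\<lambda>x. g x + gauss h z x) = gsum {..<Suc n} (p(n := h)) (z'(n := z))"
      unfolding *(2) gsum_def by auto
    ultimately show ?case by blast
  qed
  then show ?thesis by blast
qed

lemma gauss_span_add:
  assumes "gauss_span f" "gauss_span g"
  shows "gauss_span (\<lambda>x. f x + g x)"
  using assms(2)
proof (induction rule: gauss_span.induct)
  case (add g m h z)
  from gauss_span.add[OF add(5,2,3,4)] show ?case by (simp add: add.assoc)
qed (simp add: assms)

lemma gauss_span_cmult:
  assumes "gauss_span f"
  shows "gauss_span (\<lambda>x. c * f x)"
  using assms
proof (induction rule: gauss_span.induct)
  case (add g m h z)
  have "homogeneous_polynomial m (\<lambda>x. c * h x)"
    using homogeneous_polynomial_lincomb[OF homogeneous_polynomial_zero add(2), of c] by simp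
  from gauss_span.add[OF add(5) this dunkl_harmonic_cmult[OF homogeneous_polynomialD(1)[OF add(2)] add(3)] add(4)]
  show ?case by (simp add: distrib_left gauss_def mult.assoc)
qed (simp add: gauss_span.zero)

lemma gauss_measurable: "homogeneous_polynomial m p \<Longrightarrow> gauss p z \<in> borel_measurable borel"
  using homogeneous_polynomial_measurable[of m p] unfolding gauss_def[abs_def] by measurable

lemma gauss_span_measurable: "gauss_span g \<Longrightarrow> g \<in> borel_measurable borel"
  by (induction rule: gauss_span.induct) (auto intro: borel_measurable_add gauss_measurable)

section \<open>Approximation in the norm that includes the energy\<close>

context
  fixes t :: real
  assumes t_pos: "t > 0"
begin

text \<open>On the transform side, the squared norm for this measure controls the L2 norm and the
  energy divided by \<open>t\<close> at once.\<close>

definition N :: "'a measure" where "N = density M (\<lambda>x. ennreal (1 + A x / t))"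

lemma sets_N [simp, measurable_cong]: "sets N = sets borel"
  by (simp add: N_def)

lemma space_N [simp]: "space N = UNIV"
  by (simp add: N_def)

lemma weight_nonneg: "0 \<le> 1 + A x / t"
  using A_nonneg[of x] t_pos by simp

lemma sqnorm_N:
  assumes [measurable]: "f \<in> borel_measurable borel"
  shows "sqnorm N f = (\<integral>\<^sup>+x. ennreal ((1 + A x / t) * (norm (f x))\<^sup>2) \<partial>M)"
  unfolding sqnorm_def N_def using weight_nonneg
  by (subst nn_integral_density) (auto simp: ennreal_mult)

lemma sqnorm_N_gauss_finite:
  assumes p: "homogeneous_polynomial m p" and z: "z > 0"
  shows "sqnorm N (gauss p z) < \<infinity>"
proof -
  have [measurable]: "gauss p z \<in> borel_measurable borel" by (rule gauss_measurable[OF p])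
  obtain C where C: "C \<ge> 0" "\<And>x. norm (p x) \<le> C * norm x ^ m"
    using homogeneous_polynomial_bound[OF p] by blast
  have "(\<integral>\<^sup>+x. ennreal (norm (A x ^ i * (norm (gauss p z x))\<^sup>2)) \<partial>M) < \<infinity>" for i
  proof (rule nn_integral_gauss_bound_finite[of "2 * z" "C\<^sup>2"])
    fix x
    have "(norm (p x))\<^sup>2 \<le> (C * norm x ^ m)\<^sup>2" by (intro power_mono C) auto
    then have "A x ^ i * ((norm (p x))\<^sup>2 * (exp (- z * A x))\<^sup>2) \<le> A x ^ i * ((C * norm x ^ m)\<^sup>2 * (exp (- z * A x))\<^sup>2)"
      using A_nonneg[of x] by (intro mult_left_mono mult_right_mono) auto
    also have "(exp (- z * A x))\<^sup>2 = exp (- (2 * z) * A x)"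
      by (simp add: exp_double[symmetric] mult_ac)
    finally show "norm (A x ^ i * (norm (gauss p z x))\<^sup>2) \<le> C\<^sup>2 * (norm x ^ (2 * m) * A x ^ i * exp (- (2 * z) * A x))"
      using A_nonneg[of x] \<open>(exp (- z * A x))\<^sup>2 = exp (- (2 * z) * A x)\<close>
      by (simp add: gauss_def norm_mult power_mult_distrib abs_mult power_mult[symmetric] mult_ac)
  qed (use z in auto)
  note fin = this
  have "sqnorm N (gauss p z) = (\<integral>\<^sup>+x. ennreal (norm (A x ^ 0 * (norm (gauss p z x))\<^sup>2))
      + ennreal (1 / t) * ennreal (norm (A x ^ 1 * (norm (gauss p z x))\<^sup>2)) \<partial>M)"
    unfolding sqnorm_N[OF \<open>gauss p z \<in> borel_measurable borel\<close>]
    using A_nonneg t_pos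
    by (intro nn_integral_cong) (simp add: ennreal_mult[symmetric] ennreal_plus[symmetric] abs_mult distrib_right del: ennreal_plus)
  also have "\<dots> = (\<integral>\<^sup>+x. ennreal (norm (A x ^ 0 * (norm (gauss p z x))\<^sup>2)) \<partial>M)
      + ennreal (1 / t) * (\<integral>\<^sup>+x. ennreal (norm (A x ^ 1 * (norm (gauss p z x))\<^sup>2)) \<partial>M)"
    by (subst nn_integral_add) (simp_all add: nn_integral_cmult)
  also have "\<dots> < \<infinity>"
    using fin[of 0] fin[of 1] by (simp add: ennreal_mult_less_top)
  finally show ?thesis .
qed

text \<open>Membership in the closure of the span, stated with sequences so that dominated
  convergence applies. The class is enlarged from Gaussians to all functions of finite norm.\<close>

definition approximable :: "('a \<Rightarrow> complex) \<Rightarrow> bool" where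
  "approximable f \<longleftrightarrow> f \<in> borel_measurable borel \<and>
     (\<exists>s. (\<forall>n. gauss_span (s n)) \<and> (\<lambda>n. sqnorm N (\<lambda>x. f x - s n x)) \<longlonglongrightarrow> 0)"

lemma approximable_span: "gauss_span g \<Longrightarrow> approximable g"
  unfolding approximable_def
  by (auto intro!: exI[of _ "\<lambda>n. g"] gauss_span_measurable simp: sqnorm_def)

lemma approximable_add:
  assumes "approximable f" "approximable g"
  shows "approximable (\<lambda>x. f x + g x)"
proof -
  obtain s u where s: "\<And>n. gauss_span (s n)" "(\<lambda>n. sqnorm N (\<lambda>x. f x - s n x)) \<longlonglongrightarrow> 0"
    and u: "\<And>n. gauss_span (u n)" "(\<lambda>n. sqnorm N (\<lambda>x. g x - u n x)) \<longlonglongrightarrow> 0"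
    using assms unfolding approximable_def by blast
  have [measurable]: "f \<in> borel_measurable borel" "g \<in> borel_measurable borel"
      "s n \<in> borel_measurable borel" "u n \<in> borel_measurable borel" for n
    using assms s u gauss_span_measurable unfolding approximable_def by auto
  have "(\<lambda>n. 2 * sqnorm N (\<lambda>x. f x - s n x) + 2 * sqnorm N (\<lambda>x. g x - u n x)) \<longlonglongrightarrow> 2 * 0 + 2 * 0"
    by (intro tendsto_add ennreal_tendsto_cmult s u) auto
  then have lim: "(\<lambda>n. 2 * sqnorm N (\<lambda>x. f x - s n x) + 2 * sqnorm N (\<lambda>x. g x - u n x)) \<longlonglongrightarrow> 0" by simp
  have "sqnorm N (\<lambda>x. f x + g x - (s n x + u n x)) \<le> 2 * sqnorm N (\<lambda>x. f x - s n x) + 2 * sqnorm N (\<lambda>x. g x - u n x)" for n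
    using sqnorm_add_le[of "\<lambda>x. f x - s n x" N "\<lambda>x. g x - u n x"] by (simp add: algebra_simps)
  then have "(\<lambda>n. sqnorm N (\<lambda>x. f x + g x - (s n x + u n x))) \<longlonglongrightarrow> 0"
    by (intro tendsto_sandwich[OF _ _ tendsto_const lim]) auto
  then show ?thesis
    unfolding approximable_def using gauss_span_add[OF s(1) u(1)]
    by (intro conjI exI[of _ "\<lambda>n x. s n x + u n x"]) auto
qed

lemma approximable_cmult:
  assumes "approximable f"
  shows "approximable (\<lambda>x. c * f x)"
proof -
  obtain s where s: "\<And>n. gauss_span (s n)" "(\<lambda>n. sqnorm N (\<lambda>x. f x - s n x)) \<longlonglongrightarrow> 0"
    using assms unfolding approximable_def by blast
  have [measurable]: "f \<in> borel_measurable borel" "s n \<in> borel_measurable borel" for n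
    using assms s gauss_span_measurable unfolding approximable_def by auto
  have "(\<lambda>n. ennreal ((norm c)\<^sup>2) * sqnorm N (\<lambda>x. f x - s n x)) \<longlonglongrightarrow> ennreal ((norm c)\<^sup>2) * 0"
    by (intro ennreal_tendsto_cmult s) auto
  moreover have "sqnorm N (\<lambda>x. c * f x - c * s n x) = ennreal ((norm c)\<^sup>2) * sqnorm N (\<lambda>x. f x - s n x)" for n
    unfolding right_diff_distrib[symmetric] by (rule sqnorm_cmult) measurable
  ultimately have "(\<lambda>n. sqnorm N (\<lambda>x. c * f x - c * s n x)) \<longlonglongrightarrow> 0" by simp
  then show ?thesis
    unfolding approximable_def using gauss_span_cmult[OF s(1)]
    by (intro conjI exI[of _ "\<lambda>n x. c * s n x"]) auto
qed

lemma approximable_sum: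
  assumes "finite I" "\<And>i. i \<in> I \<Longrightarrow> approximable (f i)"
  shows "approximable (\<lambda>x. \<Sum>i\<in>I. f i x)"
  using assms
  by (induction rule: finite_induct) (auto intro: approximable_add approximable_span gauss_span.zero)

text \<open>A diagonal choice: each \<open>f n\<close> is replaced by an element of the span at
  squared distance below \<open>1 / Suc n\<close>.\<close>

lemma approximable_limit:
  assumes f: "\<And>n. approximable (f n)" and [measurable]: "g \<in> borel_measurable borel"
    and lim: "(\<lambda>n. sqnorm N (\<lambda>x. g x - f n x)) \<longlonglongrightarrow> 0"
  shows "approximable g"
proof -
  have "\<exists>s. gauss_span s \<and> sqnorm N (\<lambda>x. f n x - s x) < ennreal (1 / real (Suc n))" for n
  proof -
    obtain s where s: "\<And>n. gauss_span (s n)" "(\<lambda>j. sqnorm N (\<lambda>x. f n x - s j x)) \<longlonglongrightarrow> 0"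
      using f[of n] unfolding approximable_def by blast
    have "eventually (\<lambda>j. sqnorm N (\<lambda>x. f n x - s j x) < ennreal (1 / real (Suc n))) sequentially"
      by (rule order_tendstoD(2)[OF s(2)]) simp
    then show ?thesis using s(1) unfolding eventually_sequentially by blast
  qed
  then obtain s where s: "\<And>n. gauss_span (s n)" "\<And>n. sqnorm N (\<lambda>x. f n x - s n x) < ennreal (1 / real (Suc n))"
    by metis
  have [measurable]: "f n \<in> borel_measurable borel" "s n \<in> borel_measurable borel" for n
    using f s gauss_span_measurable unfolding approximable_def by auto
  have "(\<lambda>n. ennreal (1 / real (Suc n))) \<longlonglongrightarrow> ennreal 0"
    by (intro tendsto_ennrealI LIMSEQ_Suc lim_const_over_n)
  then have "(\<lambda>n. 2 * sqnorm N (\<lambda>x. g x - f n x) + 2 * ennreal (1 / real (Suc n))) \<longlonglongrightarrow> 2 * 0 + 2 * 0"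
    by (intro tendsto_add ennreal_tendsto_cmult lim) auto
  then have lim': "(\<lambda>n. 2 * sqnorm N (\<lambda>x. g x - f n x) + 2 * ennreal (1 / real (Suc n))) \<longlonglongrightarrow> 0" by simp
  have "sqnorm N (\<lambda>x. g x - s n x) \<le> 2 * sqnorm N (\<lambda>x. g x - f n x) + 2 * ennreal (1 / real (Suc n))" for n
  proof -
    have "sqnorm N (\<lambda>x. g x - s n x) \<le> 2 * sqnorm N (\<lambda>x. g x - f n x) + 2 * sqnorm N (\<lambda>x. f n x - s n x)"
      using sqnorm_add_le[of "\<lambda>x. g x - f n x" N "\<lambda>x. f n x - s n x"] by simp
    also have "\<dots> \<le> 2 * sqnorm N (\<lambda>x. g x - f n x) + 2 * ennreal (1 / real (Suc n))"
      using s(2)[of n] by (intro add_left_mono mult_left_mono) auto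
    finally show ?thesis .
  qed
  then have "(\<lambda>n. sqnorm N (\<lambda>x. g x - s n x)) \<longlonglongrightarrow> 0"
    by (intro tendsto_sandwich[OF _ _ tendsto_const lim']) auto
  with s(1) show ?thesis unfolding approximable_def by auto
qed

lemma approximable_dominated:
  assumes f: "\<And>n. approximable (f n)" and g [measurable]: "g \<in> borel_measurable borel"
    and lim: "\<And>x. (\<lambda>n. f n x) \<longlonglongrightarrow> g x"
    and G [measurable]: "G \<in> borel_measurable borel" and bound: "\<And>n x. norm (f n x) \<le> norm (G x)"
    and fin: "sqnorm N (G :: 'a \<Rightarrow> complex) < \<infinity>"
  shows "approximable g"
proof (rule approximable_limit[OF f g])
  have [measurable]: "f n \<in> borel_measurable borel" for n
    using f unfolding approximable_def by auto
  have gG: "norm (g x) \<le> norm (G x)" for x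
    by (rule Lim_bounded[OF tendsto_norm[OF lim[of x]]]) (use bound in auto)
  have "(\<lambda>n. \<integral>\<^sup>+x. ennreal ((norm (g x - f n x))\<^sup>2) \<partial>N) \<longlonglongrightarrow> (\<integral>\<^sup>+x. 0 \<partial>N)"
  proof (rule nn_integral_dominated_convergence)
    show "AE x in N. ennreal ((norm (g x - f n x))\<^sup>2) \<le> 4 * ennreal ((norm (G x))\<^sup>2)" for n
    proof (intro AE_I2)
      fix x
      have "norm (g x - f n x) \<le> 2 * norm (G x)"
        using norm_triangle_ineq4[of "g x" "f n x"] gG[of x] bound[of n x] by linarith
      then have "(norm (g x - f n x))\<^sup>2 \<le> (2 * norm (G x))\<^sup>2" by (intro power_mono) auto
      then have "ennreal ((norm (g x - f n x))\<^sup>2) \<le> ennreal (4 * (norm (G x))\<^sup>2)"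
        by (intro ennreal_leI) (simp add: power_mult_distrib)
      then show "ennreal ((norm (g x - f n x))\<^sup>2) \<le> 4 * ennreal ((norm (G x))\<^sup>2)"
        by (simp add: ennreal_mult)
    qed
    show "(\<integral>\<^sup>+x. 4 * ennreal ((norm (G x))\<^sup>2) \<partial>N) < \<infinity>"
      using fin by (subst nn_integral_cmult) (auto simp: sqnorm_def ennreal_mult_less_top)
    show "AE x in N. (\<lambda>n. ennreal ((norm (g x - f n x))\<^sup>2)) \<longlonglongrightarrow> 0"
    proof (intro AE_I2)
      fix x
      have "(\<lambda>n. (norm (g x - f n x))\<^sup>2) \<longlonglongrightarrow> (norm (g x - g x))\<^sup>2"
        by (intro tendsto_intros lim)
      then have "(\<lambda>n. ennreal ((norm (g x - f n x))\<^sup>2)) \<longlonglongrightarrow> ennreal ((norm (g x - g x))\<^sup>2)"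
        by (rule tendsto_ennrealI)
      then show "(\<lambda>n. ennreal ((norm (g x - f n x))\<^sup>2)) \<longlonglongrightarrow> 0" by simp
    qed
  qed measurable
  then show "(\<lambda>n. sqnorm N (\<lambda>x. g x - f n x)) \<longlonglongrightarrow> 0"
    unfolding sqnorm_def by simp
qed

text \<open>In the variable \<open>u = exp (- A x)\<close>, multiplication by \<open>u ^ i\<close>
  raises the rate of a Gaussian by \<open>i\<close>, so \<open>gauss p 1\<close> times a polynomial
  in \<open>u\<close> stays in the span. The Weierstrass theorem on \<open>{0..1}\<close> and
  domination by a multiple of \<open>gauss p 1\<close> reach continuous
  \<open>\<phi>\<close>.\<close>

lemma approximable_continuous_radial:
  assumes p: "homogeneous_polynomial m p" "dunkl_harmonic P k p" and \<phi>: "continuous_on {0..1} \<phi>"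
  shows "approximable (\<lambda>x. gauss p 1 x * of_real (\<phi> (exp (- A x))))"
proof -
  have "\<exists>q. real_polynomial_function q \<and> (\<forall>u\<in>{0..1}. \<bar>\<phi> u - q u\<bar> < 1 / real (Suc n))" for n
    by (rule Stone_Weierstrass_real_polynomial_function[OF compact_Icc \<phi>, of "1 / real (Suc n)"]) auto
  then obtain q where q: "\<And>n. real_polynomial_function (q n)" "\<And>n u. u \<in> {0..1} \<Longrightarrow> \<bar>\<phi> u - q n u\<bar> < 1 / real (Suc n)"
    by metis
  obtain B where B: "B \<ge> 0" "\<And>u. u \<in> {0..1} \<Longrightarrow> \<bar>\<phi> u\<bar> \<le> B"
  proof -
    have "bounded (\<phi> ` {0..1})" by (intro compact_imp_bounded compact_continuous_image \<phi>) auto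
    then obtain B where "B > 0" "\<And>u. u \<in> {0..1} \<Longrightarrow> \<bar>\<phi> u\<bar> \<le> B" unfolding bounded_pos by auto
    then show thesis using that[of B] by auto
  qed
  define u where "u x = exp (- A x)" for x
  have u: "u x \<in> {0..1}" for x using A_nonneg by (simp add: u_def)
  have [measurable]: "u \<in> borel_measurable borel" unfolding u_def by measurable
  have [measurable]: "gauss p 1 \<in> borel_measurable borel" by (rule gauss_measurable[OF p(1)])
  have q_meas [measurable]: "q n \<in> borel_measurable borel" for n
    using q(1)[of n] by (intro borel_measurable_continuous_onI continuous_on_polymonial_function)
      (simp add: real_polynomial_function_eq)
  have lim: "(\<lambda>n. q n (u x)) \<longlonglongrightarrow> \<phi> (u x)" for x
  proof (rule LIMSEQ_I)
    fix r :: real assume "r > 0"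
    then obtain n0 where n0: "1 / real (Suc n0) < r" using nat_approx_posE by blast
    have "norm (q n (u x) - \<phi> (u x)) < r" if "n \<ge> n0" for n
    proof -
      have "\<bar>\<phi> (u x) - q n (u x)\<bar> < 1 / real (Suc n)" by (rule q(2)[OF u])
      also have "\<dots> \<le> 1 / real (Suc n0)" using that by (simp add: frac_le)
      finally show ?thesis using n0 by (simp add: abs_minus_commute)
    qed
    then show "\<exists>n0. \<forall>n\<ge>n0. norm (q n (u x) - \<phi> (u x)) < r" by blast
  qed
  have meas_\<phi> [measurable]: "(\<lambda>x. \<phi> (u x)) \<in> borel_measurable borel"
    by (rule borel_measurable_LIMSEQ_real[OF lim]) measurable
  show ?thesis
    unfolding u_def[symmetric]
  proof (rule approximable_dominated[where f = "\<lambda>n x. gauss p 1 x * of_real (q n (u x))" and G = "\<lambda>x. of_real (B + 1) * gauss p 1 x"])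
    fix n
    obtain c d where cd: "q n = (\<lambda>x. \<Sum>i\<le>d. c i * x ^ i)"
      using q(1)[of n] unfolding real_polynomial_function_iff_sum by blast
    have "gauss p 1 x * of_real (q n (u x)) = (\<Sum>i\<in>{..d}. of_real (c i) * gauss p (1 + real i) x)" for x
    proof -
      have "exp (- (1 + real i) * A x) = exp (- 1 * A x) * u x ^ i" for i
        unfolding u_def exp_of_nat_mult[symmetric] exp_add[symmetric] by (simp add: algebra_simps)
      then show ?thesis
        unfolding cd gauss_def by (simp add: sum_distrib_left mult_ac)
    qed
    moreover have "approximable (gauss p (1 + real i))" for i
      using approximable_span[OF gauss_span.add[OF gauss_span.zero p, of "1 + real i"]] by simp
    then have "approximable (\<lambda>x. \<Sum>i\<in>{..d}. of_real (c i) * gauss p (1 + real i) x)"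
      by (intro approximable_sum approximable_cmult) auto
    ultimately show "approximable (\<lambda>x. gauss p 1 x * of_real (q n (u x)))" by simp
  next
    show "(\<lambda>n. gauss p 1 x * of_real (q n (u x))) \<longlonglongrightarrow> gauss p 1 x * of_real (\<phi> (u x))" for x
      by (intro tendsto_intros lim)
    show "norm (gauss p 1 x * of_real (q n (u x))) \<le> norm (of_real (B + 1) * gauss p 1 x)" for n x
    proof -
      have "\<bar>q n (u x)\<bar> \<le> \<bar>\<phi> (u x)\<bar> + \<bar>\<phi> (u x) - q n (u x)\<bar>" by linarith
      also have "\<dots> \<le> B + 1 / real (Suc n)" using B(2)[OF u, of x] q(2)[OF u, of x n] by linarith
      also have "\<dots> \<le> B + 1" by simp
      finally have "\<bar>q n (u x)\<bar> \<le> \<bar>B + 1\<bar>" using B(1) by simp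
      from mult_left_mono[OF this, of "norm (gauss p 1 x)"] show ?thesis
        unfolding norm_mult norm_of_real by (simp add: mult.commute)
    qed
    show "sqnorm N (\<lambda>x. of_real (B + 1) * gauss p 1 x) < \<infinity>"
      using sqnorm_N_gauss_finite[OF p(1) zero_less_one]
      by (subst sqnorm_cmult) (auto simp: ennreal_mult_less_top)
  qed measurable
qed

text \<open>To be applied to \<open>u = exp (- A x)\<close>. It vanishes for
  \<open>u \<le> 1 / Suc n\<close>, which confines \<open>x\<close> to a ball, and equals 1 for
  \<open>u \<ge> 2 / Suc n\<close>; as \<open>u\<close> is positive, it tends to 1 at every
  point.\<close>

definition cutoff :: "nat \<Rightarrow> real \<Rightarrow> real" where
  "cutoff n u = max 0 (min 1 (real (Suc n) * u - 1))"

lemma cutoff_bounds: "0 \<le> cutoff n u" "cutoff n u \<le> 1"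
  unfolding cutoff_def by linarith+

lemma cutoff_nonzeroD:
  assumes "cutoff n u \<noteq> 0"
  shows "1 / real (Suc n) < u"
proof -
  have "0 < real (Suc n) * u - 1"
    using assms unfolding cutoff_def by linarith
  then show ?thesis by (simp add: field_simps)
qed

lemma continuous_on_cutoff: "continuous_on S (cutoff n)"
  unfolding cutoff_def
  by (intro continuous_on_max continuous_on_min continuous_on_const continuous_on_diff continuous_on_mult continuous_on_id)

lemma cutoff_measurable [measurable]: "cutoff n \<in> borel_measurable borel"
  unfolding cutoff_def by measurable

lemma cutoff_tendsto: "u > 0 \<Longrightarrow> (\<lambda>n. cutoff n u) \<longlonglongrightarrow> 1"
proof -
  assume u: "u > 0"
  obtain n0 :: nat where n0: "2 / u < real n0" using reals_Archimedean2 by blast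
  have "eventually (\<lambda>n. cutoff n u = 1) sequentially"
  proof (rule eventually_sequentiallyI[of n0])
    fix n assume "n0 \<le> n"
    then have "2 / u < real (Suc n)" using n0 by linarith
    then have "2 < real (Suc n) * u" using u by (simp add: field_simps)
    then show "cutoff n u = 1" by (simp add: cutoff_def)
  qed
  then show ?thesis by (simp add: tendsto_eventually)
qed

text \<open>Puts a bounded function times the cutoff below a multiple of the Gaussian of rate 1,
  whose norm is finite.\<close>

lemma cutoff_le: "cutoff n (exp (- A x)) \<le> real (Suc n) * exp (- A x)"
proof -
  have "0 \<le> real (Suc n) * exp (- A x)" by simp
  then show ?thesis unfolding cutoff_def by linarith
qed

lemma homogeneous_one: "homogeneous_polynomial 0 (\<lambda>x. 1)"
  by (simp add: homogeneous_polynomial_def)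

lemma cutoff_dominating:
  "sqnorm N (\<lambda>x. of_real C * gauss (\<lambda>x. 1) 1 x) < \<infinity>"
  "(\<lambda>x. of_real C * gauss (\<lambda>x. 1) 1 x) \<in> borel_measurable borel"
proof -
  have [measurable]: "gauss (\<lambda>x. 1) 1 \<in> borel_measurable borel" by (rule gauss_measurable[OF homogeneous_one])
  show "sqnorm N (\<lambda>x. of_real C * gauss (\<lambda>x. 1) 1 x) < \<infinity>"
    using sqnorm_N_gauss_finite[OF homogeneous_one zero_less_one]
    by (subst sqnorm_cmult) (auto simp: ennreal_mult_less_top)
  show "(\<lambda>x. of_real C * gauss (\<lambda>x. 1) 1 x) \<in> borel_measurable borel" by measurable
qed

lemma norm_cutoff_le:
  fixes c :: complex
  assumes "norm c \<le> B"
  shows "norm (c * of_real (cutoff n (exp (- A x)))) \<le> norm (of_real (B * real (Suc n)) * gauss (\<lambda>x. 1) 1 x)"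
proof -
  have B: "B \<ge> 0" using assms norm_ge_zero[of c] by linarith
  have "norm (c * of_real (cutoff n (exp (- A x)))) = norm c * cutoff n (exp (- A x))"
    using cutoff_bounds by (simp add: norm_mult)
  also have "\<dots> \<le> B * (real (Suc n) * exp (- A x))"
    using assms B cutoff_bounds by (intro mult_mono cutoff_le) auto
  also have "\<dots> = norm (of_real (B * real (Suc n)) * gauss (\<lambda>x. 1) 1 x)"
    unfolding gauss_def norm_mult norm_of_real using B by simp
  finally show ?thesis .
qed

text \<open>The squared norm of \<open>x\<close> equals \<open>(a * (- ln u)) powr (2 / a)\<close>
  for \<open>u = exp (- A x)\<close>, a continuous function of \<open>u\<close> away from 0, and
  near 0 the cutoff vanishes. By the Fischer decomposition, a polynomial times the cutoff is a sum
  of harmonics times continuous functions of \<open>u\<close>.\<close>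

lemma approximable_polynomial_cutoff:
  assumes "polynomial_function Q"
  shows "approximable (\<lambda>x. Q x * of_real (cutoff n (exp (- A x))))"
  using polynomial_harmonic_span[OF assms]
proof (induction rule: harmonic_span.induct)
  case zero
  show ?case using approximable_span[OF gauss_span.zero] by simp
next
  case (add f d h e)
  define \<epsilon> where "\<epsilon> = 1 / real (Suc n)"
  have \<epsilon>: "0 < \<epsilon>" "\<epsilon> \<le> 1" by (auto simp: \<epsilon>_def)
  \<comment> \<open>\<open>max u \<epsilon>\<close> removes the singularity at 0 and equals
    \<open>u\<close> wherever the cutoff is nonzero. The division by it undoes the factor
    \<open>exp (- A x)\<close> in \<open>gauss h 1\<close>.\<close>
  define \<phi> where "\<phi> u = ((a * (- ln (max u \<epsilon>))) powr (2 / a)) ^ e * cutoff n u / max u \<epsilon>" for u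
  have "continuous_on {0..1} \<phi>"
    unfolding \<phi>_def
  proof (intro continuous_on_divide continuous_on_mult continuous_on_power continuous_on_powr'
      continuous_on_const continuous_on_cutoff continuous_on_minus continuous_on_ln continuous_on_max continuous_on_id ballI conjI impI)
    fix u :: real assume "u \<in> {0..1}"
    then show "0 \<le> a * - ln (max u \<epsilon>)" using \<epsilon> a_pos by (intro mult_nonneg_nonneg) (auto simp: ln_le_zero_iff max_def)
    show "0 < 2 / a" using a_pos by simp
    show "max u \<epsilon> \<noteq> 0" "max u \<epsilon> \<noteq> 0" using \<epsilon> by auto
  qed (use a_pos in auto)
  from approximable_continuous_radial[OF add(2,3) this]
  have "approximable (\<lambda>x. gauss h 1 x * of_real (\<phi> (exp (- A x))))" .
  moreover have "gauss h 1 x * of_real (\<phi> (exp (- A x))) = of_real ((norm x)\<^sup>2) ^ e * h x * of_real (cutoff n (exp (- A x)))" for x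
  proof (cases "cutoff n (exp (- A x)) = 0")
    case True
    then show ?thesis by (simp add: \<phi>_def)
  next
    case False
    then have "max (exp (- A x)) \<epsilon> = exp (- A x)"
      using cutoff_nonzeroD[OF False] by (simp add: \<epsilon>_def)
    moreover have "(a * A x) powr (2 / a) = (norm x)\<^sup>2"
      using a_pos by (cases "x = 0") (simp_all add: A_def powr_powr powr_realpow[of _ 2, simplified])
    ultimately have "exp (- A x) * \<phi> (exp (- A x)) = ((norm x)\<^sup>2) ^ e * cutoff n (exp (- A x))"
      by (simp add: \<phi>_def)
    then have "complex_of_real (exp (- A x)) * of_real (\<phi> (exp (- A x))) = of_real (((norm x)\<^sup>2) ^ e * cutoff n (exp (- A x)))"
      by (simp only: of_real_mult[symmetric])
    then show ?thesis by (simp add: gauss_def mult_ac)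
  qed
  ultimately have "approximable (\<lambda>x. of_real ((norm x)\<^sup>2) ^ e * h x * of_real (cutoff n (exp (- A x))))" by simp
  from approximable_add[OF add(4) this] show ?case by (simp add: distrib_right)
qed

text \<open>Polynomials approximate \<open>f\<close> uniformly on a ball outside which the cutoff is
  zero. The radius \<open>R\<close> comes from solving \<open>A x < ln (Suc n)\<close> for the
  norm.\<close>

lemma approximable_continuous_cutoff:
  assumes f: "continuous_on UNIV f"
  shows "approximable (\<lambda>x. f x * of_real (cutoff n (exp (- A x))))"
proof -
  define R where "R = (a * ln (real (Suc n))) powr (1 / a)"
  have R: "x \<in> cball 0 R" if "cutoff n (exp (- A x)) \<noteq> 0" for x
  proof -
    have "1 / real (Suc n) < exp (- A x)" by (rule cutoff_nonzeroD[OF that])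
    then have "exp (A x) < real (Suc n)" by (simp add: exp_minus field_simps)
    then have "A x < ln (real (Suc n))" by (simp add: ln_less_cancel_iff[symmetric] del: ln_less_cancel_iff)
    then have "norm x powr a \<le> a * ln (real (Suc n))" using a_pos by (simp add: A_def field_simps)
    then have "(norm x powr a) powr (1 / a) \<le> R" unfolding R_def using a_pos by (intro powr_mono2) auto
    then show ?thesis using a_pos by (simp add: powr_powr)
  qed
  have "\<exists>q. polynomial_function q \<and> (\<forall>x\<in>cball 0 R. norm (f x - q x) < 1 / real (Suc j))" for j
    by (rule Stone_Weierstrass_polynomial_function[OF compact_cball]) (auto intro: continuous_on_subset[OF f])
  then obtain q where q: "\<And>j. polynomial_function (q j)" "\<And>j x. x \<in> cball 0 R \<Longrightarrow> norm (f x - q j x) < 1 / real (Suc j)"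
    by metis
  obtain B where B: "B \<ge> 0" "\<And>x. x \<in> cball 0 R \<Longrightarrow> norm (f x) \<le> B"
  proof -
    have "bounded (f ` cball 0 R)"
      by (intro compact_imp_bounded compact_continuous_image continuous_on_subset[OF f]) auto
    then obtain B where "B > 0" "\<And>x. x \<in> cball 0 R \<Longrightarrow> norm (f x) \<le> B" unfolding bounded_pos by auto
    then show thesis using that[of B] by auto
  qed
  have meas: "(\<lambda>x. f x * of_real (cutoff n (exp (- A x)))) \<in> borel_measurable borel"
    by (intro borel_measurable_continuous_onI continuous_intros f continuous_on_of_real
        continuous_on_compose2[OF continuous_on_cutoff[of UNIV]] continuous_on_A) auto
  show ?thesis
  proof (rule approximable_dominated[where f = "\<lambda>j x. q j x * of_real (cutoff n (exp (- A x)))"])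
    show "approximable (\<lambda>x. q j x * of_real (cutoff n (exp (- A x))))" for j
      by (rule approximable_polynomial_cutoff[OF q(1)])
    show "(\<lambda>j. q j x * of_real (cutoff n (exp (- A x)))) \<longlonglongrightarrow> f x * of_real (cutoff n (exp (- A x)))" for x
    proof (cases "cutoff n (exp (- A x)) = 0")
      case False
      have "(\<lambda>j. q j x) \<longlonglongrightarrow> f x"
      proof (rule LIMSEQ_I)
        fix r :: real assume "r > 0"
        then obtain n0 where n0: "1 / real (Suc n0) < r" using nat_approx_posE by blast
        have "norm (q j x - f x) < r" if "j \<ge> n0" for j
        proof -
          have "norm (f x - q j x) < 1 / real (Suc j)" by (rule q(2)[OF R[OF False]])
          also have "\<dots> \<le> 1 / real (Suc n0)" using that by (simp add: frac_le)
          finally show ?thesis using n0 by (simp add: norm_minus_commute)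
        qed
        then show "\<exists>n0. \<forall>j\<ge>n0. norm (q j x - f x) < r" by blast
      qed
      then show ?thesis by (intro tendsto_intros)
    qed simp
    show "norm (q j x * of_real (cutoff n (exp (- A x)))) \<le> norm (of_real ((B + 1) * real (Suc n)) * gauss (\<lambda>x. 1) 1 x)" for j x
    proof (cases "cutoff n (exp (- A x)) = 0")
      case False
      have "norm (q j x) \<le> norm (f x) + norm (f x - q j x)"
        by (metis add.commute norm_minus_commute norm_triangle_sub)
      also have "\<dots> \<le> B + 1 / real (Suc j)" using B(2)[OF R[OF False]] q(2)[OF R[OF False], of j] by linarith
      also have "\<dots> \<le> B + 1" by simp
      finally show ?thesis by (rule norm_cutoff_le)
    qed simp
  qed (rule meas, rule cutoff_dominating(2), rule cutoff_dominating(1))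
qed

text \<open>Dynkin's argument with closed sets as generators. Distance functions give the generators
  and partial unions the disjoint unions, both as limits dominated through
  \<open>norm_cutoff_le\<close>; complements use the constant function with the same cutoff.\<close>

lemma approximable_indicator_cutoff:
  assumes "S \<in> sets borel"
  shows "approximable (\<lambda>x. indicator S x * of_real (cutoff n (exp (- A x))))"
proof -
  let ?c = "\<lambda>x. complex_of_real (cutoff n (exp (- A x)))"
  have c_meas: "?c \<in> borel_measurable borel" by measurable
  have meas: "(\<lambda>x. indicator B x * ?c x) \<in> borel_measurable borel" if "B \<in> sets borel" for B
    by (intro borel_measurable_times borel_measurable_indicator that c_meas)
  have "Int_stable (Collect closed :: 'a set set)" by (auto intro!: Int_stableI)
  moreover have "Collect closed \<subseteq> Pow (UNIV :: 'a set)" by simp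
  moreover have "S \<in> sigma_sets UNIV (Collect closed)"
    using assms unfolding borel_eq_closed by simp
  ultimately show ?thesis
  proof (induction rule: sigma_sets_induct_disjoint)
    case (basic C)
    show ?case
    proof (cases "C = {}")
      case True
      then show ?thesis using approximable_span[OF gauss_span.zero] by simp
    next
      case False
      have C: "closed C" using basic by simp
      show ?thesis
      proof (rule approximable_dominated[where f = "\<lambda>j x. of_real (max 0 (1 - real j * infdist x C)) * ?c x"])
        show "approximable (\<lambda>x. of_real (max 0 (1 - real j * infdist x C)) * ?c x)" for j
          by (intro approximable_continuous_cutoff continuous_intros)
        show "(\<lambda>j. of_real (max 0 (1 - real j * infdist x C)) * ?c x) \<longlonglongrightarrow> indicator C x * ?c x" for x
          using tendsto_of_real[OF closed_indicator_limit[OF C False, of x], where 'a=complex]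
          by (intro tendsto_mult tendsto_const) (simp add: of_real_indicator)
        show "norm (of_real (max 0 (1 - real j * infdist x C)) * ?c x) \<le> norm (of_real (1 * real (Suc n)) * gauss (\<lambda>x. 1) 1 x)" for j x
          by (rule norm_cutoff_le) (auto simp: infdist_nonneg)
      qed (rule meas[OF borel_closed[OF C]], rule cutoff_dominating(2), rule cutoff_dominating(1))
    qed
  next
    case empty
    show ?case using approximable_span[OF gauss_span.zero] by simp
  next
    case (compl B)
    have "approximable (\<lambda>x. 1 * ?c x + (-1) * (indicator B x * ?c x))"
      by (rule approximable_add[OF approximable_continuous_cutoff[OF continuous_on_const] approximable_cmult[OF compl(2)]])
    moreover have "1 * ?c x + (-1) * (indicator B x * ?c x) = indicator (UNIV - B) x * ?c x" for x
      by (auto simp: indicator_def)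
    ultimately show ?case by simp
  next
    case (union B)
    have "sigma_sets UNIV (Collect closed) = sets (borel :: 'a measure)" unfolding borel_eq_closed by simp
    then have "(\<Union>i. B i) \<in> sets borel" using union(2) by auto
    show ?case
    proof (rule approximable_dominated[where f = "\<lambda>j x. \<Sum>i<j. indicator (B i) x * ?c x"])
      show "approximable (\<lambda>x. \<Sum>i<j. indicator (B i) x * ?c x)" for j
        by (intro approximable_sum union) auto
      have eq: "(\<Sum>i<j. indicator (B i) x * ?c x) = indicator (\<Union>i<j. B i) x * ?c x" for j x
        using union(1) by (subst indicator_UN_disjoint) (auto simp: sum_distrib_right disjoint_family_on_def)
      show "norm (\<Sum>i<j. indicator (B i) x * ?c x) \<le> norm (of_real (1 * real (Suc n)) * gauss (\<lambda>x. 1) 1 x)" for j x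
        unfolding eq by (rule norm_cutoff_le) (auto simp: indicator_def)
      show "(\<lambda>j. \<Sum>i<j. indicator (B i) x * ?c x) \<longlonglongrightarrow> indicator (\<Union>i. B i) x * ?c x" for x
        unfolding eq using LIMSEQ_indicator_UN[of B x] by (intro tendsto_intros)
    qed (rule meas, fact, rule cutoff_dominating(2), rule cutoff_dominating(1))
  qed
qed

lemma approximable_simple_cutoff:
  assumes "simple_function borel s"
  shows "approximable (\<lambda>x. s x * of_real (cutoff n (exp (- A x))))"
proof -
  let ?c = "\<lambda>x. complex_of_real (cutoff n (exp (- A x)))"
  have meas: "s -` {y} \<in> sets borel" if "y \<in> range s" for y
    using assms that unfolding simple_function_def by auto
  have fin: "finite (range s)" using assms unfolding simple_function_def by simp
  have "approximable (\<lambda>x. \<Sum>y\<in>range s. y * (indicator (s -` {y}) x * ?c x))"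
    by (rule approximable_sum[OF fin approximable_cmult[OF approximable_indicator_cutoff[OF meas]]])
  moreover have "(\<Sum>y\<in>range s. y * (indicator (s -` {y}) x * ?c x)) = s x * ?c x" for x
  proof -
    have "(\<Sum>y\<in>range s. y * (indicator (s -` {y}) x * ?c x)) = (\<Sum>y\<in>range s. if s x = y then y * ?c x else 0)"
      by (rule sum.cong[OF HOL.refl]) (auto simp: indicator_def)
    also have "\<dots> = s x * ?c x"
      by (subst sum.delta'[OF fin]) simp
    finally show ?thesis .
  qed
  ultimately show ?thesis by simp
qed

lemma approximable_measurable_cutoff:
  assumes f: "f \<in> borel_measurable borel" and fin: "sqnorm N f < \<infinity>"
  shows "approximable (\<lambda>x. f x * of_real (cutoff n (exp (- A x))))"
proof -
  have [measurable]: "f \<in> borel_measurable borel" by (rule f)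
  let ?c = "\<lambda>x. complex_of_real (cutoff n (exp (- A x)))"
  from borel_measurable_implies_sequence_metric[OF f, of 0]
  obtain s where s: "\<forall>i. simple_function borel (s i)" "\<forall>x\<in>space borel. (\<lambda>i. s i x) \<longlonglongrightarrow> f x"
     "\<forall>i. \<forall>x\<in>space borel. dist (s i x) 0 \<le> 2 * dist (f x) 0"
    by blast
  show ?thesis
  proof (rule approximable_dominated[where f = "\<lambda>i x. s i x * ?c x" and G = "\<lambda>x. 2 * f x"])
    show "approximable (\<lambda>x. s i x * ?c x)" for i
      by (rule approximable_simple_cutoff) (rule s(1)[rule_format])
    show "(\<lambda>x. f x * ?c x) \<in> borel_measurable borel" by measurable
    show "(\<lambda>x. 2 * f x) \<in> borel_measurable borel" by measurable
    show "(\<lambda>i. s i x * ?c x) \<longlonglongrightarrow> f x * ?c x" for x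
    proof -
      have "(\<lambda>i. s i x) \<longlonglongrightarrow> f x" using s(2) by simp
      then show ?thesis by (rule tendsto_mult_right)
    qed
    show "norm (s i x * ?c x) \<le> norm (2 * f x)" for i x
    proof -
      have "norm (s i x) \<le> 2 * norm (f x)" using s(3) by simp
      moreover have "norm (s i x) * cutoff n (exp (- A x)) \<le> norm (s i x)"
        using cutoff_bounds by (simp add: mult_left_le)
      moreover have "norm (s i x * ?c x) = norm (s i x) * cutoff n (exp (- A x))"
        using cutoff_bounds by (simp add: norm_mult)
      moreover have "norm (2 * f x) = 2 * norm (f x)" by (simp add: norm_mult)
      ultimately show ?thesis by linarith
    qed
    show "sqnorm N (\<lambda>x. 2 * f x) < \<infinity>"
      using fin by (subst sqnorm_cmult) (auto simp: ennreal_mult_less_top)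
  qed
qed

text \<open>The cutoffs tend to 1, and \<open>f\<close> itself dominates the cut-off
  functions.\<close>

lemma approximable_finite_sqnorm:
  assumes f: "f \<in> borel_measurable borel" and fin: "sqnorm N f < \<infinity>"
  shows "approximable f"
proof (rule approximable_dominated[OF approximable_measurable_cutoff[OF f fin] f _ f _ fin])
  show "(\<lambda>n. f x * of_real (cutoff n (exp (- A x)))) \<longlonglongrightarrow> f x" for x
  proof -
    have "(\<lambda>n. f x * of_real (cutoff n (exp (- A x)))) \<longlonglongrightarrow> f x * of_real 1"
      by (intro tendsto_mult tendsto_const tendsto_of_real cutoff_tendsto) simp
    then show ?thesis by simp
  qed
  show "norm (f x * of_real (cutoff n (exp (- A x)))) \<le> norm (f x)" for n x
    using cutoff_bounds[of n "exp (- A x)"] by (simp add: norm_mult mult_left_le)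
qed

end

end

section \<open>The uncertainty inequality\<close>

text \<open>The scale \<open>t\<close> at which \<open>t powr \<alpha> * x\<close> and
  \<open>t powr (- \<beta>) * y\<close> coincide; the common value is the weighted geometric mean in
  the product inequality.\<close>

lemma powr_balance:
  fixes x y \<alpha> \<beta> :: real
  assumes "x > 0" "y > 0" "\<alpha> > 0" "\<beta> > 0"
  defines "t \<equiv> (y / x) powr (1 / (\<alpha> + \<beta>))"
  shows "t powr \<alpha> * x = x powr (\<beta> / (\<alpha> + \<beta>)) * y powr (\<alpha> / (\<alpha> + \<beta>))"
    and "t powr (- \<beta>) * y = x powr (\<beta> / (\<alpha> + \<beta>)) * y powr (\<alpha> / (\<alpha> + \<beta>))"
proof -
  have e: "\<alpha> / (\<alpha> + \<beta>) = 1 - \<beta> / (\<alpha> + \<beta>)" "\<beta> / (\<alpha> + \<beta>) = 1 - \<alpha> / (\<alpha> + \<beta>)"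
    using assms by (simp_all add: field_simps)
  have "t powr \<alpha> * x = y powr (\<alpha> / (\<alpha> + \<beta>)) * (x powr (1 - \<alpha> / (\<alpha> + \<beta>)))"
    using assms by (simp add: t_def powr_powr powr_divide powr_diff)
  then show "t powr \<alpha> * x = x powr (\<beta> / (\<alpha> + \<beta>)) * y powr (\<alpha> / (\<alpha> + \<beta>))"
    unfolding e(2)[symmetric] by (simp only: mult.commute)
  have "t powr (- \<beta>) = x powr (\<beta> / (\<alpha> + \<beta>)) / y powr (\<beta> / (\<alpha> + \<beta>))"
    using assms by (simp add: t_def powr_powr powr_divide powr_minus)
  then have "t powr (- \<beta>) * y = x powr (\<beta> / (\<alpha> + \<beta>)) * (y powr (1 - \<beta> / (\<alpha> + \<beta>)))"
    using assms by (simp add: powr_diff)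
  then show "t powr (- \<beta>) * y = x powr (\<beta> / (\<alpha> + \<beta>)) * y powr (\<alpha> / (\<alpha> + \<beta>))"
    unfolding e(1)[symmetric] .
qed

lemma min_one_le_powr:
  fixes y s :: real
  assumes "0 \<le> y" "0 < s" "s \<le> 1"
  shows "min 1 y \<le> y powr s"
proof (cases "y \<le> 1")
  case True
  then have "y powr 1 \<le> y powr s"
    using assms powr_mono'[of s 1 y] by blast
  then show ?thesis using assms True by simp
next
  case False
  then have "1 powr s \<le> y powr s" using assms by (intro powr_mono2) auto
  then show ?thesis by simp
qed

lemma nn_integral_two_term_bound:
  assumes [measurable]: "f1 \<in> borel_measurable M" "f2 \<in> borel_measurable M"
    and le: "\<And>x. f x \<le> 2 * f1 x + 2 * f2 x" and nn: "\<And>x. 0 \<le> f1 x" "\<And>x. 0 \<le> f2 x"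
  shows "(\<integral>\<^sup>+x. ennreal (f x) \<partial>M) \<le> 2 * (\<integral>\<^sup>+x. ennreal (f1 x) \<partial>M) + 2 * (\<integral>\<^sup>+x. ennreal (f2 x) \<partial>M)"
proof -
  have "(\<integral>\<^sup>+x. ennreal (f x) \<partial>M) \<le> (\<integral>\<^sup>+x. 2 * ennreal (f1 x) + 2 * ennreal (f2 x) \<partial>M)"
  proof (intro nn_integral_mono)
    fix x
    have "ennreal (f x) \<le> ennreal (2 * f1 x + 2 * f2 x)" by (intro ennreal_leI le)
    then show "ennreal (f x) \<le> 2 * ennreal (f1 x) + 2 * ennreal (f2 x)"
      using nn by (simp add: ennreal_mult)
  qed
  also have "\<dots> = 2 * (\<integral>\<^sup>+x. ennreal (f1 x) \<partial>M) + 2 * (\<integral>\<^sup>+x. ennreal (f2 x) \<partial>M)"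
    by (simp add: nn_integral_add nn_integral_cmult)
  finally show ?thesis .
qed

section \<open>From Gaussian sums to square integrable functions\<close>

context ka_fourier
begin

lemma gauss_span_L2: "gauss_span g \<Longrightarrow> g \<in> L2_functions M"
proof (induction rule: gauss_span.induct)
  case (add g m h z)
  from L2_functions_lincomb[OF add(5) L2_gauss[OF add(2,4)], of 1 1] show ?case by simp
qed (rule L2_functions_zero)

lemma F_zero: "AE x in M. F (\<lambda>x. 0) x = 0"
  using F_cmult[OF L2_functions_zero, of 0] by simp

text \<open>Approximation happens on the transform side, whereas \<open>span_inequality\<close>
  starts from a sum on the original side. A Gaussian of rate \<open>z\<close> is reached from one of
  rate \<open>1 / z\<close> after division by the nonzero factor of \<open>F_gauss\<close>.\<close>

lemma gauss_span_F_preimage: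
  assumes "gauss_span h"
  shows "\<exists>g. gauss_span g \<and> (AE x in M. F g x = h x)"
  using assms
proof (induction rule: gauss_span.induct)
  case zero
  show ?case using F_zero gauss_span.zero by blast
next
  case (add h m q z)
  then obtain g where g: "gauss_span g" "AE x in M. F g x = h x" by blast
  define c where "c = cis (- pi * (real m / a)) * of_real ((1 / z) powr (- ka_lambda P k a m - 1))"
  have c: "c \<noteq> 0" using add(4) by (simp add: c_def)
  have q: "homogeneous_polynomial m (\<lambda>x. inverse c * q x)"
    using homogeneous_polynomial_lincomb[OF homogeneous_polynomial_zero add(2), of "inverse c"] by simp
  have qh: "dunkl_harmonic P k (\<lambda>x. inverse c * q x)"
    by (rule dunkl_harmonic_cmult[OF homogeneous_polynomialD(1)[OF add(2)] add(3)])
  have z: "1 / z > 0" using add(4) by simp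
  let ?q = "gauss (\<lambda>x. inverse c * q x) (1 / z)"
  have "AE x in M. F (\<lambda>y. 1 * g y + 1 * ?q y) x = 1 * F g x + 1 * F ?q x"
    by (rule F_lincomb[OF gauss_span_L2[OF g(1)] L2_gauss[OF q z]])
  moreover have "AE x in M. F ?q x = c * gauss (\<lambda>x. inverse c * q x) z x"
    using F_gauss[OF q qh z] unfolding c_def by simp
  ultimately have "AE x in M. F (\<lambda>y. g y + ?q y) x = h x + gauss q z x"
    using g(2)
  proof eventually_elim
    fix x
    assume "F (\<lambda>y. 1 * g y + 1 * ?q y) x = 1 * F g x + 1 * F ?q x"
      and "F ?q x = c * gauss (\<lambda>x. inverse c * q x) z x" and "F g x = h x"
    then show "F (\<lambda>y. g y + ?q y) x = h x + gauss q z x"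
      using c by (simp add: gauss_def)
  qed
  moreover have "gauss_span (\<lambda>y. g y + ?q y)"
    by (rule gauss_span.add[OF g(1) q qh z])
  ultimately show ?case by blast
qed

text \<open>\<open>u\<close> is \<open>F f\<close> divided by \<open>1 + A x / t\<close>, and
  \<open>g\<close> is a Gaussian sum whose transform \<open>s n\<close> is close to
  \<open>u\<close>. Both the loss \<open>F f - u\<close> and the energy of \<open>u\<close> cost at
  most \<open>min 1 (A x / t)\<close> times the squared modulus of \<open>F f\<close>. So
  \<open>T\<close>, the two truncated integrals plus the error \<open>\<delta>\<close>, controls
  \<open>f - g\<close>, the truncated mass of \<open>g\<close> and its energy; at the end
  \<open>\<delta>\<close> tends to 0.\<close>

lemma uncertainty_sum:
  assumes f: "f \<in> L2_functions M" and t: "t > 0"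
  shows "sqnorm M f \<le> (16 * ennreal (1 + 2 / (hdim / a)) + 4) *
     ((\<integral>\<^sup>+x. ennreal (min 1 (t * A x) * (norm (f x))\<^sup>2) \<partial>M)
      + (\<integral>\<^sup>+x. ennreal (min 1 (A x / t) * (norm (F f x))\<^sup>2) \<partial>M))"
proof -
  define C where "C = ennreal (1 + 2 / (hdim / a))"
  define X where "X = (\<integral>\<^sup>+x. ennreal (min 1 (t * A x) * (norm (f x))\<^sup>2) \<partial>M)"
  define Y where "Y = (\<integral>\<^sup>+x. ennreal (min 1 (A x / t) * (norm (F f x))\<^sup>2) \<partial>M)"
  have Ff: "F f \<in> L2_functions M" by (rule F_L2[OF f])
  have [measurable]: "f \<in> borel_measurable borel" "F f \<in> borel_measurable borel"
    using L2_functions_measurable[OF f] L2_functions_measurable[OF Ff] by auto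
  define b where "b x = 1 / (1 + A x / t)" for x
  have [measurable]: "b \<in> borel_measurable borel" unfolding b_def by measurable
  have At: "A x / t \<ge> 0" for x using A_nonneg t by simp
  have b: "0 < b x" "b x \<le> 1" for x using At[of x] by (auto simp: b_def divide_le_eq_1)
  have bW: "(1 + A x / t) * b x = 1" for x using At[of x] by (simp add: b_def)
  have b1: "A x / t * b x = 1 - b x" for x using bW[of x] by (simp add: distrib_right)
  \<comment> \<open>\<open>1 - b x\<close> equals \<open>A x / t * b x\<close>, hence is at most 1
    and at most \<open>A x / t\<close>; the truncated weight on the transform arises here.\<close>
  have bmin: "1 - b x \<le> min 1 (A x / t)" for x
  proof -
    have "A x / t * b x \<le> A x / t" using At b[of x] by (intro mult_left_le) auto
    then show ?thesis using b1[of x] b(1)[of x] by simp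
  qed
  define u where "u x = of_real (b x) * F f x" for x
  have [measurable]: "u \<in> borel_measurable borel" unfolding u_def by measurable
  \<comment> \<open>The weight \<open>1 + A x / t\<close> cancels one of the two factors
    \<open>b x\<close>.\<close>
  have "sqnorm (N t) u \<le> sqnorm M (F f)"
  proof -
    have "(1 + A x / t) * (norm (u x))\<^sup>2 \<le> (norm (F f x))\<^sup>2" for x
    proof -
      have "(1 + A x / t) * (norm (u x))\<^sup>2 = ((1 + A x / t) * b x) * (b x * (norm (F f x))\<^sup>2)"
        using b(1)[of x] by (simp add: u_def norm_mult power_mult_distrib power2_eq_square)
      also have "\<dots> \<le> (norm (F f x))\<^sup>2"
        unfolding bW using b[of x] by (simp add: mult_left_le_one_le)
      finally show ?thesis .
    qed
    then show ?thesis
      unfolding sqnorm_N[OF t \<open>u \<in> borel_measurable borel\<close>] by (auto simp: sqnorm_def intro!: nn_integral_mono ennreal_leI)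
  qed
  also have "\<dots> < \<infinity>" using Ff by (simp add: L2_functions_iff)
  finally have "approximable t u"
    by (rule approximable_finite_sqnorm[OF t \<open>u \<in> borel_measurable borel\<close>])
  then obtain s where s: "\<And>n. gauss_span (s n)" "(\<lambda>n. sqnorm (N t) (\<lambda>x. u x - s n x)) \<longlonglongrightarrow> 0"
    unfolding approximable_def[OF t] by blast
  have main: "sqnorm M f \<le> (16 * C + 4) * (X + Y + sqnorm (N t) (\<lambda>x. u x - s n x))" for n
  proof -
    define \<delta> where "\<delta> = sqnorm (N t) (\<lambda>x. u x - s n x)"
    define T where "T = X + Y + \<delta>"
    obtain g where g: "gauss_span g" "AE x in M. F g x = s n x"
      using gauss_span_F_preimage[OF s(1)] by blast
    obtain I m p z where adm: "admissible I m p z" and gs: "g = gsum I p z"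
      using gauss_span_gsum[OF g(1)] by blast
    have gL2: "g \<in> L2_functions M" by (rule gauss_span_L2[OF g(1)])
    have [measurable]: "g \<in> borel_measurable borel" "s n \<in> borel_measurable borel"
      by (rule gauss_span_measurable[OF g(1)], rule gauss_span_measurable[OF s(1)])
    have us: "(\<integral>\<^sup>+x. ennreal ((1 + A x / t) * (norm (u x - s n x))\<^sup>2) \<partial>M) = \<delta>"
      unfolding \<delta>_def by (subst sqnorm_N[OF t]) auto
    have Yu: "2 * Y + 2 * \<delta> \<le> 2 * T" unfolding T_def by (simp add: distrib_left add_increasing)
    have XT: "X \<le> T" unfolding T_def by (simp add: add_increasing2 add.assoc)
    define d where "d = sqnorm M (\<lambda>x. f x - g x)"
    have d: "d \<le> 2 * T"
    proof -
      have "AE x in M. F (\<lambda>y. 1 * f y + (-1) * g y) x = 1 * F f x + (-1) * F g x"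
        by (rule F_lincomb[OF f gL2])
      then have "AE x in M. F (\<lambda>y. f y - g y) x = F f x - s n x"
        using g(2) by eventually_elim simp
      then have "sqnorm M (\<lambda>x. F f x - s n x) = sqnorm M (F (\<lambda>y. f y - g y))"
        by (intro sqnorm_cong_AE) (auto elim: eventually_mono)
      also have "\<dots> = d" unfolding d_def by (intro F_sqnorm L2_functions_diff f gL2)
      finally have "d = sqnorm M (\<lambda>x. F f x - s n x)" ..
      also have "\<dots> \<le> 2 * Y + 2 * (\<integral>\<^sup>+x. ennreal ((1 + A x / t) * (norm (u x - s n x))\<^sup>2) \<partial>M)"
        unfolding sqnorm_def Y_def
      proof (rule nn_integral_two_term_bound)
        show "(norm (F f x - s n x))\<^sup>2 \<le> 2 * (min 1 (A x / t) * (norm (F f x))\<^sup>2) + 2 * ((1 + A x / t) * (norm (u x - s n x))\<^sup>2)" for x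
        proof -
          have "(norm (F f x - s n x))\<^sup>2 \<le> 2 * (norm (F f x - u x))\<^sup>2 + 2 * (norm (u x - s n x))\<^sup>2"
            using norm_add_power2_le[of "F f x - u x" "u x - s n x"] by simp
          moreover have "(norm (F f x - u x))\<^sup>2 \<le> min 1 (A x / t) * (norm (F f x))\<^sup>2"
          proof -
            have "F f x - u x = of_real (1 - b x) * F f x" by (simp add: u_def left_diff_distrib)
            then have "(norm (F f x - u x))\<^sup>2 = (1 - b x)\<^sup>2 * (norm (F f x))\<^sup>2"
              by (simp only: norm_mult norm_of_real power_mult_distrib power2_abs)
            also have "(1 - b x)\<^sup>2 \<le> 1 - b x"
              using b[of x] by (simp add: power2_eq_square mult_left_le)
            then have "(1 - b x)\<^sup>2 * (norm (F f x))\<^sup>2 \<le> min 1 (A x / t) * (norm (F f x))\<^sup>2"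
              using bmin[of x] by (intro mult_right_mono) auto
            finally show ?thesis .
          qed
          moreover have "(norm (u x - s n x))\<^sup>2 \<le> (1 + A x / t) * (norm (u x - s n x))\<^sup>2"
            unfolding distrib_right using mult_nonneg_nonneg[OF At zero_le_power2, of x "norm (u x - s n x)"] by linarith
          ultimately show ?thesis by linarith
        qed
      qed (use At in \<open>auto intro!: mult_nonneg_nonneg add_nonneg_nonneg\<close>)
      also have "\<dots> \<le> 2 * T" unfolding us by (rule Yu)
      finally show ?thesis .
    qed
    have R: "(\<integral>\<^sup>+x. ennreal (A x / t * (norm (F g x))\<^sup>2) \<partial>M) \<le> 2 * T"
    proof -
      have "(\<integral>\<^sup>+x. ennreal (A x / t * (norm (F g x))\<^sup>2) \<partial>M) = (\<integral>\<^sup>+x. ennreal (A x / t * (norm (s n x))\<^sup>2) \<partial>M)"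
        by (intro nn_integral_cong_AE) (use g(2) in \<open>eventually_elim, simp\<close>)
      also have "\<dots> \<le> 2 * Y + 2 * (\<integral>\<^sup>+x. ennreal ((1 + A x / t) * (norm (u x - s n x))\<^sup>2) \<partial>M)"
        unfolding Y_def
      proof (rule nn_integral_two_term_bound)
        show "A x / t * (norm (s n x))\<^sup>2 \<le> 2 * (min 1 (A x / t) * (norm (F f x))\<^sup>2) + 2 * ((1 + A x / t) * (norm (u x - s n x))\<^sup>2)" for x
        proof -
          have "(norm (u x + (s n x - u x)))\<^sup>2 \<le> 2 * (norm (u x))\<^sup>2 + 2 * (norm (s n x - u x))\<^sup>2"
            by (rule norm_add_power2_le)
          then have "(norm (s n x))\<^sup>2 \<le> 2 * (norm (u x))\<^sup>2 + 2 * (norm (u x - s n x))\<^sup>2"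
            by (simp add: norm_minus_commute)
          then have "A x / t * (norm (s n x))\<^sup>2 \<le> A x / t * (2 * (norm (u x))\<^sup>2 + 2 * (norm (u x - s n x))\<^sup>2)"
            using At by (rule mult_left_mono)
          also have "\<dots> = 2 * (A x / t * (norm (u x))\<^sup>2) + 2 * (A x / t * (norm (u x - s n x))\<^sup>2)"
            by (simp add: algebra_simps)
          also have "A x / t * (norm (u x))\<^sup>2 \<le> min 1 (A x / t) * (norm (F f x))\<^sup>2"
          proof -
            have "A x / t * (norm (u x))\<^sup>2 = (A x / t * b x) * (b x * (norm (F f x))\<^sup>2)"
              by (simp add: u_def norm_mult power_mult_distrib power2_eq_square)
            also have "\<dots> \<le> min 1 (A x / t) * (norm (F f x))\<^sup>2"
              unfolding b1 using bmin[of x] b[of x] At[of x]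
              by (intro mult_mono) (auto intro: mult_left_le_one_le)
            finally show ?thesis .
          qed
          also have "A x / t * (norm (u x - s n x))\<^sup>2 \<le> (1 + A x / t) * (norm (u x - s n x))\<^sup>2"
            by (intro mult_right_mono) auto
          finally show ?thesis by simp
        qed
      qed (use At in \<open>auto intro!: mult_nonneg_nonneg add_nonneg_nonneg\<close>)
      also have "\<dots> \<le> 2 * T" unfolding us by (rule Yu)
      finally show ?thesis .
    qed
    have P: "(\<integral>\<^sup>+x. ennreal (min 1 (t * A x) * (norm (g x))\<^sup>2) \<partial>M) \<le> 2 * T + 2 * (2 * T)"
    proof -
      have "(\<integral>\<^sup>+x. ennreal (min 1 (t * A x) * (norm (g x))\<^sup>2) \<partial>M) \<le> 2 * X + 2 * d"
        unfolding X_def d_def sqnorm_def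
      proof (rule nn_integral_two_term_bound)
        show "min 1 (t * A x) * (norm (g x))\<^sup>2 \<le> 2 * (min 1 (t * A x) * (norm (f x))\<^sup>2) + 2 * (norm (f x - g x))\<^sup>2" for x
        proof -
          have tA: "0 \<le> min 1 (t * A x)" "min 1 (t * A x) \<le> 1" using t A_nonneg[of x] by auto
          have "(norm (f x + (g x - f x)))\<^sup>2 \<le> 2 * (norm (f x))\<^sup>2 + 2 * (norm (g x - f x))\<^sup>2"
            by (rule norm_add_power2_le)
          then have "(norm (g x))\<^sup>2 \<le> 2 * (norm (f x))\<^sup>2 + 2 * (norm (f x - g x))\<^sup>2"
            by (simp add: norm_minus_commute)
          then have "min 1 (t * A x) * (norm (g x))\<^sup>2 \<le> min 1 (t * A x) * (2 * (norm (f x))\<^sup>2 + 2 * (norm (f x - g x))\<^sup>2)"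
            using tA(1) by (rule mult_left_mono)
          also have "\<dots> = 2 * (min 1 (t * A x) * (norm (f x))\<^sup>2) + 2 * (min 1 (t * A x) * (norm (f x - g x))\<^sup>2)"
            by (simp add: algebra_simps)
          also have "min 1 (t * A x) * (norm (f x - g x))\<^sup>2 \<le> (norm (f x - g x))\<^sup>2"
            using tA by (intro mult_left_le_one_le) auto
          finally show ?thesis by simp
        qed
      qed (use t A_nonneg in auto)
      also have "\<dots> \<le> 2 * T + 2 * (2 * T)"
        by (intro add_mono mult_left_mono XT d) auto
      finally show ?thesis .
    qed
    \<comment> \<open>The bounds \<open>P\<close> and \<open>R\<close> add up to
      \<open>8 * T\<close>. With \<open>d \<le> 2 * T\<close> and the factors 2 of
      \<open>sqnorm_add_le\<close> this makes \<open>16 * C + 4\<close>.\<close>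
    have "sqnorm M g \<le> C * ((2 * T + 2 * (2 * T)) + 2 * T)"
    proof -
      have "sqnorm M g \<le> C * ((\<integral>\<^sup>+x. ennreal (min 1 (t * A x) * (norm (g x))\<^sup>2) \<partial>M)
          + (\<integral>\<^sup>+x. ennreal (A x / t * (norm (F g x))\<^sup>2) \<partial>M))"
        unfolding C_def gs by (rule span_inequality[OF adm t])
      also have "\<dots> \<le> C * ((2 * T + 2 * (2 * T)) + 2 * T)"
        by (intro mult_left_mono add_mono P R) auto
      finally show ?thesis .
    qed
    also have "C * ((2 * T + 2 * (2 * T)) + 2 * T) = 8 * C * T"
      by (simp add: mult.assoc[symmetric] distrib_right[symmetric] del: distrib_right_numeral)
         (simp add: mult.commute mult.left_commute)
    finally have "2 * sqnorm M g + 2 * d \<le> 2 * (8 * C * T) + 2 * (2 * T)"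
      by (intro add_mono mult_left_mono d) auto
    moreover have "sqnorm M f \<le> 2 * sqnorm M g + 2 * d"
      using sqnorm_add_le[of g M "\<lambda>x. f x - g x"] unfolding d_def by simp
    ultimately have "sqnorm M f \<le> 2 * (8 * C * T) + 2 * (2 * T)" by (rule order.trans[rotated])
    also have "\<dots> = (16 * C + 4) * T"
      by (simp add: distrib_right mult.assoc[symmetric])
    finally show ?thesis unfolding T_def \<delta>_def .
  qed
  \<comment> \<open>The limit may be taken inside the product because the constant is
    finite.\<close>
  have "(\<lambda>n. (16 * C + 4) * (X + Y + sqnorm (N t) (\<lambda>x. u x - s n x))) \<longlonglongrightarrow> (16 * C + 4) * (X + Y + 0)"
    by (intro ennreal_tendsto_cmult tendsto_add tendsto_const s(2)) (simp add: C_def ennreal_mult_less_top)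
  from LIMSEQ_le_const[OF this, of "sqnorm M f"] main
  have "sqnorm M f \<le> (16 * C + 4) * (X + Y)" by auto
  then show ?thesis unfolding C_def X_def Y_def .
qed

section \<open>Power weights and the optimal scale\<close>

lemma min_weight_le:
  assumes [measurable]: "h \<in> borel_measurable borel" and s: "0 < s" "s \<le> 1" and t: "t > 0"
  shows "(\<integral>\<^sup>+x. ennreal (min 1 (t * A x) * (norm (h x))\<^sup>2) \<partial>M)
    \<le> ennreal (t powr s * a powr (- s)) * sqnorm M (\<lambda>x. of_real (norm x powr (s * (a / 2))) * h x)"
proof -
  have "(\<integral>\<^sup>+x. ennreal (min 1 (t * A x) * (norm (h x))\<^sup>2) \<partial>M)
    \<le> (\<integral>\<^sup>+x. ennreal (t powr s * a powr (- s)) * ennreal ((norm (of_real (norm x powr (s * (a / 2))) * h x))\<^sup>2) \<partial>M)"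
  proof (intro nn_integral_mono)
    fix x
    have "min 1 (t * A x) \<le> (t * A x) powr s"
      using t A_nonneg s by (intro min_one_le_powr) auto
    also have "\<dots> = t powr s * (norm x powr a) powr s * a powr (- s)"
      using t a_pos by (simp add: A_def powr_mult powr_divide powr_minus_divide)
    \<comment> \<open>The exponent \<open>a / 2\<close> of the weight turns into \<open>a\<close>
      when squared, which matches \<open>A x\<close>.\<close>
    also have "(norm x powr a) powr s = (norm x powr (s * (a / 2)))\<^sup>2"
      by (simp add: powr_powr power2_eq_square mult.commute flip: powr_add)
    finally have "min 1 (t * A x) * (norm (h x))\<^sup>2 \<le> t powr s * (norm x powr (s * (a / 2)))\<^sup>2 * a powr (- s) * (norm (h x))\<^sup>2"
      by (rule mult_right_mono) simp
    also have "\<dots> = (t powr s * a powr (- s)) * (norm (of_real (norm x powr (s * (a / 2))) * h x))\<^sup>2"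
      by (simp add: norm_mult power_mult_distrib)
    finally show "ennreal (min 1 (t * A x) * (norm (h x))\<^sup>2)
      \<le> ennreal (t powr s * a powr (- s)) * ennreal ((norm (of_real (norm x powr (s * (a / 2))) * h x))\<^sup>2)"
      by (subst ennreal_mult[symmetric]) (auto intro: ennreal_leI)
  qed
  also have "\<dots> = ennreal (t powr s * a powr (- s)) * sqnorm M (\<lambda>x. of_real (norm x powr (s * (a / 2))) * h x)"
    unfolding sqnorm_def by (rule nn_integral_cmult) measurable
  finally show ?thesis .
qed

text \<open>The weight vanishes only at the origin, a point that \<open>M\<close> does not
  charge.\<close>

lemma weighted_sqnorm_zero_imp:
  assumes h: "h \<in> L2_functions M" and z: "sqnorm M (\<lambda>x. of_real (norm x powr r) * h x) = 0"
  shows "sqnorm M h = 0"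
proof -
  have [measurable]: "h \<in> borel_measurable borel" using L2_functions_measurable[OF h] by simp
  have "AE x in M. of_real (norm x powr r) * h x = 0"
    using z by (subst (asm) sqnorm_eq_0_iff) auto
  then have "AE x in M. h x = 0"
    using AE_M_nonzero by eventually_elim simp
  then show ?thesis by (subst sqnorm_eq_0_iff) auto
qed

text \<open>At the scale of \<open>powr_balance\<close> the two terms of the sum bound are multiples
  of one product, and a square root gives the claim. Degenerate cases are split off first, since
  this scale requires both weighted norms to be positive and finite.\<close>

theorem uncertainty_product:
  assumes \<alpha>: "0 < \<alpha>" "\<alpha> \<le> 1" and \<beta>: "0 < \<beta>" "\<beta> \<le> 1"
  shows "\<exists>c::real. c > 0 \<and> (\<forall>f \<in> L2_functions M.
       ennreal_powr (L2_norm_ennreal M (\<lambda>x. of_real (norm x powr (\<alpha> * (a / 2))) * f x)) (\<beta> / (\<alpha> + \<beta>))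
       * ennreal_powr (L2_norm_ennreal M (\<lambda>x. of_real (norm x powr (\<beta> * (a / 2))) * F f x)) (\<alpha> / (\<alpha> + \<beta>))
       \<ge> ennreal c * L2_norm_ennreal M f)"
proof -
  \<comment> \<open>\<open>K\<close> is the constant of \<open>uncertainty_sum\<close> as a real
    number. \<open>L\<close> adds the factors in \<open>a\<close> caused by the normalisation of
    \<open>A\<close>, and \<open>c\<close> is the inverse square root of \<open>L\<close> because
    \<open>sqnorm\<close> is squared.\<close>
  define K where "K = 16 * (1 + 2 / (hdim / a)) + 4"
  have h: "hdim / a > 0" using hdim_pos a_pos by simp
  have h2: "2 / (hdim / a) > 0" by (rule divide_pos_pos[OF zero_less_numeral h])
  have K: "K > 0"
    unfolding K_def by (intro add_pos_pos mult_pos_pos zero_less_numeral zero_less_one h2)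
  have "16 * ennreal r + 4 = ennreal (16 * r + 4)" if "r \<ge> 0" for r
    using that by (simp add: ennreal_mult)
  from this[of "1 + 2 / (hdim / a)"] h2
  have eK: "16 * ennreal (1 + 2 / (hdim / a)) + 4 = ennreal K"
    unfolding K_def by linarith
  define L where "L = K * (a powr (- \<alpha>) + a powr (- \<beta>))"
  have L: "L > 0" using K a_pos by (simp add: L_def add_pos_pos)
  define c where "c = 1 / sqrt L"
  have c: "c > 0" using L by (simp add: c_def)
  have pos: "\<beta> / (\<alpha> + \<beta>) > 0" "\<alpha> / (\<alpha> + \<beta>) > 0" using \<alpha> \<beta> by auto
  have norm_eq: "L2_norm_ennreal M f = ennreal_powr (sqnorm M f) (1 / 2)" for f :: "'a \<Rightarrow> complex"
    by (simp add: L2_norm_ennreal_def sqnorm_def)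
  have "ennreal c * L2_norm_ennreal M f
     \<le> ennreal_powr (L2_norm_ennreal M (\<lambda>x. of_real (norm x powr (\<alpha> * (a / 2))) * f x)) (\<beta> / (\<alpha> + \<beta>))
       * ennreal_powr (L2_norm_ennreal M (\<lambda>x. of_real (norm x powr (\<beta> * (a / 2))) * F f x)) (\<alpha> / (\<alpha> + \<beta>))"
    if f: "f \<in> L2_functions M" for f
  proof -
    have Ff: "F f \<in> L2_functions M" by (rule F_L2[OF f])
    have [measurable]: "f \<in> borel_measurable borel" "F f \<in> borel_measurable borel"
      using L2_functions_measurable[OF f] L2_functions_measurable[OF Ff] by auto
    define X where "X = sqnorm M (\<lambda>x. of_real (norm x powr (\<alpha> * (a / 2))) * f x)"
    define Y where "Y = sqnorm M (\<lambda>x. of_real (norm x powr (\<beta> * (a / 2))) * F f x)"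
    have bound: "sqnorm M f \<le> ennreal K * (ennreal (t powr \<alpha> * a powr (- \<alpha>)) * X + ennreal (t powr (- \<beta>) * a powr (- \<beta>)) * Y)"
      if t: "t > 0" for t
    proof -
      have "sqnorm M f \<le> ennreal K * ((\<integral>\<^sup>+x. ennreal (min 1 (t * A x) * (norm (f x))\<^sup>2) \<partial>M)
         + (\<integral>\<^sup>+x. ennreal (min 1 (A x / t) * (norm (F f x))\<^sup>2) \<partial>M))"
        unfolding eK[symmetric] by (rule uncertainty_sum[OF f t])
      also have "\<dots> \<le> ennreal K * (ennreal (t powr \<alpha> * a powr (- \<alpha>)) * X + ennreal (t powr (- \<beta>) * a powr (- \<beta>)) * Y)"
      proof (intro mult_left_mono add_mono)
        show "(\<integral>\<^sup>+x. ennreal (min 1 (t * A x) * (norm (f x))\<^sup>2) \<partial>M) \<le> ennreal (t powr \<alpha> * a powr (- \<alpha>)) * X"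
          unfolding X_def by (rule min_weight_le[OF _ \<alpha> t]) measurable
        \<comment> \<open>The same estimate at the scale \<open>1 / t\<close>, the source of the
          negative power of \<open>t\<close>.\<close>
        have "(\<integral>\<^sup>+x. ennreal (min 1 (1 / t * A x) * (norm (F f x))\<^sup>2) \<partial>M) \<le> ennreal ((1 / t) powr \<beta> * a powr (- \<beta>)) * Y"
          unfolding Y_def by (rule min_weight_le[OF _ \<beta>]) (use t in auto)
        then show "(\<integral>\<^sup>+x. ennreal (min 1 (A x / t) * (norm (F f x))\<^sup>2) \<partial>M) \<le> ennreal (t powr (- \<beta>) * a powr (- \<beta>)) * Y"
          using t by (simp add: powr_divide powr_minus_divide)
      qed auto
      finally show ?thesis .
    qed
    show ?thesis
    proof (cases "sqnorm M f = 0")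
      case True
      then show ?thesis by (simp add: norm_eq ennreal_powr_def)
    next
      case False
      \<comment> \<open>In \<open>ennreal\<close> zero times infinity is zero, so the infinite case
        below needs both factors nonzero. A vanishing weighted norm would force \<open>f\<close> to
        vanish almost everywhere.\<close>
      then have X0: "X \<noteq> 0" unfolding X_def using weighted_sqnorm_zero_imp[OF f] by blast
      have Y0: "Y \<noteq> 0"
        unfolding Y_def using weighted_sqnorm_zero_imp[OF Ff] False F_sqnorm[OF f] by metis
      have nz: "ennreal_powr (ennreal_powr Z (1 / 2)) r \<noteq> 0" if "Z \<noteq> 0" for Z r
        using that by (cases Z) (auto simp: ennreal_powr_def)
      have norms: "L2_norm_ennreal M (\<lambda>x. of_real (norm x powr (\<alpha> * (a / 2))) * f x) = ennreal_powr X (1 / 2)"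
        "L2_norm_ennreal M (\<lambda>x. of_real (norm x powr (\<beta> * (a / 2))) * F f x) = ennreal_powr Y (1 / 2)"
        unfolding norm_eq X_def Y_def by simp_all
      show ?thesis
      proof (cases "X = \<infinity> \<or> Y = \<infinity>")
        case True
        then have "ennreal_powr (ennreal_powr X (1 / 2)) (\<beta> / (\<alpha> + \<beta>)) * ennreal_powr (ennreal_powr Y (1 / 2)) (\<alpha> / (\<alpha> + \<beta>)) = \<infinity>"
        proof -
          have "ennreal_powr top r = top" for r by (simp add: ennreal_powr_def)
          then show ?thesis using True nz[OF X0] nz[OF Y0] by (auto simp: ennreal_mult_eq_top_iff)
        qed
        then show ?thesis unfolding norms by simp
      next
        case False
        then obtain x y where xy: "X = ennreal x" "x \<ge> 0" "Y = ennreal y" "y \<ge> 0"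
          by (metis ennreal_cases infinity_ennreal_def)
        then have xy0: "x > 0" "y > 0" using X0 Y0 by (auto simp: less_le)
        define t where "t = (y / x) powr (1 / (\<alpha> + \<beta>))"
        have t: "t > 0" using xy0 by (simp add: t_def)
        define Z where "Z = x powr (\<beta> / (\<alpha> + \<beta>)) * y powr (\<alpha> / (\<alpha> + \<beta>))"
        have Z: "Z \<ge> 0" by (simp add: Z_def)
        have bal: "t powr \<alpha> * x = Z" "t powr (- \<beta>) * y = Z"
          unfolding t_def Z_def using powr_balance[OF xy0 \<alpha>(1) \<beta>(1)] by auto
        define sf where "sf = (LINT x|M. (norm (f x))\<^sup>2)"
        have sf: "sqnorm M f = ennreal sf" "sf \<ge> 0"
          unfolding sf_def by (auto simp: sqnorm_eq_integral[OF f])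
        have "ennreal sf \<le> ennreal (K * (t powr \<alpha> * a powr (- \<alpha>) * x + t powr (- \<beta>) * a powr (- \<beta>) * y))"
          using bound[OF t] K xy unfolding sf by (simp add: ennreal_mult ennreal_plus)
        then have "sf \<le> K * (t powr \<alpha> * a powr (- \<alpha>) * x + t powr (- \<beta>) * a powr (- \<beta>) * y)"
          using K xy by (subst (asm) ennreal_le_iff) auto
        also have "\<dots> = K * (a powr (- \<alpha>) * (t powr \<alpha> * x) + a powr (- \<beta>) * (t powr (- \<beta>) * y))"
          by (simp only: mult_ac)
        also have "\<dots> = L * Z" unfolding bal L_def by (simp only: distrib_right mult.assoc)
        finally have "sqrt sf \<le> sqrt L * sqrt Z" by (simp add: real_sqrt_mult[symmetric])
        then have "c * sqrt sf \<le> sqrt Z" using L by (simp add: c_def field_simps)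
        also have "sqrt Z = (x powr (1 / 2)) powr (\<beta> / (\<alpha> + \<beta>)) * (y powr (1 / 2)) powr (\<alpha> / (\<alpha> + \<beta>))"
          unfolding Z_def using xy0 by (simp add: real_sqrt_mult powr_half_sqrt[symmetric] powr_powr mult.commute)
        finally have "ennreal (c * sqrt sf) \<le> ennreal ((x powr (1 / 2)) powr (\<beta> / (\<alpha> + \<beta>)) * (y powr (1 / 2)) powr (\<alpha> / (\<alpha> + \<beta>)))"
          by (rule ennreal_leI)
        moreover have "ennreal c * L2_norm_ennreal M f = ennreal (c * sqrt sf)"
          unfolding norm_eq sf(1) using sf(2) c by (simp add: ennreal_powr_def powr_half_sqrt ennreal_mult)
        moreover have "ennreal_powr (ennreal_powr X (1 / 2)) (\<beta> / (\<alpha> + \<beta>)) * ennreal_powr (ennreal_powr Y (1 / 2)) (\<alpha> / (\<alpha> + \<beta>))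
           = ennreal ((x powr (1 / 2)) powr (\<beta> / (\<alpha> + \<beta>)) * (y powr (1 / 2)) powr (\<alpha> / (\<alpha> + \<beta>)))"
          unfolding xy(1,3) using xy by (simp add: ennreal_powr_def ennreal_mult)
        ultimately show ?thesis unfolding norms by simp
      qed
    qed
  qed
  with c show ?thesis by blast
qed

end

theorem theorem5p5:
  fixes R P :: "(real ^ 'n) set"
    and k :: "real ^ 'n \<Rightarrow> real"
    and a \<alpha> \<beta> :: real
    and F :: "(real ^ 'n \<Rightarrow> complex) \<Rightarrow> (real ^ 'n \<Rightarrow> complex)"
  assumes "reduced_root_system R"
    and "positive_subsystem R P"
    and "multiplicity_function R k"
    and "a > 0"
    and "a + 2 * (\<Sum>\<gamma>\<in>P. k \<gamma>) + real CARD('n) > 2"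
    and "is_ka_fourier P k a F"
    and "0 < \<alpha>" and "\<alpha> < 1" and "0 < \<beta>" and "\<beta> < 1"
    and "CARD('n) = 1
         \<or> (CARD('n) \<ge> 2 \<and> (a = 1 \<or> a = 2))
         \<or> (CARD('n) = 2 \<and> (\<forall>\<gamma>\<in>R. k \<gamma> = 0) \<and> (\<exists>n::nat. n \<ge> 1 \<and> a = 2 / real n))"
  shows "\<exists>c::real. c > 0 \<and>
    (\<forall>f \<in> L2_functions (ka_measure P k a).
       ennreal_powr (L2_norm_ennreal (ka_measure P k a)
           (\<lambda>x. of_real (norm x powr (\<alpha> * (a / 2))) * f x)) (\<beta> / (\<alpha> + \<beta>))
       * ennreal_powr (L2_norm_ennreal (ka_measure P k a)
           (\<lambda>x. of_real (norm x powr (\<beta> * (a / 2))) * F f x)) (\<alpha> / (\<alpha> + \<beta>))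
       \<ge> ennreal c * L2_norm_ennreal (ka_measure P k a) f)"
proof -
  have PR: "P \<subseteq> R" using assms(2) unfolding positive_subsystem_def by auto
  have "finite R" "0 \<notin> R" using assms(1) unfolding reduced_root_system_def by auto
  with PR have "finite P" "0 \<notin> P" by (auto intro: finite_subset)
  moreover have "0 \<le> k \<gamma>" if "\<gamma> \<in> P" for \<gamma>
    using assms(3) PR that unfolding multiplicity_function_def by auto
  ultimately interpret ka_fourier P k a F
    using assms(4-6) by unfold_locales auto
  show ?thesis
    using uncertainty_product[of \<alpha> \<beta>] assms(7-10) by simp
qed

end
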